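(* Let $(E,\mathcal{P})$ be a random locally convex module over $\mathbb{R}$ with base $(\Omega,\mathcal{F},P)$ such that $E$ has the countable concatenation property. If $f$ is a proper, $\mathcal{T}_c$-lower semicontinuous $L^0$-convex function from $E$ to $\bar L^0(\mathcal{F})$, then $f^{\ast\ast}_c=f$.
   Context: $(\Omega,\mathcal{F},P)$ is a probability space. $L^0(\mathcal{F})$ (resp. $\bar L^0(\mathcal{F})$) is the set of equivalence classes (a.s. equality) of real (resp. extended real)-valued $\mathcal{F}$-measurable random variables, with the a.s. order; $\bar L^0(\mathcal{F})$ is a complete lattice, with suprema $\bigvee$ and infima $\bigwedge$. $L^0_+(\mathcal{F})=\{\xi\in L^0(\mathcal{F}):\xi\ge0\}$, $L^0_{++}(\mathcal{F})=\{\xi\in L^0(\mathcal{F}):\xi>0\text{ a.s.}\}$; $\tilde I_A$ is the class of the indicator of $A\in\mathcal{F}$. "$\xi<\eta$ on $A$" means $\xi(\omega)<\eta(\omega)$ for $P$-almost all $\omega\in A$. A countable partition $\{A_n,n\in\mathbb{N}\}$ of $\Omega$ to $\mathcal{F}$ is a sequence of pairwise disjoint members of $\mathcal{F}$ with union $\Omega$. Random locally convex module over $\mathbb{R}$ with base $(\Omega,\mathcal{F},P)$: a pair $(E,\mathcal{P})$ with $E$ an $L^0(\mathcal{F})$-module and $\mathcal{P}$ a family of $L^0$-seminorms on $E$ (maps $\|\cdot\|:E\to L^0_+(\mathcal{F})$ with $\|\xi x\|=|\xi|\|x\|$ for $\xi\in L^0(\mathcal{F})$ and $\|x+y\|\le\|x\|+\|y\|$)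 such that $\bigvee\{\|x\|:\|\cdot\|\in\mathcal{P}\}=0$ iff $x=\theta$ (null element). $\mathcal{P}_f$ is the family of (nonempty) finite subsets of $\mathcal{P}$, and $\|x\|_{\mathcal{Q}}=\bigvee\{\|x\|:\|\cdot\|\in\mathcal{Q}\}$. The locally $L^0$-convex topology $\mathcal{T}_c$ on $E$ has local base at $\theta$: $\{x:\|x\|_{\mathcal{Q}}\le\varepsilon\}$, $\mathcal{Q}\in\mathcal{P}_f$, $\varepsilon\in L^0_{++}(\mathcal{F})$; $L^0(\mathcal{F})$ carries its own $\mathcal{T}_c$ determined by $|\cdot|$. $E^\ast_c$ is the set of continuous module homomorphisms from $(E,\mathcal{T}_c)$ to $(L^0(\mathcal{F}),\mathcal{T}_c)$. $E$ has the countable concatenation property if for each sequence $\{x_n\}$ in $E$ and each countable partition $\{A_n\}$ of $\Omega$ to $\mathcal{F}$ there is $x\in E$ with $\tilde I_{A_n}x=\tilde I_{A_n}x_n$ for all $n$. For $f:E\to\bar L^0(\mathcal{F})$: $dom(f)=\{x\in E: f(x)<+\infty\text{ on }\Omega\}$, $epi(f)=\{(x,r)\in E\times L^0(\mathcal{F}):f(x)\le r\}$. $f$ is proper if $dom(f)\ne\emptyset$ and $f(x)>-\infty$ on $\Omega$ for all $x\in E$. $f$ is $L^0$-convex if $f(\xi x+(1-\xi)y)\le\xi f(x)+(1-\xi)f(y)$ for all $x,y\in E$, $\xi\in L^0_+(\mathcal{F})$ with $0\le\xi\le1$, with the conventions $0\cdot(\pm\infty)=0$ and $+\infty\pm(\pm\infty)=+\infty$.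 A proper $f$ is $\mathcal{T}_c$-lower semicontinuous if $epi(f)$ is closed in $(E,\mathcal{T}_c)\times(L^0(\mathcal{F}),\mathcal{T}_c)$. $f^\ast_c(g)=\bigvee\{g(x)-f(x):x\in E\}$ for $g\in E^\ast_c$, and $f^{\ast\ast}_c(x)=\bigvee\{g(x)-f^\ast_c(g):g\in E^\ast_c\}$ for $x\in E$. *)

theory Defs
  imports "HOL-Probability.Probability" "HOL-Algebra.Module"
begin

section \<open>Random variables modulo almost sure equality\<close>

definition ae_rel :: "'w measure \<Rightarrow> (('w \<Rightarrow> 'b::topological_space) \<times> ('w \<Rightarrow> 'b)) set" where
  "ae_rel M = {(X, Y). X \<in> borel_measurable M \<and> Y \<in> borel_measurable M \<and> (AE w in M. X w = Y w)}"

definition ae_class :: "'w measure \<Rightarrow> ('w \<Rightarrow> 'b::topological_space) \<Rightarrow> ('w \<Rightarrow> 'b) set" where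
  "ae_class M X = ae_rel M `` {X}"

text \<open>A representative of a class. All operations below are defined on representatives; since they
  are compatible with a.s. equality, the choice is immaterial.\<close>

definition rep :: "('w \<Rightarrow> 'b) set \<Rightarrow> 'w \<Rightarrow> 'b" where
  "rep a = (SOME X. X \<in> a)"

text \<open>One record serves as the ring $L^0$ and as the module $L^0$ over itself.\<close>

definition L0 :: "'w measure \<Rightarrow> (('w \<Rightarrow> real) set, ('w \<Rightarrow> real) set) module" where
  "L0 M = \<lparr> carrier = borel_measurable M // ae_rel M,
            mult = (\<lambda>a b. ae_class M (\<lambda>w. rep a w * rep b w)),
            one = ae_class M (\<lambda>_. 1),
            zero = ae_class M (\<lambda>_. 0),
            add = (\<lambda>a b. ae_class M (\<lambda>w. rep a w + rep b w)),
            smult = (\<lambda>a b. ae_class M (\<lambda>w. rep a w * rep b w)) \<rparr>"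

definition as_le :: "'w measure \<Rightarrow> ('w \<Rightarrow> 'b::order) set \<Rightarrow> ('w \<Rightarrow> 'b) set \<Rightarrow> bool" where
  "as_le M a b \<longleftrightarrow> (AE w in M. rep a w \<le> rep b w)"

definition L0_abs :: "'w measure \<Rightarrow> ('w \<Rightarrow> real) set \<Rightarrow> ('w \<Rightarrow> real) set" where
  "L0_abs M a = ae_class M (\<lambda>w. \<bar>rep a w\<bar>)"

definition L0_ind :: "'w measure \<Rightarrow> 'w set \<Rightarrow> ('w \<Rightarrow> real) set" where
  "L0_ind M A = ae_class M (indicator A)"

definition L0_nonneg :: "'w measure \<Rightarrow> ('w \<Rightarrow> real) set set" where
  "L0_nonneg M = {a \<in> carrier (L0 M). as_le M \<zero>\<^bsub>L0 M\<^esub> a}"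

definition L0_pos :: "'w measure \<Rightarrow> ('w \<Rightarrow> real) set set" where
  "L0_pos M = {a \<in> carrier (L0 M). AE w in M. 0 < rep a w}"

text \<open>The complete lattice of classes of extended real random variables; \<open>\<Squnion>\<^bsub>L0bar M\<^esub>\<close> is
  the supremum for the a.s. order (the essential supremum), also of uncountable families.\<close>

definition L0bar :: "'w measure \<Rightarrow> ('w \<Rightarrow> ereal) set gorder" where
  "L0bar M = \<lparr> carrier = borel_measurable M // ae_rel M, eq = (=), le = as_le M \<rparr>"

definition to_L0bar :: "'w measure \<Rightarrow> ('w \<Rightarrow> real) set \<Rightarrow> ('w \<Rightarrow> ereal) set" where
  "to_L0bar M a = ae_class M (\<lambda>w. ereal (rep a w))"

text \<open>The arithmetic of \<^typ>\<open>ereal\<close> has exactly the conventions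
  $0\cdot(\pm\infty) = 0$ and $+\infty \pm (\pm\infty) = +\infty$ of random convex analysis.\<close>

definition L0bar_add :: "'w measure \<Rightarrow> ('w \<Rightarrow> ereal) set \<Rightarrow> ('w \<Rightarrow> ereal) set \<Rightarrow> ('w \<Rightarrow> ereal) set" where
  "L0bar_add M a b = ae_class M (\<lambda>w. rep a w + rep b w)"

definition L0bar_diff :: "'w measure \<Rightarrow> ('w \<Rightarrow> ereal) set \<Rightarrow> ('w \<Rightarrow> ereal) set \<Rightarrow> ('w \<Rightarrow> ereal) set" where
  "L0bar_diff M a b = ae_class M (\<lambda>w. rep a w - rep b w)"

definition L0bar_mult :: "'w measure \<Rightarrow> ('w \<Rightarrow> ereal) set \<Rightarrow> ('w \<Rightarrow> ereal) set \<Rightarrow> ('w \<Rightarrow> ereal) set" where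
  "L0bar_mult M a b = ae_class M (\<lambda>w. rep a w * rep b w)"


section \<open>Random locally convex modules\<close>

definition L0_seminorm ::
  "'w measure \<Rightarrow> (('w \<Rightarrow> real) set, 'e) module \<Rightarrow> ('e \<Rightarrow> ('w \<Rightarrow> real) set) \<Rightarrow> bool" where
  "L0_seminorm M E p \<longleftrightarrow>
     p \<in> carrier E \<rightarrow> L0_nonneg M \<and>
     (\<forall>a\<in>carrier (L0 M). \<forall>x\<in>carrier E. p (a \<odot>\<^bsub>E\<^esub> x) = L0_abs M a \<otimes>\<^bsub>L0 M\<^esub> p x) \<and>
     (\<forall>x\<in>carrier E. \<forall>y\<in>carrier E. as_le M (p (x \<oplus>\<^bsub>E\<^esub> y)) (p x \<oplus>\<^bsub>L0 M\<^esub> p y))"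

definition seminorm_sup ::
  "'w measure \<Rightarrow> ('e \<Rightarrow> ('w \<Rightarrow> real) set) set \<Rightarrow> 'e \<Rightarrow> ('w \<Rightarrow> ereal) set" where
  "seminorm_sup M Q x = \<Squnion>\<^bsub>L0bar M\<^esub> ((\<lambda>p. to_L0bar M (p x)) ` Q)"

text \<open>The family \<open>P\<close> is automatically nonempty: the empty supremum in \<open>L0bar M\<close> is $-\infty$, not 0.\<close>

locale random_locally_convex_module =
  prob_space M + module "L0 M" E
  for M :: "'w measure" and E :: "(('w \<Rightarrow> real) set, 'e) module" +
  fixes P :: "('e \<Rightarrow> ('w \<Rightarrow> real) set) set"
  assumes seminorms: "\<And>p. p \<in> P \<Longrightarrow> L0_seminorm M E p"
    and separating: "\<And>x. x \<in> carrier E \<Longrightarrow>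
      seminorm_sup M P x = to_L0bar M \<zero>\<^bsub>L0 M\<^esub> \<longleftrightarrow> x = \<zero>\<^bsub>E\<^esub>"

definition Tc_nbhd ::
  "'w measure \<Rightarrow> (('w \<Rightarrow> real) set, 'e) module \<Rightarrow> ('e \<Rightarrow> ('w \<Rightarrow> real) set) set
     \<Rightarrow> ('w \<Rightarrow> real) set \<Rightarrow> 'e set" where
  "Tc_nbhd M E Q \<epsilon> = {x \<in> carrier E. seminorm_sup M Q x \<sqsubseteq>\<^bsub>L0bar M\<^esub> to_L0bar M \<epsilon>}"

text \<open>The translation invariant topology for which the sets \<open>Tc_nbhd M E Q \<epsilon>\<close> form a base of
  neighbourhoods of the null element.\<close>

definition Tc ::
  "'w measure \<Rightarrow> (('w \<Rightarrow> real) set, 'e) module \<Rightarrow> ('e \<Rightarrow> ('w \<Rightarrow> real) set) set \<Rightarrow> 'e topology" where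
  "Tc M E P = topology (\<lambda>U. U \<subseteq> carrier E \<and>
     (\<forall>x\<in>U. \<exists>Q \<epsilon>. finite Q \<and> Q \<noteq> {} \<and> Q \<subseteq> P \<and> \<epsilon> \<in> L0_pos M \<and>
        (\<forall>y\<in>Tc_nbhd M E Q \<epsilon>. x \<oplus>\<^bsub>E\<^esub> y \<in> U)))"

abbreviation Tc_L0 :: "'w measure \<Rightarrow> ('w \<Rightarrow> real) set topology" where
  "Tc_L0 M \<equiv> Tc M (L0 M) {L0_abs M}"

definition dual_c ::
  "'w measure \<Rightarrow> (('w \<Rightarrow> real) set, 'e) module \<Rightarrow> ('e \<Rightarrow> ('w \<Rightarrow> real) set) set
     \<Rightarrow> ('e \<Rightarrow> ('w \<Rightarrow> real) set) set" where
  "dual_c M E P = {g \<in> carrier E \<rightarrow> carrier (L0 M).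
     (\<forall>x\<in>carrier E. \<forall>y\<in>carrier E. g (x \<oplus>\<^bsub>E\<^esub> y) = g x \<oplus>\<^bsub>L0 M\<^esub> g y) \<and>
     (\<forall>a\<in>carrier (L0 M). \<forall>x\<in>carrier E. g (a \<odot>\<^bsub>E\<^esub> x) = a \<otimes>\<^bsub>L0 M\<^esub> g x) \<and>
     continuous_map (Tc M E P) (Tc_L0 M) g}"

definition countable_concatenation :: "'w measure \<Rightarrow> (('w \<Rightarrow> real) set, 'e) module \<Rightarrow> bool" where
  "countable_concatenation M E \<longleftrightarrow>
     (\<forall>(X :: nat \<Rightarrow> 'e) (A :: nat \<Rightarrow> 'w set).
        range X \<subseteq> carrier E \<and> range A \<subseteq> sets M \<and> disjoint_family A \<and> (\<Union>n. A n) = space M \<longrightarrow>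
        (\<exists>x\<in>carrier E. \<forall>n. L0_ind M (A n) \<odot>\<^bsub>E\<^esub> x = L0_ind M (A n) \<odot>\<^bsub>E\<^esub> X n))"


section \<open>Convex functions and conjugates\<close>

definition dom_fun ::
  "'w measure \<Rightarrow> (('w \<Rightarrow> real) set, 'e) module \<Rightarrow> ('e \<Rightarrow> ('w \<Rightarrow> ereal) set) \<Rightarrow> 'e set" where
  "dom_fun M E f = {x \<in> carrier E. AE w in M. rep (f x) w < \<infinity>}"

definition epi_fun ::
  "'w measure \<Rightarrow> (('w \<Rightarrow> real) set, 'e) module \<Rightarrow> ('e \<Rightarrow> ('w \<Rightarrow> ereal) set)
     \<Rightarrow> ('e \<times> ('w \<Rightarrow> real) set) set" where
  "epi_fun M E f = {(x, r). x \<in> carrier E \<and> r \<in> carrier (L0 M) \<and> f x \<sqsubseteq>\<^bsub>L0bar M\<^esub> to_L0bar M r}"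

definition proper_fun ::
  "'w measure \<Rightarrow> (('w \<Rightarrow> real) set, 'e) module \<Rightarrow> ('e \<Rightarrow> ('w \<Rightarrow> ereal) set) \<Rightarrow> bool" where
  "proper_fun M E f \<longleftrightarrow> dom_fun M E f \<noteq> {} \<and> (\<forall>x\<in>carrier E. AE w in M. -\<infinity> < rep (f x) w)"

definition L0_convex ::
  "'w measure \<Rightarrow> (('w \<Rightarrow> real) set, 'e) module \<Rightarrow> ('e \<Rightarrow> ('w \<Rightarrow> ereal) set) \<Rightarrow> bool" where
  "L0_convex M E f \<longleftrightarrow>
     (\<forall>x\<in>carrier E. \<forall>y\<in>carrier E. \<forall>a\<in>L0_nonneg M. as_le M a \<one>\<^bsub>L0 M\<^esub> \<longrightarrow>
        f (a \<odot>\<^bsub>E\<^esub> x \<oplus>\<^bsub>E\<^esub> (\<one>\<^bsub>L0 M\<^esub> \<ominus>\<^bsub>L0 M\<^esub> a) \<odot>\<^bsub>E\<^esub> y) \<sqsubseteq>\<^bsub>L0bar M\<^esub>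
        L0bar_add M (L0bar_mult M (to_L0bar M a) (f x))
                    (L0bar_mult M (to_L0bar M (\<one>\<^bsub>L0 M\<^esub> \<ominus>\<^bsub>L0 M\<^esub> a)) (f y)))"

definition Tc_lsc ::
  "'w measure \<Rightarrow> (('w \<Rightarrow> real) set, 'e) module \<Rightarrow> ('e \<Rightarrow> ('w \<Rightarrow> real) set) set
     \<Rightarrow> ('e \<Rightarrow> ('w \<Rightarrow> ereal) set) \<Rightarrow> bool" where
  "Tc_lsc M E P f \<longleftrightarrow> closedin (prod_topology (Tc M E P) (Tc_L0 M)) (epi_fun M E f)"

definition conjugate_c ::
  "'w measure \<Rightarrow> (('w \<Rightarrow> real) set, 'e) module \<Rightarrow> ('e \<Rightarrow> ('w \<Rightarrow> ereal) set)
     \<Rightarrow> ('e \<Rightarrow> ('w \<Rightarrow> real) set) \<Rightarrow> ('w \<Rightarrow> ereal) set" where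
  "conjugate_c M E f g =
     \<Squnion>\<^bsub>L0bar M\<^esub> ((\<lambda>x. L0bar_diff M (to_L0bar M (g x)) (f x)) ` carrier E)"

definition biconjugate_c ::
  "'w measure \<Rightarrow> (('w \<Rightarrow> real) set, 'e) module \<Rightarrow> ('e \<Rightarrow> ('w \<Rightarrow> real) set) set
     \<Rightarrow> ('e \<Rightarrow> ('w \<Rightarrow> ereal) set) \<Rightarrow> 'e \<Rightarrow> ('w \<Rightarrow> ereal) set" where
  "biconjugate_c M E P f x =
     \<Squnion>\<^bsub>L0bar M\<^esub> ((\<lambda>g. L0bar_diff M (to_L0bar M (g x)) (conjugate_c M E f g)) ` dual_c M E P)"

end

theory Submission
  imports Defs
begin

text \<open>Suppose \<open>f\<^sup>*\<^sup>*(x) < c < f(x)\<close> on a nonnegligible set. Closedness of the epigraph and the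
  countable concatenation property yield, by an exhaustion argument, a smaller nonnegligible set \<open>A\<close>
  and a finite sum \<open>q\<close> of the seminorms such that, on \<open>A\<close>, \<open>f(y) > c\<close> wherever \<open>q(y - x)\<close> is small,
  for all \<open>y\<close> at once. The same argument at a point of the domain, combined with convexity, bounds
  \<open>f\<close> from below by an affine function of \<open>q\<close>, so that \<open>f(y) + N q(y - x) \<ge> c\<close> on \<open>A\<close> for some
  constant \<open>N\<close>. A Hahn-Banach-Kantorovich argument (a minimal element among the \<open>L\<^sup>0\<close>-valued
  sublinear maps is additive) separates \<open>f - c\<close> from \<open>-N q(\<cdot> - x)\<close> on \<open>A\<close> by an additive map \<open>g\<close> with
  \<open>\<bar>g\<bar> \<le> N q\<close>. Such a map is automatically \<open>L\<^sup>0\<close>-linear and continuous, and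
  \<open>f\<^sup>*(g) \<le> g(x) - c\<close> on \<open>A\<close>, contradicting \<open>f\<^sup>*\<^sup>*(x) < c\<close>.\<close>

section \<open>Essential suprema and infima\<close>

text \<open>The obstacle is that lying outside the epigraph is a weak property:
  \<open>f(z) \<le> r\<close> fails only on some nonnegligible set, which varies with
  \<open>z\<close>. A separating neighbourhood thus gives no common set on which all nearby points
  have large values. The exhaustion collects all places where some nearby point has a small value;
  concatenation merges countably many such points into one, and if nothing were left over, that one
  point would lie in the neighbourhood and below the level.

  A contradiction on any nonnegligible set suffices, so random radii, levels and distances become
  constants by shrinking the set. The cone \<open>c - N q(y - x)\<close> below \<open>f\<close>
  excludes vertical separation in advance, even where \<open>f(x)\<close> is infinite, so points
  outside the domain need no separate case. The sublinear functional uses real multipliers only: an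
  additive map dominated by \<open>N q\<close> is local, hence commutes with integer-valued random
  scalars and, by approximation, with all of them.\<close>

text \<open>Closure under countable unions lets the supremum of the measures be attained by some
  \<open>A\<close>. Adding any further \<open>B\<close> stays in \<open>D\<close>, so it cannot
  increase the measure, and \<open>B - A\<close> is null.\<close>

lemma (in finite_measure) exists_ae_greatest_set:
  assumes sub: "D \<subseteq> sets M" and ne: "D \<noteq> {}"
    and un: "\<And>X :: nat \<Rightarrow> 'a set. range X \<subseteq> D \<Longrightarrow> (\<Union>n. X n) \<in> D"
  obtains A where "A \<in> D" "\<forall>B\<in>D. AE w in M. w \<in> B \<longrightarrow> w \<in> A"
proof -
  define s where "s = Sup (measure M ` D)"
  have bdd: "bdd_above (measure M ` D)"
    by (rule bdd_aboveI[of _ "measure M (space M)"]) (auto simp: bounded_measure)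
  have "\<exists>X\<in>D. s - 1 / real (Suc n) < measure M X" for n
  proof -
    have "s - 1 / real (Suc n) < Sup (measure M ` D)" by (simp add: s_def)
    then show ?thesis using less_cSup_iff[OF _ bdd] ne by auto
  qed
  then obtain X where X: "\<And>n. X n \<in> D" "\<And>n. s - 1 / real (Suc n) < measure M (X n)" by metis
  define A where "A = (\<Union>n. X n)"
  have AD: "A \<in> D" unfolding A_def using X by (intro un) auto
  have sA: "s - 1 / real (Suc n) \<le> measure M A" for n
    using X(2)[of n] finite_measure_mono[of "X n" A] AD sub unfolding A_def by fastforce
  have "s \<le> measure M A"
  proof (rule field_le_epsilon)
    fix e :: real assume "e > 0"
    then obtain n where "1 / real (Suc n) < e" using nat_approx_posE by blast
    then show "s \<le> measure M A + e" using sA[of n] by linarith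
  qed
  show ?thesis
  proof (rule that[OF AD], rule ballI)
    fix B assume B: "B \<in> D"
    have "range (\<lambda>n::nat. if n = 0 then A else B) \<subseteq> D" using AD B by auto
    from un[OF this] have AB: "A \<union> B \<in> D"
      by (rule back_subst[where P="\<lambda>x. x \<in> D"]) (auto split: if_splits)
    then have "measure M (A \<union> B) \<le> measure M A"
      using \<open>s \<le> _\<close> cSup_upper[OF _ bdd, of "measure M (A \<union> B)"] unfolding s_def by force
    moreover have "measure M (A \<union> B) = measure M A + measure M (B - A)"
      using AD B sub by (metis finite_measure_Union' subsetD Un_Diff_cancel Diff_disjoint sets.Diff finite_measure_Union)
    ultimately have "measure M (B - A) = 0" using measure_nonneg[of M "B - A"] by linarith
    then have "B - A \<in> null_sets M"
      using AD B sub by (auto simp: null_sets_def emeasure_eq_measure)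
    then have "AE w in M. w \<notin> B - A" by (rule AE_not_in)
    then show "AE w in M. w \<in> B \<longrightarrow> w \<in> A" by auto
  qed
qed

text \<open>For each rational \<open>q\<close>, the countable unions of superlevel sets of members
  of \<open>S\<close> have an almost surely greatest element, which picks a countable subfamily. The
  union over all \<open>q\<close> works, since a failure of the inequality would be seen at a
  rational level.\<close>

lemma (in finite_measure) ess_sup_countable:
  fixes S :: "('a \<Rightarrow> ereal) set"
  assumes S: "S \<subseteq> borel_measurable M"
  obtains C where "countable C" "C \<subseteq> S" "\<forall>X\<in>S. AE w in M. X w \<le> (SUP Y\<in>C. Y w)"
proof -
  have "\<exists>C. countable C \<and> C \<subseteq> S \<and> (\<forall>X\<in>S. AE w in M. ereal (of_rat q) < X w \<longrightarrow> (\<exists>Y\<in>C. ereal (of_rat q) < Y w))" for q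
  proof -
    define L where "L X = {w \<in> space M. ereal (of_rat q) < X w}" for X
    have L: "L X \<in> sets M" if "X \<in> S" for X
      using that S unfolding L_def by (auto intro!: borel_measurable_less[of "\<lambda>_. ereal (of_rat q)", simplified])
    define D where "D = {\<Union>(L ` C) |C. countable C \<and> C \<subseteq> S}"
    have D1: "D \<subseteq> sets M" unfolding D_def using L by (auto intro!: sets.countable_UN')
    have D2: "D \<noteq> {}" unfolding D_def by blast
    have D3: "(\<Union>n. X n) \<in> D" if "range X \<subseteq> D" for X :: "nat \<Rightarrow> 'a set"
    proof -
      have "\<forall>n. \<exists>C. X n = \<Union>(L ` C) \<and> countable C \<and> C \<subseteq> S" using that unfolding D_def by blast
      then obtain C where C: "\<And>n. X n = \<Union>(L ` C n)" "\<And>n. countable (C n)" "\<And>n. C n \<subseteq> S" by metis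
      have "(\<Union>n. X n) = \<Union>(L ` (\<Union>n. C n))" using C(1) by auto
      moreover have "countable (\<Union>n. C n)" "(\<Union>n. C n) \<subseteq> S" using C(2,3) by auto
      ultimately show ?thesis unfolding D_def by blast
    qed
    obtain A where A: "A \<in> D" "\<forall>B\<in>D. AE w in M. w \<in> B \<longrightarrow> w \<in> A"
      by (rule exists_ae_greatest_set[OF D1 D2 D3])
    then obtain C where C: "A = \<Union>(L ` C)" "countable C" "C \<subseteq> S" unfolding D_def by blast
    have "AE w in M. ereal (of_rat q) < X w \<longrightarrow> (\<exists>Y\<in>C. ereal (of_rat q) < Y w)" if "X \<in> S" for X
    proof -
      have "L X \<in> D" unfolding D_def using that by (auto intro!: exI[of _ "{X}"])
      from bspec[OF A(2) this] show ?thesis using AE_space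
        by eventually_elim (auto simp: C(1) L_def)
    qed
    with C show ?thesis by blast
  qed
  then obtain C where "\<forall>q. countable (C q) \<and> C q \<subseteq> S \<and>
      (\<forall>X\<in>S. AE w in M. ereal (of_rat q) < X w \<longrightarrow> (\<exists>Y\<in>C q. ereal (of_rat q) < Y w))"
    using choice[of "\<lambda>q C. countable C \<and> C \<subseteq> S \<and>
      (\<forall>X\<in>S. AE w in M. ereal (of_rat q) < X w \<longrightarrow> (\<exists>Y\<in>C. ereal (of_rat q) < Y w))"] by blast
  then have C: "\<And>q. countable (C q)" "\<And>q. C q \<subseteq> S"
    "\<And>q X. X \<in> S \<Longrightarrow> AE w in M. ereal (of_rat q) < X w \<longrightarrow> (\<exists>Y\<in>C q. ereal (of_rat q) < Y w)"
    by blast+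
  show ?thesis
  proof (rule that[of "\<Union>q. C q"])
    show "countable (\<Union>q. C q)" using C(1) by auto
    show "(\<Union>q. C q) \<subseteq> S" using C(2) by auto
    show "\<forall>X\<in>S. AE w in M. X w \<le> (SUP Y\<in>(\<Union>q. C q). Y w)"
    proof
    fix X assume "X \<in> S"
    then have "AE w in M. \<forall>q. ereal (of_rat q) < X w \<longrightarrow> (\<exists>Y\<in>C q. ereal (of_rat q) < Y w)"
      using C(3) by (auto simp: AE_all_countable)
    then show "AE w in M. X w \<le> (SUP Y\<in>(\<Union>q. C q). Y w)"
    proof eventually_elim
      case (elim w)
      show ?case
      proof (rule ccontr)
        assume "\<not> ?thesis"
        then obtain r where r: "(SUP Y\<in>(\<Union>q. C q). Y w) < ereal r" "ereal r < X w"
          using ereal_dense2[of "SUP Y\<in>(\<Union>q. C q). Y w" "X w"] by (auto simp only: not_le)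
        \<comment> \<open>A second real is inserted because \<open>X w\<close> may be infinite,
          while density of the rationals is applied between two reals.\<close>
        then obtain r2 where r2: "ereal r < ereal r2" "ereal r2 < X w"
          using ereal_dense2[of "ereal r" "X w"] by blast
        then obtain q where q: "r < of_rat q" "of_rat q < r2" using of_rat_dense[of r r2] by auto
        then have "ereal (of_rat q) < X w" using r2(2) less_trans[of "ereal (of_rat q)" "ereal r2" "X w"] by simp
        with elim obtain Y where "Y \<in> C q" "ereal (of_rat q) < Y w" by blast
        then have "ereal (of_rat q) < (SUP Y\<in>(\<Union>q. C q). Y w)" by (auto simp: less_SUP_iff)
        from less_trans[OF this r(1)] have "ereal (of_rat q) < ereal r" .
        with q(1) show False by simp
      qed
    qed
    qed
  qed
qed

text \<open>The competitor \<open>K\<close> ranges over all functions, so expressions such as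
  \<open>K w - Y w\<close> can be tested without measurability checks. The infimum is real valued,
  as sublinear maps are handled on representatives.\<close>

definition is_ess_inf :: "'a measure \<Rightarrow> ('a \<Rightarrow> real) set \<Rightarrow> ('a \<Rightarrow> real) \<Rightarrow> bool" where
  "is_ess_inf M S m \<longleftrightarrow> m \<in> borel_measurable M \<and> (\<forall>X\<in>S. AE w in M. m w \<le> X w) \<and>
     (\<forall>K. (\<forall>X\<in>S. AE w in M. K w \<le> X w) \<longrightarrow> (AE w in M. K w \<le> m w))"

text \<open>The negatives have a countable subfamily attaining their essential supremum; one member
  of \<open>S\<close> and the bound \<open>L\<close> keep that supremum finite.\<close>

lemma (in finite_measure) exists_is_ess_inf:
  fixes S :: "('a \<Rightarrow> real) set"
  assumes S: "S \<subseteq> borel_measurable M" "S \<noteq> {}"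
    and L: "\<And>X. X \<in> S \<Longrightarrow> AE w in M. L w \<le> X w"
  shows "\<exists>m. is_ess_inf M S m"
proof -
  have Sm: "X \<in> borel_measurable M" if "X \<in> S" for X using that S(1) by (rule subsetD[rotated])
  have "(\<lambda>w. ereal (- X w)) \<in> borel_measurable M" if "X \<in> S" for X
    using Sm[OF that] by measurable
  then have "(\<lambda>X w. ereal (- X w)) ` S \<subseteq> borel_measurable M" by (rule image_subsetI)
  note * = this
  obtain C' where C': "countable C'" "C' \<subseteq> (\<lambda>X w. ereal (- X w)) ` S"
    "\<forall>X\<in>(\<lambda>X w. ereal (- X w)) ` S. AE w in M. X w \<le> (SUP Y\<in>C'. Y w)"
    by (rule ess_sup_countable[OF *])
  then obtain C where C: "countable C" "C \<subseteq> S" "C' = (\<lambda>X w. ereal (- X w)) ` C"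
    using countable_subset_image[of C' "\<lambda>X w. ereal (- X w)" S] by auto
  define s where "s w = (SUP Y\<in>C. ereal (- Y w))" for w
  have sC': "(SUP Y\<in>C'. Y w) = s w" for w unfolding C(3) s_def by (simp add: image_image)
  have sm: "s \<in> borel_measurable M" unfolding s_def
  proof (rule borel_measurable_SUP[OF C(1)])
    fix X assume "X \<in> C"
    then have "X \<in> borel_measurable M" using Sm C(2) by (metis subsetD)
    then show "(\<lambda>w. ereal (- X w)) \<in> borel_measurable M" by measurable
  qed
  have up: "AE w in M. ereal (- X w) \<le> s w" if "X \<in> S" for X
    using bspec[OF C'(3) imageI[OF that]] unfolding sC' .
  have gt: "AE w in M. s w \<le> ereal (- K w)" if K: "\<And>X. X \<in> S \<Longrightarrow> AE w in M. K w \<le> X w" for K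
  proof -
    have "AE w in M. \<forall>Y\<in>C. K w \<le> Y w" using C(1,2) K by (subst AE_ball_countable) auto
    then show ?thesis unfolding s_def by eventually_elim (auto intro!: SUP_least)
  qed
  obtain X0 where X0: "X0 \<in> S" using S by auto
  have gL: "AE w in M. s w \<le> ereal (- L w)" by (rule gt) (rule L)
  have fin: "AE w in M. \<bar>s w\<bar> \<noteq> \<infinity>"
    using up[OF X0] gL
  proof eventually_elim
    case (elim w) then show ?case by (cases "s w") auto
  qed
  have "is_ess_inf M S (\<lambda>w. - real_of_ereal (s w))"
    unfolding is_ess_inf_def
  proof (intro conjI ballI allI impI)
    show "(\<lambda>w. - real_of_ereal (s w)) \<in> borel_measurable M" using sm by auto
    show "AE w in M. - real_of_ereal (s w) \<le> X w" if "X \<in> S" for X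
      using up[OF that] fin
    proof eventually_elim
      case (elim w) then show ?case by (cases "s w") auto
    qed
    show "AE w in M. K w \<le> - real_of_ereal (s w)" if "\<forall>X\<in>S. AE w in M. K w \<le> X w" for K
    proof -
      have "AE w in M. s w \<le> ereal (- K w)" by (rule gt) (rule bspec[OF that])
      then show ?thesis using fin
      proof eventually_elim
        case (elim w) then show ?case by (cases "s w") auto
      qed
    qed
  qed
  then show ?thesis by blast
qed

section \<open>Classes of random variables\<close>

lemma equiv_ae_rel: "equiv (borel_measurable M) (ae_rel M)"
proof (rule equivI)
  show "ae_rel M \<subseteq> borel_measurable M \<times> borel_measurable M" by (auto simp: ae_rel_def)
  show "refl_on (borel_measurable M) (ae_rel M)" by (auto simp: refl_on_def ae_rel_def)
  show "sym (ae_rel M)" by (auto simp: sym_def ae_rel_def elim!: eventually_mono)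
  show "trans (ae_rel M)" by (auto simp: trans_def ae_rel_def elim: eventually_elim2)
qed

lemma
  assumes X: "X \<in> borel_measurable M"
  shows rep_ae_class_measurable [measurable, simp]: "rep (ae_class M X) \<in> borel_measurable M"
    and AE_rep_ae_class: "AE w in M. rep (ae_class M X) w = X w"
proof -
  have "X \<in> ae_class M X" using X by (auto simp: ae_class_def ae_rel_def)
  then have "rep (ae_class M X) \<in> ae_class M X" unfolding rep_def
    by (rule someI[where P="\<lambda>Y. Y \<in> ae_class M X"])
  then show "rep (ae_class M X) \<in> borel_measurable M" "AE w in M. rep (ae_class M X) w = X w"
    by (auto simp: ae_class_def ae_rel_def elim!: eventually_mono)
qed

lemma ae_class_closed [simp]: "X \<in> borel_measurable M \<Longrightarrow> ae_class M X \<in> borel_measurable M // ae_rel M"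
  unfolding ae_class_def by (rule quotientI)

lemma
  assumes a: "a \<in> borel_measurable M // ae_rel M"
  shows rep_measurable: "rep a \<in> borel_measurable M" and ae_class_rep: "ae_class M (rep a) = a"
proof -
  obtain X where X: "X \<in> borel_measurable M" "a = ae_class M X"
    using a by (auto elim!: quotientE simp: ae_class_def)
  show "rep a \<in> borel_measurable M" using X by simp
  have "(rep a, X) \<in> ae_rel M" using X AE_rep_ae_class[of X M] by (auto simp: ae_rel_def)
  then show "ae_class M (rep a) = a" unfolding X(2) unfolding ae_class_def
    by (rule equiv_class_eq[OF equiv_ae_rel])
qed

lemma ae_class_cong:
  assumes "X \<in> borel_measurable M" "Y \<in> borel_measurable M" "AE w in M. X w = Y w"
  shows "ae_class M X = ae_class M Y"
  unfolding ae_class_def by (rule equiv_class_eq[OF equiv_ae_rel]) (use assms in \<open>auto simp: ae_rel_def\<close>)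

lemma class_eqI:
  assumes "a \<in> borel_measurable M // ae_rel M" "b \<in> borel_measurable M // ae_rel M"
    and "AE w in M. rep a w = rep b w"
  shows "a = b"
  using ae_class_cong[OF rep_measurable rep_measurable] assms ae_class_rep by metis

section \<open>Operations on classes in terms of representatives\<close>

lemma carrier_L0: "carrier (L0 M) = borel_measurable M // ae_rel M" by (simp add: L0_def)

lemma carrier_L0bar: "carrier (L0bar M) = borel_measurable M // ae_rel M" by (simp add: L0bar_def)

lemma le_L0bar [simp]: "le (L0bar M) = as_le M" by (simp add: L0bar_def)

lemma L0_rep_measurable [measurable_dest, simp]: "a \<in> carrier (L0 M) \<Longrightarrow> rep a \<in> borel_measurable M"
  by (simp add: carrier_L0 rep_measurable)

lemma L0bar_rep_measurable [measurable_dest, simp]: "a \<in> carrier (L0bar M) \<Longrightarrow> rep a \<in> borel_measurable M"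
  by (simp add: carrier_L0bar rep_measurable)

lemma L0_class_closed [simp]: "X \<in> borel_measurable M \<Longrightarrow> ae_class M X \<in> carrier (L0 M)"
  by (simp add: carrier_L0)

lemma L0bar_class_closed [simp]: "X \<in> borel_measurable M \<Longrightarrow> ae_class M X \<in> carrier (L0bar M)"
  by (simp add: carrier_L0bar)

lemma to_L0bar_closed [simp]: "a \<in> carrier (L0 M) \<Longrightarrow> to_L0bar M a \<in> carrier (L0bar M)"
  unfolding to_L0bar_def by simp

lemma AE_rep_add: "a \<in> carrier (L0 M) \<Longrightarrow> b \<in> carrier (L0 M) \<Longrightarrow>
    AE w in M. rep (a \<oplus>\<^bsub>L0 M\<^esub> b) w = rep a w + rep b w"
  using AE_rep_ae_class[of "\<lambda>w. rep a w + rep b w" M] L0_rep_measurable[of a M] L0_rep_measurable[of b M]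
  by (simp add: L0_def[of M] borel_measurable_add)

lemma AE_rep_mult: "a \<in> carrier (L0 M) \<Longrightarrow> b \<in> carrier (L0 M) \<Longrightarrow>
    AE w in M. rep (a \<otimes>\<^bsub>L0 M\<^esub> b) w = rep a w * rep b w"
  using AE_rep_ae_class[of "\<lambda>w. rep a w * rep b w" M] L0_rep_measurable[of a M] L0_rep_measurable[of b M]
  by (simp add: L0_def[of M] borel_measurable_times)

lemma AE_rep_zero: "AE w in M. rep \<zero>\<^bsub>L0 M\<^esub> w = 0"
  by (simp add: L0_def[of M]) (rule AE_rep_ae_class, simp)

lemma AE_rep_one: "AE w in M. rep \<one>\<^bsub>L0 M\<^esub> w = 1"
  by (simp add: L0_def[of M]) (rule AE_rep_ae_class, simp)

lemma AE_rep_abs: "a \<in> carrier (L0 M) \<Longrightarrow> AE w in M. rep (L0_abs M a) w = \<bar>rep a w\<bar>"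
  unfolding L0_abs_def by (rule AE_rep_ae_class) simp

lemma AE_rep_to_L0bar: "a \<in> carrier (L0 M) \<Longrightarrow> AE w in M. rep (to_L0bar M a) w = ereal (rep a w)"
  unfolding to_L0bar_def by (rule AE_rep_ae_class) simp

lemma AE_rep_L0bar_diff: "a \<in> carrier (L0bar M) \<Longrightarrow> b \<in> carrier (L0bar M) \<Longrightarrow>
    AE w in M. rep (L0bar_diff M a b) w = rep a w - rep b w"
  unfolding L0bar_diff_def by (rule AE_rep_ae_class) simp

lemma AE_rep_L0bar_add: "a \<in> carrier (L0bar M) \<Longrightarrow> b \<in> carrier (L0bar M) \<Longrightarrow>
    AE w in M. rep (L0bar_add M a b) w = rep a w + rep b w"
  unfolding L0bar_add_def by (rule AE_rep_ae_class) simp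

lemma AE_rep_L0bar_mult: "a \<in> carrier (L0bar M) \<Longrightarrow> b \<in> carrier (L0bar M) \<Longrightarrow>
    AE w in M. rep (L0bar_mult M a b) w = rep a w * rep b w"
  unfolding L0bar_mult_def by (rule AE_rep_ae_class) simp

lemma L0bar_diff_closed [simp]: "a \<in> carrier (L0bar M) \<Longrightarrow> b \<in> carrier (L0bar M) \<Longrightarrow>
    L0bar_diff M a b \<in> carrier (L0bar M)"
  unfolding L0bar_diff_def by simp

lemma L0bar_mult_closed [simp]: "a \<in> carrier (L0bar M) \<Longrightarrow> b \<in> carrier (L0bar M) \<Longrightarrow>
    L0bar_mult M a b \<in> carrier (L0bar M)"
  unfolding L0bar_mult_def by simp

text \<open>Restricting to a countable subfamily keeps the pointwise supremum measurable without
  losing any upper bound.\<close>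

lemma (in finite_measure) exists_lub_L0bar:
  assumes S: "S \<subseteq> carrier (L0bar M)"
  shows "\<exists>s. is_lub (L0bar M) s S"
proof -
  have "rep ` S \<subseteq> borel_measurable M" using S by auto
  note * = this
  obtain C' where C': "countable C'" "C' \<subseteq> rep ` S"
    "\<forall>X\<in>rep ` S. AE w in M. X w \<le> (SUP Y\<in>C'. Y w)"
    by (rule ess_sup_countable[OF *])
  define s where "s w = (SUP Y\<in>C'. Y w)" for w
  have sm: "s \<in> borel_measurable M" unfolding s_def using C'(1,2) *
    by (intro borel_measurable_SUP) blast+
  have "is_lub (L0bar M) (ae_class M s) S"
  proof (rule least_UpperI)
    fix x assume x: "x \<in> S"
    have "AE w in M. rep x w \<le> s w" using bspec[OF C'(3) imageI[OF x]] by (simp add: s_def)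
    then show "x \<sqsubseteq>\<^bsub>L0bar M\<^esub> ae_class M s"
      using AE_rep_ae_class[OF sm] unfolding le_L0bar as_le_def by eventually_elim simp
  next
    fix y assume "y \<in> Upper (L0bar M) S"
    then have y: "\<And>x. x \<in> S \<Longrightarrow> AE w in M. rep x w \<le> rep y w"
      using S by (auto simp: Upper_def as_le_def)
    have "AE w in M. \<forall>Y\<in>C'. Y w \<le> rep y w" using C'(1,2) y by (subst AE_ball_countable) auto
    then have "AE w in M. s w \<le> rep y w"
      unfolding s_def by eventually_elim (auto intro: SUP_least)
    then show "ae_class M s \<sqsubseteq>\<^bsub>L0bar M\<^esub> y"
      using AE_rep_ae_class[OF sm] unfolding le_L0bar as_le_def by eventually_elim simp
  qed (use S sm in auto)
  then show ?thesis ..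
qed

lemma (in finite_measure)
  assumes S: "S \<subseteq> carrier (L0bar M)"
  shows sup_L0bar_closed: "\<Squnion>\<^bsub>L0bar M\<^esub> S \<in> carrier (L0bar M)"
    and AE_le_sup_L0bar: "a \<in> S \<Longrightarrow> AE w in M. rep a w \<le> rep (\<Squnion>\<^bsub>L0bar M\<^esub> S) w"
    and AE_sup_L0bar_le: "b \<in> carrier (L0bar M) \<Longrightarrow> (\<And>a. a \<in> S \<Longrightarrow> AE w in M. rep a w \<le> rep b w) \<Longrightarrow>
        AE w in M. rep (\<Squnion>\<^bsub>L0bar M\<^esub> S) w \<le> rep b w"
proof -
  have lub: "is_lub (L0bar M) (\<Squnion>\<^bsub>L0bar M\<^esub> S) S"
    unfolding sup_def using exists_lub_L0bar[OF S] by (rule someI_ex)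
  then show "\<Squnion>\<^bsub>L0bar M\<^esub> S \<in> carrier (L0bar M)" by (rule least_closed)
  show "AE w in M. rep a w \<le> rep (\<Squnion>\<^bsub>L0bar M\<^esub> S) w" if "a \<in> S"
    using least_Upper_above[OF lub that S] by (simp add: as_le_def)
  show "AE w in M. rep (\<Squnion>\<^bsub>L0bar M\<^esub> S) w \<le> rep b w"
    if "b \<in> carrier (L0bar M)" "\<And>a. a \<in> S \<Longrightarrow> AE w in M. rep a w \<le> rep b w"
  proof -
    have "b \<in> Upper (L0bar M) S" using that S by (auto simp: Upper_def as_le_def)
    from least_le[OF lub this] show ?thesis by (simp add: as_le_def)
  qed
qed

section \<open>The locally $L^0$-convex topology\<close>

text \<open>Trades the essential supremum for one almost sure inequality per seminorm, the form in
  which later estimates are available.\<close>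

lemma (in prob_space) Tc_nbhd_iff:
  assumes "\<And>p. p \<in> Q \<Longrightarrow> p \<in> carrier E \<rightarrow> carrier (L0 M)" "finite Q" "\<epsilon> \<in> carrier (L0 M)"
  shows "y \<in> Tc_nbhd M E Q \<epsilon> \<longleftrightarrow> y \<in> carrier E \<and> (\<forall>p\<in>Q. AE w in M. rep (p y) w \<le> rep \<epsilon> w)"
proof (cases "y \<in> carrier E")
  case True
  have py: "p y \<in> carrier (L0 M)" if "p \<in> Q" for p using assms(1)[OF that] True by auto
  have S: "(\<lambda>p. to_L0bar M (p y)) ` Q \<subseteq> carrier (L0bar M)" using py by auto
  note e = AE_rep_to_L0bar[OF assms(3)]
  have "(AE w in M. rep (seminorm_sup M Q y) w \<le> rep (to_L0bar M \<epsilon>) w) \<longleftrightarrow>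
      (\<forall>p\<in>Q. AE w in M. rep (p y) w \<le> rep \<epsilon> w)"
  proof (intro iffI ballI)
    fix p assume l: "AE w in M. rep (seminorm_sup M Q y) w \<le> rep (to_L0bar M \<epsilon>) w" and p: "p \<in> Q"
    have "AE w in M. rep (to_L0bar M (p y)) w \<le> rep (seminorm_sup M Q y) w"
      unfolding seminorm_sup_def using p by (intro AE_le_sup_L0bar[OF S]) auto
    with l e AE_rep_to_L0bar[OF py[OF p]] show "AE w in M. rep (p y) w \<le> rep \<epsilon> w"
    proof eventually_elim
      case (elim w)
      then have "ereal (rep (p y) w) \<le> ereal (rep \<epsilon> w)" by (metis order_trans)
      then show ?case by simp
    qed
  next
    assume l: "\<forall>p\<in>Q. AE w in M. rep (p y) w \<le> rep \<epsilon> w"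
    show "AE w in M. rep (seminorm_sup M Q y) w \<le> rep (to_L0bar M \<epsilon>) w"
      unfolding seminorm_sup_def
    proof (rule AE_sup_L0bar_le[OF S])
      fix a assume "a \<in> (\<lambda>p. to_L0bar M (p y)) ` Q"
      then obtain p where p: "p \<in> Q" "a = to_L0bar M (p y)" by auto
      show "AE w in M. rep a w \<le> rep (to_L0bar M \<epsilon>) w"
        using l[rule_format, OF p(1)] e AE_rep_to_L0bar[OF py[OF p(1)]] unfolding p(2)
        by eventually_elim simp
    qed (use assms(3) in simp)
  qed
  then show ?thesis using True by (simp add: Tc_nbhd_def as_le_def)
qed (simp add: Tc_nbhd_def)

text \<open>The predicate in \<open>Tc\<close> describes the open sets once it is known to be a
  topology. For intersections, take the union of the two finite families and the pointwise minimum
  of the two radii.\<close>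

lemma (in prob_space) openin_Tc:
  assumes P: "\<And>p. p \<in> P \<Longrightarrow> p \<in> carrier E \<rightarrow> carrier (L0 M)"
  shows "openin (Tc M E P) U \<longleftrightarrow> U \<subseteq> carrier E \<and>
     (\<forall>x\<in>U. \<exists>Q \<epsilon>. finite Q \<and> Q \<noteq> {} \<and> Q \<subseteq> P \<and> \<epsilon> \<in> L0_pos M \<and>
        (\<forall>y\<in>Tc_nbhd M E Q \<epsilon>. x \<oplus>\<^bsub>E\<^esub> y \<in> U))"
proof -
  define N where "N x U Q \<epsilon> \<longleftrightarrow> finite Q \<and> Q \<noteq> {} \<and> Q \<subseteq> P \<and> \<epsilon> \<in> L0_pos M \<and>
        (\<forall>y\<in>Tc_nbhd M E Q \<epsilon>. x \<oplus>\<^bsub>E\<^esub> y \<in> U)" for x U Q \<epsilon>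
  have inter: "\<exists>Q \<epsilon>. N x (S \<inter> T) Q \<epsilon>" if Q: "N x S Q \<epsilon>" and Q': "N x T Q' \<epsilon>'" for x S T Q Q' \<epsilon> \<epsilon>'
  proof -
    note Q = Q[unfolded N_def] and Q' = Q'[unfolded N_def]
    define d where "d = ae_class M (\<lambda>w. min (rep \<epsilon> w) (rep \<epsilon>' w))"
    have em: "\<epsilon> \<in> carrier (L0 M)" "\<epsilon>' \<in> carrier (L0 M)" using Q Q' by (simp_all add: L0_pos_def)
    have m: "(\<lambda>w. min (rep \<epsilon> w) (rep \<epsilon>' w)) \<in> borel_measurable M"
      using em by (intro borel_measurable_min L0_rep_measurable)
    note d = AE_rep_ae_class[OF m, folded d_def]
    have dc: "d \<in> carrier (L0 M)" unfolding d_def using m by (rule L0_class_closed)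
    have "AE w in M. 0 < rep \<epsilon> w" "AE w in M. 0 < rep \<epsilon>' w" using Q Q' by (simp_all add: L0_pos_def)
    with d have "AE w in M. 0 < rep d w" by eventually_elim simp
    then have dp: "d \<in> L0_pos M" using dc by (simp add: L0_pos_def)
    have QQ: "finite (Q \<union> Q')" "Q \<union> Q' \<noteq> {}" "Q \<union> Q' \<subseteq> P" using Q Q' by simp_all
    have inP: "p \<in> P" if "p \<in> Q \<union> Q'" for p using QQ(3) that by (rule subsetD)
    have "x \<oplus>\<^bsub>E\<^esub> y \<in> S \<inter> T" if "y \<in> Tc_nbhd M E (Q \<union> Q') d" for y
    proof -
      have y: "y \<in> carrier E" "\<forall>p\<in>Q\<union>Q'. AE w in M. rep (p y) w \<le> rep d w"
        using that Tc_nbhd_iff[OF P[OF inP] QQ(1) dc, of y] by simp_all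
      have "AE w in M. rep (p y) w \<le> rep \<epsilon> w" if "p \<in> Q" for p
      proof -
        have "AE w in M. rep (p y) w \<le> rep d w" using y(2) that by simp
        with d show ?thesis by eventually_elim simp
      qed
      moreover have "AE w in M. rep (p y) w \<le> rep \<epsilon>' w" if "p \<in> Q'" for p
      proof -
        have "AE w in M. rep (p y) w \<le> rep d w" using y(2) that by simp
        with d show ?thesis by eventually_elim simp
      qed
      ultimately have "y \<in> Tc_nbhd M E Q \<epsilon>" "y \<in> Tc_nbhd M E Q' \<epsilon>'"
        using Tc_nbhd_iff[OF P[OF inP] _ em(1), of Q y] Tc_nbhd_iff[OF P[OF inP] _ em(2), of Q' y] Q Q' y(1)
        by simp_all
      then show ?thesis using Q Q' by simp
    qed
    then have "N x (S \<inter> T) (Q \<union> Q') d" unfolding N_def using QQ dp by simp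
    then show ?thesis by (intro exI)
  qed
  have mono: "N x T Q \<epsilon>" if "N x S Q \<epsilon>" "S \<subseteq> T" for x S T Q \<epsilon>
    using that unfolding N_def by (simp add: subset_iff)
  have "istopology (\<lambda>U. U \<subseteq> carrier E \<and> (\<forall>x\<in>U. \<exists>Q \<epsilon>. N x U Q \<epsilon>))"
    unfolding istopology_def
  proof (rule conjI; intro allI impI)
    fix S T assume S: "S \<subseteq> carrier E \<and> (\<forall>x\<in>S. \<exists>Q \<epsilon>. N x S Q \<epsilon>)"
      and T: "T \<subseteq> carrier E \<and> (\<forall>x\<in>T. \<exists>Q \<epsilon>. N x T Q \<epsilon>)"
    show "S \<inter> T \<subseteq> carrier E \<and> (\<forall>x\<in>S \<inter> T. \<exists>Q \<epsilon>. N x (S \<inter> T) Q \<epsilon>)"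
    proof (intro conjI ballI)
      show "S \<inter> T \<subseteq> carrier E" using S by (simp add: le_infI1)
      fix x assume x: "x \<in> S \<inter> T"
      obtain Q \<epsilon> where Q: "N x S Q \<epsilon>" using bspec[OF conjunct2[OF S] IntD1[OF x]] by (elim exE)
      obtain Q' \<epsilon>' where Q': "N x T Q' \<epsilon>'" using bspec[OF conjunct2[OF T] IntD2[OF x]] by (elim exE)
      from inter[OF Q Q'] show "\<exists>Q \<epsilon>. N x (S \<inter> T) Q \<epsilon>" .
    qed
  next
    fix K assume K: "\<forall>U\<in>K. U \<subseteq> carrier E \<and> (\<forall>x\<in>U. \<exists>Q \<epsilon>. N x U Q \<epsilon>)"
    show "\<Union>K \<subseteq> carrier E \<and> (\<forall>x\<in>\<Union>K. \<exists>Q \<epsilon>. N x (\<Union>K) Q \<epsilon>)"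
    proof (intro conjI ballI)
      show "\<Union>K \<subseteq> carrier E" using K by (intro Union_least) simp
      fix x assume "x \<in> \<Union>K"
      then obtain U where U: "x \<in> U" "U \<in> K" by (elim UnionE)
      obtain Q \<epsilon> where "N x U Q \<epsilon>" using bspec[OF conjunct2[OF bspec[OF K U(2)]] U(1)] by (elim exE)
      from mono[OF this Union_upper[OF U(2)]] show "\<exists>Q \<epsilon>. N x (\<Union>K) Q \<epsilon>" by (intro exI)
    qed
  qed
  from fun_cong[OF topology_inverse'[OF this], of U] show ?thesis unfolding Tc_def N_def .
qed

lemma L0_pos_ne: "L0_pos M \<noteq> {}"
proof -
  have "AE w in M. rep (ae_class M (\<lambda>w. 1 :: real)) w = 1" by (rule AE_rep_ae_class) simp
  then have "AE w in M. 0 < rep (ae_class M (\<lambda>w. 1 :: real)) w" by eventually_elim simp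
  then have "ae_class M (\<lambda>w. 1 :: real) \<in> L0_pos M" by (simp add: L0_pos_def)
  then show ?thesis by blast
qed

lemma ae_class_add:
  assumes "\<xi> \<in> borel_measurable M" "\<eta> \<in> borel_measurable M"
  shows "ae_class M (\<lambda>w. \<xi> w + \<eta> w) = ae_class M \<xi> \<oplus>\<^bsub>L0 M\<^esub> ae_class M \<eta>"
proof -
  have "AE w in M. \<xi> w + \<eta> w = rep (ae_class M \<xi>) w + rep (ae_class M \<eta>) w"
    using AE_rep_ae_class[OF assms(1)] AE_rep_ae_class[OF assms(2)] by eventually_elim simp
  then have "ae_class M (\<lambda>w. \<xi> w + \<eta> w) = ae_class M (\<lambda>w. rep (ae_class M \<xi>) w + rep (ae_class M \<eta>) w)"
    by (intro ae_class_cong) (use assms in simp_all)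
  then show ?thesis by (simp add: L0_def[of M])
qed

lemma ae_class_mult:
  assumes "\<xi> \<in> borel_measurable M" "\<eta> \<in> borel_measurable M"
  shows "ae_class M (\<lambda>w. \<xi> w * \<eta> w) = ae_class M \<xi> \<otimes>\<^bsub>L0 M\<^esub> ae_class M \<eta>"
proof -
  have "AE w in M. \<xi> w * \<eta> w = rep (ae_class M \<xi>) w * rep (ae_class M \<eta>) w"
    using AE_rep_ae_class[OF assms(1)] AE_rep_ae_class[OF assms(2)] by eventually_elim simp
  then have "ae_class M (\<lambda>w. \<xi> w * \<eta> w) = ae_class M (\<lambda>w. rep (ae_class M \<xi>) w * rep (ae_class M \<eta>) w)"
    by (intro ae_class_cong) (use assms in simp_all)
  then show ?thesis by (simp add: L0_def[of M])
qed

lemma ae_class_zero: "ae_class M (\<lambda>_. 0) = \<zero>\<^bsub>L0 M\<^esub>" by (simp add: L0_def)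

lemma ae_class_one: "ae_class M (\<lambda>_. 1) = \<one>\<^bsub>L0 M\<^esub>" by (simp add: L0_def)

context random_locally_convex_module
begin

lemma seminorm_carrier: "p \<in> P \<Longrightarrow> p \<in> carrier E \<rightarrow> carrier (L0 M)"
  by (drule seminorms) (unfold L0_seminorm_def L0_nonneg_def, blast)

text \<open>For an empty family the separation axiom at the null element would read
  \<open_placeholder>\<close>

lemma P_ne: "P \<noteq> {}"
proof
  assume P: "P = {}"
  have "seminorm_sup M P \<zero>\<^bsub>E\<^esub> = to_L0bar M \<zero>\<^bsub>L0 M\<^esub>" using separating[of "\<zero>\<^bsub>E\<^esub>"] by simp
  then have *: "\<Squnion>\<^bsub>L0bar M\<^esub> {} = to_L0bar M \<zero>\<^bsub>L0 M\<^esub>" by (simp add: seminorm_sup_def P)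
  have m: "(\<lambda>_. -\<infinity> :: ereal) \<in> borel_measurable M" by simp
  have "AE w in M. rep (\<Squnion>\<^bsub>L0bar M\<^esub> {}) w \<le> rep (ae_class M (\<lambda>_. -\<infinity>)) w"
  proof (rule AE_sup_L0bar_le)
    show "ae_class M (\<lambda>_. -\<infinity>) \<in> carrier (L0bar M)" using m by (rule L0bar_class_closed)
  qed simp_all
  moreover have "AE w in M. rep (to_L0bar M \<zero>\<^bsub>L0 M\<^esub>) w = ereal (rep \<zero>\<^bsub>L0 M\<^esub> w)"
    by (rule AE_rep_to_L0bar) simp
  ultimately have "AE w in M. False" unfolding *
    using AE_rep_ae_class[OF m] by eventually_elim simp
  then show False by simp
qed

lemma openin_Tc_E: "openin (Tc M E P) U \<longleftrightarrow> U \<subseteq> carrier E \<and>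
     (\<forall>x\<in>U. \<exists>Q \<epsilon>. finite Q \<and> Q \<noteq> {} \<and> Q \<subseteq> P \<and> \<epsilon> \<in> L0_pos M \<and>
        (\<forall>y\<in>Tc_nbhd M E Q \<epsilon>. x \<oplus>\<^bsub>E\<^esub> y \<in> U))"
  by (rule openin_Tc) (rule seminorm_carrier)

lemma L0_abs_carrier: "L0_abs M \<in> carrier (L0 M) \<rightarrow> carrier (L0 M)"
  by (auto simp: L0_abs_def)

lemma openin_Tc_L0: "openin (Tc_L0 M) U \<longleftrightarrow> U \<subseteq> carrier (L0 M) \<and>
     (\<forall>x\<in>U. \<exists>\<epsilon>. \<epsilon> \<in> L0_pos M \<and>
        (\<forall>y\<in>carrier (L0 M). (AE w in M. \<bar>rep y w\<bar> \<le> rep \<epsilon> w) \<longrightarrow> x \<oplus>\<^bsub>L0 M\<^esub> y \<in> U))"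
proof -
  have "y \<in> Tc_nbhd M (L0 M) {L0_abs M} \<epsilon> \<longleftrightarrow> y \<in> carrier (L0 M) \<and> (AE w in M. \<bar>rep y w\<bar> \<le> rep \<epsilon> w)"
    if "\<epsilon> \<in> L0_pos M" for y \<epsilon>
  proof (cases "y \<in> carrier (L0 M)")
    case True
    have "(AE w in M. rep (L0_abs M y) w \<le> rep \<epsilon> w) \<longleftrightarrow> (AE w in M. \<bar>rep y w\<bar> \<le> rep \<epsilon> w)"
      using AE_rep_abs[OF True] by (intro eventually_subst) (auto elim!: eventually_mono)
    then show ?thesis using Tc_nbhd_iff[of "{L0_abs M}" "L0 M" \<epsilon> y] that True L0_abs_carrier by (simp add: L0_pos_def)
  qed (simp add: Tc_nbhd_def)
  note n = this
  show ?thesis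
    unfolding openin_Tc[of "{L0_abs M}" "L0 M", simplified, OF L0_abs_carrier]
  proof (intro iffI conjI ballI, goal_cases)
    case (2 x)
    then obtain Q \<epsilon> where Q: "finite Q" "Q \<noteq> {}" "Q \<subseteq> {L0_abs M}" "\<epsilon> \<in> L0_pos M"
       "\<forall>y\<in>Tc_nbhd M (L0 M) Q \<epsilon>. x \<oplus>\<^bsub>L0 M\<^esub> y \<in> U" by blast
    then have "Q = {L0_abs M}" by blast
    then show ?case using Q n[OF Q(4)] by blast
  next
    case (4 x)
    then obtain \<epsilon> where e: "\<epsilon> \<in> L0_pos M" "\<forall>y\<in>carrier (L0 M). (AE w in M. \<bar>rep y w\<bar> \<le> rep \<epsilon> w) \<longrightarrow> x \<oplus>\<^bsub>L0 M\<^esub> y \<in> U"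
      by blast
    then show ?case using n[OF e(1)] by (intro exI[of _ "{L0_abs M}"] exI[of _ \<epsilon>]) auto
  qed blast+
qed

lemma topspace_Tc_E: "topspace (Tc M E P) = carrier E"
proof -
  obtain p where p: "p \<in> P" using P_ne by blast
  obtain \<epsilon> where e: "\<epsilon> \<in> L0_pos M" using L0_pos_ne by blast
  have "openin (Tc M E P) (carrier E)"
    unfolding openin_Tc_E
  proof (intro conjI ballI)
    fix x assume "x \<in> carrier E"
    then show "\<exists>Q \<epsilon>. finite Q \<and> Q \<noteq> {} \<and> Q \<subseteq> P \<and> \<epsilon> \<in> L0_pos M \<and> (\<forall>y\<in>Tc_nbhd M E Q \<epsilon>. x \<oplus>\<^bsub>E\<^esub> y \<in> carrier E)"
      using p e by (intro exI[of _ "{p}"] exI[of _ \<epsilon>]) (auto simp: Tc_nbhd_def)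
  qed simp
  moreover have "topspace (Tc M E P) \<subseteq> carrier E"
    using openin_topspace[of "Tc M E P"] unfolding openin_Tc_E by blast
  ultimately show ?thesis by (meson openin_subset subset_antisym)
qed

lemma topspace_Tc_L0: "topspace (Tc_L0 M) = carrier (L0 M)"
proof -
  obtain \<epsilon> where e: "\<epsilon> \<in> L0_pos M" using L0_pos_ne by blast
  have "openin (Tc_L0 M) (carrier (L0 M))"
    unfolding openin_Tc_L0 using e by blast
  moreover have "topspace (Tc_L0 M) \<subseteq> carrier (L0 M)"
    using openin_topspace[of "Tc_L0 M"] unfolding openin_Tc_L0 by blast
  ultimately show ?thesis by (meson openin_subset subset_antisym)
qed

section \<open>Multiplication of module elements by measurable functions\<close>

text \<open>Scalars are taken as functions instead of classes, so that identities between scalars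
  are pointwise identities.\<close>

definition rsm :: "('w \<Rightarrow> real) \<Rightarrow> 'e \<Rightarrow> 'e" where
  "rsm \<xi> x = ae_class M \<xi> \<odot>\<^bsub>E\<^esub> x"

lemma rsm_closed [simp]: "\<xi> \<in> borel_measurable M \<Longrightarrow> x \<in> carrier E \<Longrightarrow> rsm \<xi> x \<in> carrier E"
  by (simp add: rsm_def)

lemma rsm_cong: "\<xi> \<in> borel_measurable M \<Longrightarrow> \<eta> \<in> borel_measurable M \<Longrightarrow> AE w in M. \<xi> w = \<eta> w \<Longrightarrow> rsm \<xi> x = rsm \<eta> x"
  unfolding rsm_def by (drule (2) ae_class_cong) simp

lemma rsm_add: "\<xi> \<in> borel_measurable M \<Longrightarrow> \<eta> \<in> borel_measurable M \<Longrightarrow> x \<in> carrier E \<Longrightarrow>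
    rsm (\<lambda>w. \<xi> w + \<eta> w) x = rsm \<xi> x \<oplus>\<^bsub>E\<^esub> rsm \<eta> x"
  unfolding rsm_def by (simp add: ae_class_add smult_l_distr)

lemma rsm_rsm: "\<xi> \<in> borel_measurable M \<Longrightarrow> \<eta> \<in> borel_measurable M \<Longrightarrow> x \<in> carrier E \<Longrightarrow>
    rsm \<xi> (rsm \<eta> x) = rsm (\<lambda>w. \<xi> w * \<eta> w) x"
  unfolding rsm_def by (simp add: ae_class_mult smult_assoc1)

lemma rsm_distr: "\<xi> \<in> borel_measurable M \<Longrightarrow> x \<in> carrier E \<Longrightarrow> y \<in> carrier E \<Longrightarrow>
    rsm \<xi> (x \<oplus>\<^bsub>E\<^esub> y) = rsm \<xi> x \<oplus>\<^bsub>E\<^esub> rsm \<xi> y"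
  unfolding rsm_def by (simp add: smult_r_distr)

lemma rsm_one [simp]: "x \<in> carrier E \<Longrightarrow> rsm (\<lambda>_. 1) x = x"
  unfolding rsm_def ae_class_one by simp

lemma rsm_zero [simp]: "x \<in> carrier E \<Longrightarrow> rsm (\<lambda>_. 0) x = \<zero>\<^bsub>E\<^esub>"
  unfolding rsm_def ae_class_zero by simp

lemma rsm_r_zero [simp]: "\<xi> \<in> borel_measurable M \<Longrightarrow> rsm \<xi> \<zero>\<^bsub>E\<^esub> = \<zero>\<^bsub>E\<^esub>"
  unfolding rsm_def by simp

lemma rsm_r_minus: "\<xi> \<in> borel_measurable M \<Longrightarrow> x \<in> carrier E \<Longrightarrow> rsm \<xi> (\<ominus>\<^bsub>E\<^esub> x) = \<ominus>\<^bsub>E\<^esub> rsm \<xi> x"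
  unfolding rsm_def by (simp add: smult_r_minus)

lemma rsm_minus_one: "x \<in> carrier E \<Longrightarrow> rsm (\<lambda>_. - 1) x = \<ominus>\<^bsub>E\<^esub> x"
proof -
  assume x: "x \<in> carrier E"
  have "rsm (\<lambda>_. - 1) x \<oplus>\<^bsub>E\<^esub> x = rsm (\<lambda>_. - 1 + 1) x"
    using x rsm_add[of "\<lambda>_. - 1" "\<lambda>_. 1" x] by simp
  then have "rsm (\<lambda>_. - 1) x \<oplus>\<^bsub>E\<^esub> x = \<zero>\<^bsub>E\<^esub>" using x by simp
  then show ?thesis using x by (metis M.minus_equality borel_measurable_const rsm_closed)
qed

section \<open>Finite sums of seminorms\<close>

text \<open>The sum stands in for the supremum over a finite family: it is again a seminorm, lies
  between that supremum and \<open>card Q\<close> times it, and is an explicit real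
  function.\<close>

definition qn :: "('e \<Rightarrow> ('w \<Rightarrow> real) set) set \<Rightarrow> 'e \<Rightarrow> 'w \<Rightarrow> real" where
  "qn Q x w = (\<Sum>p\<in>Q. rep (p x) w)"

lemma qn_measurable [measurable (raw), simp]:
  "Q \<subseteq> P \<Longrightarrow> x \<in> carrier E \<Longrightarrow> qn Q x \<in> borel_measurable M"
  unfolding qn_def[abs_def]
  by (intro borel_measurable_sum L0_rep_measurable) (use seminorm_carrier in \<open>auto simp: Pi_iff\<close>)

lemma seminorm_nonneg: "p \<in> P \<Longrightarrow> x \<in> carrier E \<Longrightarrow> AE w in M. 0 \<le> rep (p x) w"
proof -
  assume "p \<in> P" "x \<in> carrier E"
  then have "AE w in M. rep \<zero>\<^bsub>L0 M\<^esub> w \<le> rep (p x) w"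
    using seminorms[of p] by (auto simp: L0_seminorm_def L0_nonneg_def as_le_def)
  then show ?thesis using AE_rep_zero[of M] by eventually_elim simp
qed

lemma qn_nonneg:
  assumes "finite Q" "Q \<subseteq> P" "x \<in> carrier E"
  shows "AE w in M. 0 \<le> qn Q x w"
proof -
  have "AE w in M. \<forall>p\<in>Q. 0 \<le> rep (p x) w"
    using assms seminorm_nonneg by (subst AE_ball_countable) (auto simp: countable_finite)
  then show ?thesis by eventually_elim (simp add: qn_def sum_nonneg)
qed

lemma seminorm_le_qn:
  assumes "finite Q" "Q \<subseteq> P" "x \<in> carrier E" "p \<in> Q"
  shows "AE w in M. rep (p x) w \<le> qn Q x w"
proof -
  have "AE w in M. \<forall>p\<in>Q. 0 \<le> rep (p x) w"
    using assms seminorm_nonneg by (subst AE_ball_countable) (auto simp: countable_finite)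
  then show ?thesis by eventually_elim (use assms in \<open>auto simp: qn_def intro!: member_le_sum\<close>)
qed

lemma qn_mono:
  assumes "finite Q'" "Q \<subseteq> Q'" "Q' \<subseteq> P" "x \<in> carrier E"
  shows "AE w in M. qn Q x w \<le> qn Q' x w"
proof -
  have "AE w in M. \<forall>p\<in>Q'. 0 \<le> rep (p x) w"
    using assms seminorm_nonneg by (subst AE_ball_countable) (auto simp: countable_finite)
  then show ?thesis by eventually_elim (use assms in \<open>auto simp: qn_def intro!: sum_mono2\<close>)
qed

lemma qn_triangle:
  assumes "finite Q" "Q \<subseteq> P" "x \<in> carrier E" "y \<in> carrier E"
  shows "AE w in M. qn Q (x \<oplus>\<^bsub>E\<^esub> y) w \<le> qn Q x w + qn Q y w"
proof -
  have "AE w in M. rep (p (x \<oplus>\<^bsub>E\<^esub> y)) w \<le> rep (p x) w + rep (p y) w" if p: "p \<in> Q" for p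
  proof -
    have p: "p \<in> P" using p assms by blast
    have "AE w in M. rep (p (x \<oplus>\<^bsub>E\<^esub> y)) w \<le> rep (p x \<oplus>\<^bsub>L0 M\<^esub> p y) w"
      using seminorms[OF p] assms by (auto simp: L0_seminorm_def as_le_def)
    moreover have "AE w in M. rep (p x \<oplus>\<^bsub>L0 M\<^esub> p y) w = rep (p x) w + rep (p y) w"
      using seminorm_carrier[OF p] assms by (intro AE_rep_add) auto
    ultimately show ?thesis by eventually_elim simp
  qed
  then have "AE w in M. \<forall>p\<in>Q. rep (p (x \<oplus>\<^bsub>E\<^esub> y)) w \<le> rep (p x) w + rep (p y) w"
    using assms by (subst AE_ball_countable) (auto simp: countable_finite)
  then show ?thesis
    by eventually_elim (simp add: qn_def sum.distrib[symmetric] sum_mono)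
qed

lemma qn_rsm:
  assumes "finite Q" "Q \<subseteq> P" "x \<in> carrier E" and \<xi>: "\<xi> \<in> borel_measurable M"
  shows "AE w in M. qn Q (rsm \<xi> x) w = \<bar>\<xi> w\<bar> * qn Q x w"
proof -
  have "AE w in M. rep (p (rsm \<xi> x)) w = \<bar>\<xi> w\<bar> * rep (p x) w" if p: "p \<in> Q" for p
  proof -
    have p: "p \<in> P" using p assms by blast
    have c: "ae_class M \<xi> \<in> carrier (L0 M)" using \<xi> by simp
    have eq: "p (rsm \<xi> x) = L0_abs M (ae_class M \<xi>) \<otimes>\<^bsub>L0 M\<^esub> p x"
      using seminorms[OF p] assms c unfolding L0_seminorm_def rsm_def by blast
    have "AE w in M. rep (L0_abs M (ae_class M \<xi>) \<otimes>\<^bsub>L0 M\<^esub> p x) w = rep (L0_abs M (ae_class M \<xi>)) w * rep (p x) w"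
      using seminorm_carrier[OF p] assms c L0_abs_carrier by (intro AE_rep_mult) auto
    then show ?thesis unfolding eq using AE_rep_abs[OF c] AE_rep_ae_class[OF \<xi>]
      by eventually_elim simp
  qed
  then have "AE w in M. \<forall>p\<in>Q. rep (p (rsm \<xi> x)) w = \<bar>\<xi> w\<bar> * rep (p x) w"
    using assms by (subst AE_ball_countable) (auto simp: countable_finite)
  then show ?thesis
    by eventually_elim (simp add: qn_def sum_distrib_left)
qed

lemma qn_minus:
  assumes "finite Q" "Q \<subseteq> P" "x \<in> carrier E"
  shows "AE w in M. qn Q (\<ominus>\<^bsub>E\<^esub> x) w = qn Q x w"
  using qn_rsm[OF assms, of "\<lambda>_. -1"] assms by (simp add: rsm_minus_one)

section \<open>Agreement on a set and gluing\<close>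

text \<open>Module elements have no values at points; agreement on \<open>A\<close> has to be
  expressed through the indicator.\<close>

definition eqon :: "'w set \<Rightarrow> 'e \<Rightarrow> 'e \<Rightarrow> bool" where
  "eqon A x y \<longleftrightarrow> rsm (indicator A) x = rsm (indicator A) y"

lemma eqon_minus:
  assumes "A \<in> sets M" "x \<in> carrier E" "y \<in> carrier E" "z \<in> carrier E" "eqon A x y"
  shows "eqon A (x \<ominus>\<^bsub>E\<^esub> z) (y \<ominus>\<^bsub>E\<^esub> z)"
  using assms by (simp add: eqon_def M.minus_eq rsm_distr)

lemma qn_eqon:
  assumes "finite Q" "Q \<subseteq> P" "x \<in> carrier E" "y \<in> carrier E" "A \<in> sets M" "eqon A x y"
  shows "AE w in M. w \<in> A \<longrightarrow> qn Q x w = qn Q y w"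
proof -
  have m: "indicator A \<in> borel_measurable M" using assms by simp
  show ?thesis
    using qn_rsm[OF assms(1-3) m] qn_rsm[OF assms(1,2,4) m, folded assms(6)[unfolded eqon_def]]
    by eventually_elim auto
qed

definition glue :: "'w set \<Rightarrow> 'e \<Rightarrow> 'e \<Rightarrow> 'e" where
  "glue A x y = rsm (indicator A) x \<oplus>\<^bsub>E\<^esub> rsm (\<lambda>w. 1 - indicator A w) y"

lemma glue_closed [simp]: "A \<in> sets M \<Longrightarrow> x \<in> carrier E \<Longrightarrow> y \<in> carrier E \<Longrightarrow> glue A x y \<in> carrier E"
  by (simp add: glue_def)

lemma glue_eqon:
  assumes "A \<in> sets M" "x \<in> carrier E" "y \<in> carrier E"
  shows "eqon A (glue A x y) x"
proof -
  have [simp]: "(\<lambda>w. indicator A w * indicator A w) = (indicator A :: _ \<Rightarrow> real)"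
    "(\<lambda>w. indicator A w * (1 - indicator A w)) = (\<lambda>w. 0 :: real)"
    by (auto simp: indicator_def)
  show ?thesis unfolding eqon_def glue_def using assms by (simp add: rsm_distr rsm_rsm)
qed

lemma glue_eqon_compl:
  assumes "A \<in> sets M" "x \<in> carrier E" "y \<in> carrier E"
  shows "eqon (space M - A) (glue A x y) y"
proof -
  have [simp]: "(\<lambda>w. indicator (space M - A) w * indicator A w) = (\<lambda>w. 0 :: real)"
    "(\<lambda>w. indicator (space M - A) w * (1 - indicator A w)) = (indicator (space M - A) :: _ \<Rightarrow> real)"
    by (auto simp: indicator_def)
  show ?thesis unfolding eqon_def glue_def using assms by (simp add: rsm_distr rsm_rsm)
qed

lemma glue_same: "A \<in> sets M \<Longrightarrow> y \<in> carrier E \<Longrightarrow> glue A y y = y"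
  using rsm_add[of "indicator A" "\<lambda>w. 1 - indicator A w" y] by (simp add: glue_def)

lemma glue_cong: "eqon A x y \<Longrightarrow> glue A x z = glue A y z"
  by (simp add: glue_def eqon_def)

end

section \<open>Rules for essential infima\<close>

lemma is_ess_inf_measurable: "is_ess_inf M S m \<Longrightarrow> m \<in> borel_measurable M"
  by (simp add: is_ess_inf_def)

lemma is_ess_inf_lower: "is_ess_inf M S m \<Longrightarrow> X \<in> S \<Longrightarrow> AE w in M. m w \<le> X w"
  by (simp add: is_ess_inf_def)

lemma is_ess_inf_greatest:
  assumes "is_ess_inf M S m" "\<And>X. X \<in> S \<Longrightarrow> AE w in M. K w \<le> X w"
  shows "AE w in M. K w \<le> m w"
  using assms unfolding is_ess_inf_def by simp

text \<open>One infimum at a time: with \<open>Y\<close> fixed, \<open>K - Y\<close> is a lower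
  bound of \<open>S\<close>; then \<open>K - m\<close> is a lower bound of
  \<open>S'\<close>.\<close>

lemma is_ess_inf_add_greatest:
  assumes m: "is_ess_inf M S m" "is_ess_inf M S' m'"
    and K: "\<And>X Y. X \<in> S \<Longrightarrow> Y \<in> S' \<Longrightarrow> AE w in M. K w \<le> X w + Y w"
  shows "AE w in M. K w \<le> m w + m' w"
proof -
  have "AE w in M. K w - Y w \<le> m w" if Y: "Y \<in> S'" for Y
  proof (rule is_ess_inf_greatest[OF m(1)])
    fix X assume "X \<in> S"
    from K[OF this Y] show "AE w in M. K w - Y w \<le> X w" by eventually_elim simp
  qed
  note 1 = this
  have "AE w in M. K w - m w \<le> m' w"
  proof (rule is_ess_inf_greatest[OF m(2)])
    fix Y assume "Y \<in> S'"
    from 1[OF this] show "AE w in M. K w - m w \<le> Y w" by eventually_elim simp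
  qed
  then show ?thesis by eventually_elim simp
qed

section \<open>Additive minorants of sublinear maps\<close>

text \<open>Only the additive group of the module enters here; compatibility with scalars is
  recovered later from domination by seminorms.\<close>

locale measure_abelian_group = finite_measure M + abelian_group G
  for M :: "'w measure" and G :: "('e, 'z) ring_scheme" (structure)
begin

text \<open>Homogeneity is only required for the factor 2; for the descent to a minimal element
  this is enough, since \<open>h (u \<oplus> 2\<^sup>nv) - 2\<^sup>n h v\<close> is decreasing in \<open>n\<close>.\<close>

definition sublin :: "('e \<Rightarrow> 'w \<Rightarrow> real) \<Rightarrow> bool" where
  "sublin h \<longleftrightarrow> (\<forall>u\<in>carrier G. h u \<in> borel_measurable M) \<and>
     (\<forall>u\<in>carrier G. AE w in M. h (u \<oplus> u) w = 2 * h u w) \<and>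
     (\<forall>u\<in>carrier G. \<forall>v\<in>carrier G. AE w in M. h (u \<oplus> v) w \<le> h u w + h v w)"

definition ple :: "('e \<Rightarrow> 'w \<Rightarrow> real) \<Rightarrow> ('e \<Rightarrow> 'w \<Rightarrow> real) \<Rightarrow> bool" where
  "ple h k \<longleftrightarrow> (\<forall>u\<in>carrier G. AE w in M. h u w \<le> k u w)"

lemma
  assumes "sublin h"
  shows sublin_measurable: "u \<in> carrier G \<Longrightarrow> h u \<in> borel_measurable M"
    and sublin_dbl: "u \<in> carrier G \<Longrightarrow> AE w in M. h (u \<oplus> u) w = 2 * h u w"
    and sublin_add: "u \<in> carrier G \<Longrightarrow> v \<in> carrier G \<Longrightarrow> AE w in M. h (u \<oplus> v) w \<le> h u w + h v w"
  using assms by (simp_all add: sublin_def)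

lemma pleD: "ple h k \<Longrightarrow> u \<in> carrier G \<Longrightarrow> AE w in M. h u w \<le> k u w"
  by (simp add: ple_def)

lemma ple_trans:
  assumes "ple h k" "ple k l" shows "ple h l"
  unfolding ple_def
proof
  fix u assume "u \<in> carrier G"
  from pleD[OF assms(1) this] pleD[OF assms(2) this]
  show "AE w in M. h u w \<le> l u w" by eventually_elim simp
qed

text \<open>Doubling at the null element forces \<open>h \<zero> = 0\<close>; then subadditivity
  applies to \<open>u\<close> and its negative. This supplies the lower bounds that keep essential
  infima finite.\<close>

lemma sublin_neg:
  assumes h: "sublin h" and u: "u \<in> carrier G"
  shows "AE w in M. - h (\<ominus> u) w \<le> h u w"
proof -
  have "AE w in M. h (\<zero> \<oplus> \<zero>) w = 2 * h \<zero> w" by (rule sublin_dbl[OF h]) simp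
  then have "AE w in M. h \<zero> w = 0" by simp
  moreover have "AE w in M. h (u \<oplus> \<ominus> u) w \<le> h u w + h (\<ominus> u) w"
    by (rule sublin_add[OF h]) (use u in simp_all)
  ultimately show ?thesis unfolding r_neg[OF u] by eventually_elim simp
qed

text \<open>Common criterion for infima over chains, for the descent to a minimal element and for
  the separating functional. One half of the doubling identity is subadditivity at
  \<open>u, u\<close>; \<open>dbl\<close> gives the other.\<close>

lemma sublin_ess_inf:
  assumes m: "\<And>u. u \<in> carrier G \<Longrightarrow> is_ess_inf M (S u) (m u)"
    and dbl: "\<And>u X. u \<in> carrier G \<Longrightarrow> X \<in> S (u \<oplus> u) \<Longrightarrow> AE w in M. 2 * m u w \<le> X w"
    and add: "\<And>u v X Y. u \<in> carrier G \<Longrightarrow> v \<in> carrier G \<Longrightarrow> X \<in> S u \<Longrightarrow> Y \<in> S v \<Longrightarrow>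
        AE w in M. m (u \<oplus> v) w \<le> X w + Y w"
  shows "sublin m"
  unfolding sublin_def
proof (intro conjI ballI)
  show "m u \<in> borel_measurable M" if "u \<in> carrier G" for u
    using m[OF that] by (rule is_ess_inf_measurable)
  show 1: "AE w in M. m (u \<oplus> v) w \<le> m u w + m v w" if "u \<in> carrier G" "v \<in> carrier G" for u v
    by (rule is_ess_inf_add_greatest[OF m m]) (rule that add | assumption)+
  show "AE w in M. m (u \<oplus> u) w = 2 * m u w" if u: "u \<in> carrier G" for u
  proof -
    have "AE w in M. 2 * m u w \<le> m (u \<oplus> u) w"
      by (rule is_ess_inf_greatest[OF m]) (use u in \<open>auto intro: dbl\<close>)
    with 1[OF u u] show ?thesis by eventually_elim simp
  qed
qed

text \<open>In a chain the smaller of two members serves for both summands, so subadditivity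
  survives the infimum. The infimum at \<open>u\<close> is finite because all members lie above
  \<open>- p (\<ominus> u)\<close>.\<close>

lemma chain_ess_inf:
  assumes C: "C \<noteq> {}" "\<And>h. h \<in> C \<Longrightarrow> sublin h \<and> ple h p"
    and chain: "\<And>h k. h \<in> C \<Longrightarrow> k \<in> C \<Longrightarrow> ple h k \<or> ple k h"
  obtains m where "sublin m" "\<forall>h\<in>C. ple m h"
proof -
  define S where "S u = (\<lambda>h. h u) ` C" for u
  have "\<exists>m. is_ess_inf M (S u) m" if u: "u \<in> carrier G" for u
  proof (rule exists_is_ess_inf)
    show "S u \<subseteq> borel_measurable M" unfolding S_def
      by (rule image_subsetI) (use C(2) u sublin_measurable in simp)
    show "S u \<noteq> {}" using C(1) by (simp add: S_def)
    fix X assume "X \<in> S u"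
    then obtain h where h: "h \<in> C" "X = h u" unfolding S_def by (elim imageE)
    have "AE w in M. h (\<ominus> u) w \<le> p (\<ominus> u) w" using C(2)[OF h(1)] u by (intro pleD) simp_all
    moreover have "AE w in M. - h (\<ominus> u) w \<le> h u w" using C(2)[OF h(1)] u by (intro sublin_neg) simp_all
    ultimately show "AE w in M. - p (\<ominus> u) w \<le> X w" unfolding h(2) by eventually_elim simp
  qed
  then have "\<forall>u\<in>carrier G. \<exists>m. is_ess_inf M (S u) m" by (rule ballI)
  then obtain m where m': "\<forall>u\<in>carrier G. is_ess_inf M (S u) (m u)" by (elim bchoice[elim_format] exE)
  then have m: "is_ess_inf M (S u) (m u)" if "u \<in> carrier G" for u using that by (rule bspec)
  have lower: "AE w in M. m u w \<le> h u w" if "h \<in> C" "u \<in> carrier G" for h u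
    by (rule is_ess_inf_lower[OF m[OF that(2)]]) (use that in \<open>simp add: S_def\<close>)
  have "sublin m"
  proof (rule sublin_ess_inf[OF m])
    fix u X assume u: "u \<in> carrier G" "X \<in> S (u \<oplus> u)"
    then obtain h where h: "h \<in> C" "X = h (u \<oplus> u)" unfolding S_def by (elim imageE)
    have "AE w in M. h (u \<oplus> u) w = 2 * h u w" using C(2)[OF h(1)] u by (intro sublin_dbl) simp_all
    with lower[OF h(1) u(1)] show "AE w in M. 2 * m u w \<le> X w" unfolding h(2) by eventually_elim simp
  next
    fix u v X Y assume u: "u \<in> carrier G" "v \<in> carrier G" "X \<in> S u" "Y \<in> S v"
    obtain h where h: "h \<in> C" "X = h u" using u(3) unfolding S_def by (elim imageE)
    obtain k where k: "k \<in> C" "Y = k v" using u(4) unfolding S_def by (elim imageE)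
    have uv: "u \<oplus> v \<in> carrier G" using u by simp
    show "AE w in M. m (u \<oplus> v) w \<le> X w + Y w"
    proof (cases "ple h k")
      case True
      have "AE w in M. h (u \<oplus> v) w \<le> h u w + h v w" using C(2)[OF h(1)] u by (intro sublin_add) simp_all
      with lower[OF h(1) uv] pleD[OF True u(2)] show ?thesis unfolding h(2) k(2) by eventually_elim simp
    next
      case False
      then have kh: "ple k h" using chain[OF h(1) k(1)] by simp
      have "AE w in M. k (u \<oplus> v) w \<le> k u w + k v w" using C(2)[OF k(1)] u by (intro sublin_add) simp_all
      with lower[OF k(1) uv] pleD[OF kh u(1)] show ?thesis unfolding h(2) k(2) by eventually_elim simp
    qed
  qed
  moreover have "\<forall>h\<in>C. ple m h" unfolding ple_def using lower by simp
  ultimately show ?thesis by (rule that)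
qed

text \<open>As \<open>ple\<close> is only a preorder (it ignores null sets), minimality is stated up
  to \<open>ple\<close> and a maximal chain is used. A sublinear \<open>k\<close> below the lower
  bound \<open>m\<close> of that chain is below every member, so it belongs to the chain and lies
  above \<open>m\<close>.\<close>

lemma exists_minimal_sublin:
  assumes p: "sublin p"
  obtains m where "sublin m" "ple m p" "\<forall>k. sublin k \<and> ple k m \<longrightarrow> ple m k"
proof -
  define A where "A = {h. sublin h \<and> ple h p}"
  have pp0: "ple h h" for h by (simp add: ple_def)
  note pp = pp0[of p]
  obtain C where C: "pred_on.maxchain A ple C" using pred_on.Hausdorff[of A ple] by (elim exE)
  have chainC: "pred_on.chain A ple C" and maxC: "\<not> (\<exists>S. pred_on.chain A ple S \<and> C \<subset> S)"
    using C unfolding pred_on.maxchain_def by blast+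
  have CA: "C \<subseteq> A" using chainC by (simp add: pred_on.chain_def)
  have ch: "ple h k \<or> ple k h" if "h \<in> C" "k \<in> C" for h k
    using chainC that pp0 unfolding pred_on.chain_def by blast
  have add: "k \<in> C" if k: "k \<in> A" "\<And>h. h \<in> C \<Longrightarrow> ple k h" for k
  proof (rule ccontr)
    assume "k \<notin> C"
    have "ple x y \<or> ple y x" if x: "x \<in> insert k C" and y: "y \<in> insert k C" for x y
      using x y k(2) ch pp0[of k] by (elim insertE) simp_all
    then have "pred_on.chain A ple (insert k C)"
      unfolding pred_on.chain_def using CA k(1) by blast
    moreover have "C \<subset> insert k C" using \<open>k \<notin> C\<close> by (simp add: psubset_eq subset_insertI) blast
    ultimately show False using maxC by simp
  qed
  have Cne: "C \<noteq> {}"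
  proof
    assume "C = {}"
    then have "p \<in> C" by (intro add) (use p pp in \<open>simp_all add: A_def\<close>)
    then show False using \<open>C = {}\<close> by simp
  qed
  have CA': "sublin h \<and> ple h p" if "h \<in> C" for h using CA that unfolding A_def by (simp add: subset_iff)
  obtain m where m: "sublin m" "\<forall>h\<in>C. ple m h" by (rule chain_ess_inf[OF Cne CA' ch])
  obtain h where h: "h \<in> C" using Cne by (metis ex_in_conv)
  have mp: "ple m p" using m(2) h CA'[OF h] ple_trans[of m h p] by simp
  show ?thesis
  proof (rule that[OF m(1) mp], intro allI impI)
    fix k assume k: "sublin k \<and> ple k m"
    have "k \<in> C"
    proof (rule add)
      show "k \<in> A" using k mp ple_trans[of k m p] by (simp add: A_def)
      show "ple k h" if "h \<in> C" for h using k m(2) that ple_trans[of k m h] by simp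
    qed
    then show "ple m k" using m(2) by simp
  qed
qed

text \<open>The multiple of \<open>v\<close> by \<open>2 ^ n\<close>, formed by addition alone
  because the group has no scalars.\<close>

primrec dbl :: "nat \<Rightarrow> 'e \<Rightarrow> 'e" where
  "dbl 0 v = v"
| "dbl (Suc n) v = dbl n v \<oplus> dbl n v"

lemma dbl_closed [simp]: "v \<in> carrier G \<Longrightarrow> dbl n v \<in> carrier G"
  by (induction n) simp_all

lemma sublin_dbl_pow:
  assumes "sublin h" "v \<in> carrier G"
  shows "AE w in M. h (dbl n v) w = 2 ^ n * h v w"
proof (induction n)
  case (Suc n)
  with sublin_dbl[OF assms(1) dbl_closed[OF assms(2), of n]]
  show ?case unfolding dbl.simps(2) by eventually_elim simp
qed simp

text \<open>The infimum \<open>k\<close> over \<open>n\<close> of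
  \<open>a n u = h (u \<oplus> dbl n v) - 2 ^ n * h v\<close> is again sublinear, and the term
  \<open>n = 0\<close> shows \<open>k \<le> h\<close>. Minimality gives
  \<open>h u0 \<le> k u0 \<le> h (u0 \<oplus> v) - h v\<close>, the inequality opposite to
  subadditivity.\<close>

lemma minimal_sublin_additive:
  assumes h: "sublin h" and min: "\<forall>k. sublin k \<and> ple k h \<longrightarrow> ple h k"
    and u0: "u0 \<in> carrier G" and v: "v \<in> carrier G"
  shows "AE w in M. h (u0 \<oplus> v) w = h u0 w + h v w"
proof -
  define a where "a n u w = h (u \<oplus> dbl n v) w - 2 ^ n * h v w" for n u w
  note hm = sublin_measurable[OF h] and hadd = sublin_add[OF h] and hdbl = sublin_dbl[OF h]
  note vn = sublin_dbl_pow[OF h v]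
  have am: "a n u \<in> borel_measurable M" if "u \<in> carrier G" for n u
    unfolding a_def[abs_def] using hm[of "u \<oplus> dbl n v"] hm[OF v] that v by simp
  have low: "AE w in M. - h (\<ominus> u) w \<le> a n u w" if u: "u \<in> carrier G" for n u
  proof -
    have "\<ominus> u \<oplus> (u \<oplus> dbl n v) = dbl n v" using u v by (simp add: r_neg1)
    moreover have "AE w in M. h (\<ominus> u \<oplus> (u \<oplus> dbl n v)) w \<le> h (\<ominus> u) w + h (u \<oplus> dbl n v) w"
      using u v by (intro hadd) simp_all
    ultimately have "AE w in M. h (dbl n v) w \<le> h (\<ominus> u) w + h (u \<oplus> dbl n v) w" by simp
    then show ?thesis using vn[of n] by eventually_elim (unfold a_def power_Suc, linarith)
  qed
  have dec1: "AE w in M. a (Suc n) u w \<le> a n u w" if u: "u \<in> carrier G" for n u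
  proof -
    have "u \<oplus> dbl n v \<oplus> dbl n v = u \<oplus> dbl (Suc n) v" using u v by (simp add: a_assoc)
    moreover have "AE w in M. h (u \<oplus> dbl n v \<oplus> dbl n v) w \<le> h (u \<oplus> dbl n v) w + h (dbl n v) w"
      using u v by (intro hadd) simp_all
    ultimately have "AE w in M. h (u \<oplus> dbl (Suc n) v) w \<le> h (u \<oplus> dbl n v) w + h (dbl n v) w" by simp
    then show ?thesis using vn[of n]
    proof eventually_elim
      case (elim w)
      then show ?case unfolding a_def power_Suc by linarith
    qed
  qed
  have dec: "AE w in M. a (n + k) u w \<le> a n u w" if u: "u \<in> carrier G" for n k u
  proof (induction k)
    case (Suc k)
    with dec1[OF u, of "n + k"] show ?case unfolding add_Suc_right by eventually_elim simp
  qed simp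
  define S where "S u = range (\<lambda>n. a n u)" for u
  have "\<exists>m. is_ess_inf M (S u) m" if u: "u \<in> carrier G" for u
  proof (rule exists_is_ess_inf)
    show "S u \<subseteq> borel_measurable M" unfolding S_def by (rule image_subsetI) (rule am[OF u])
    show "S u \<noteq> {}" by (simp add: S_def)
    fix X assume "X \<in> S u"
    then obtain n where "X = a n u" unfolding S_def by (elim rangeE)
    then show "AE w in M. - h (\<ominus> u) w \<le> X w" using low[OF u, of n] by simp
  qed
  then have "\<forall>u\<in>carrier G. \<exists>m. is_ess_inf M (S u) m" by (rule ballI)
  then obtain k where k': "\<forall>u\<in>carrier G. is_ess_inf M (S u) (k u)" by (elim bchoice[elim_format] exE)
  then have k: "is_ess_inf M (S u) (k u)" if "u \<in> carrier G" for u using that by (rule bspec)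
  have lower: "AE w in M. k u w \<le> a n u w" if "u \<in> carrier G" for n u
    by (rule is_ess_inf_lower[OF k[OF that]]) (simp add: S_def)
  have "sublin k"
  proof (rule sublin_ess_inf[OF k])
    fix u X assume u: "u \<in> carrier G" "X \<in> S (u \<oplus> u)"
    then obtain n where n: "X = a n (u \<oplus> u)" unfolding S_def by (elim rangeE)
    have uu: "u \<oplus> u \<in> carrier G" using u by simp
    \<comment> \<open>Twice the term of index \<open>n\<close> at \<open>u\<close> is the term of
      index \<open>Suc n\<close> at \<open>u \<oplus> u\<close>, which lies below the term of index
      \<open>n\<close> there.\<close>
    have "(u \<oplus> dbl n v) \<oplus> (u \<oplus> dbl n v) = u \<oplus> u \<oplus> dbl (Suc n) v" using u v by (simp add: a_ac)
    moreover have "AE w in M. h ((u \<oplus> dbl n v) \<oplus> (u \<oplus> dbl n v)) w = 2 * h (u \<oplus> dbl n v) w"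
      using u v by (intro hdbl) simp_all
    ultimately have "AE w in M. h (u \<oplus> u \<oplus> dbl (Suc n) v) w = 2 * h (u \<oplus> dbl n v) w" by simp
    then show "AE w in M. 2 * k u w \<le> X w"
      using lower[OF u(1), of n] dec1[OF uu, of n] unfolding n
      by eventually_elim (unfold a_def power_Suc, linarith)
  next
    fix u u' X Y assume u: "u \<in> carrier G" "u' \<in> carrier G" "X \<in> S u" "Y \<in> S u'"
    obtain n where n: "X = a n u" using u(3) unfolding S_def by (elim rangeE)
    obtain n' where n': "Y = a n' u'" using u(4) unfolding S_def by (elim rangeE)
    \<comment> \<open>A common index beyond \<open>n\<close> and \<open>n'\<close>: the terms
      decrease, so both may be replaced by those of index \<open>N\<close>. Their sum dominates the
      term of index \<open>Suc N\<close> at \<open>u \<oplus> u'\<close>.\<close>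
    define N where "N = n + n'"
    have uu: "u \<oplus> u' \<in> carrier G" using u by simp
    have d: "AE w in M. a N u w \<le> a n u w" "AE w in M. a N u' w \<le> a n' u' w"
      using dec[OF u(1), of n n'] dec[OF u(2), of n' n] by (simp_all add: N_def add.commute)
    have "(u \<oplus> dbl N v) \<oplus> (u' \<oplus> dbl N v) = u \<oplus> u' \<oplus> dbl (Suc N) v" using u v by (simp add: a_ac)
    moreover have "AE w in M. h ((u \<oplus> dbl N v) \<oplus> (u' \<oplus> dbl N v)) w \<le> h (u \<oplus> dbl N v) w + h (u' \<oplus> dbl N v) w"
      using u v by (intro hadd) simp_all
    ultimately have "AE w in M. h (u \<oplus> u' \<oplus> dbl (Suc N) v) w \<le> h (u \<oplus> dbl N v) w + h (u' \<oplus> dbl N v) w" by simp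
    then show "AE w in M. k (u \<oplus> u') w \<le> X w + Y w"
      using lower[OF uu, of "Suc N"] d unfolding n n' by eventually_elim (unfold a_def power_Suc, linarith)
  qed
  moreover have "ple k h"
    unfolding ple_def
  proof
    fix u assume u: "u \<in> carrier G"
    from lower[OF u, of 0] hadd[OF u v] show "AE w in M. k u w \<le> h u w"
      by eventually_elim (simp add: a_def)
  qed
  ultimately have "ple h k" using min by simp
  from pleD[OF this u0] lower[OF u0, of 0] hadd[OF u0 v] show ?thesis
    by eventually_elim (simp add: a_def)
qed

theorem hahn_banach_kantorovich:
  assumes "sublin p"
  obtains g where "\<forall>u\<in>carrier G. g u \<in> borel_measurable M"
    "\<forall>u\<in>carrier G. AE w in M. g u w \<le> p u w"
    "\<forall>u\<in>carrier G. \<forall>v\<in>carrier G. AE w in M. g (u \<oplus> v) w = g u w + g v w"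
proof -
  obtain m where m: "sublin m" "ple m p" "\<forall>k. sublin k \<and> ple k m \<longrightarrow> ple m k"
    by (rule exists_minimal_sublin[OF assms])
  show ?thesis
  proof (rule that[of m])
    show "\<forall>u\<in>carrier G. m u \<in> borel_measurable M" using sublin_measurable[OF m(1)] by (rule ballI)
    show "\<forall>u\<in>carrier G. AE w in M. m u w \<le> p u w" using m(2) by (simp add: ple_def)
    show "\<forall>u\<in>carrier G. \<forall>v\<in>carrier G. AE w in M. m (u \<oplus> v) w = m u w + m v w"
      by (intro ballI minimal_sublin_additive[OF m(1,3)])
  qed
qed

end

section \<open>Lower semicontinuity on a nonnegligible set\<close>

definition nonnegligible :: "'a measure \<Rightarrow> 'a set \<Rightarrow> bool" where
  "nonnegligible M A \<longleftrightarrow> A \<in> sets M \<and> \<not> (AE w in M. w \<notin> A)"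

lemma nonnegligible_sets: "nonnegligible M A \<Longrightarrow> A \<in> sets M"
  by (simp add: nonnegligible_def)

text \<open>Otherwise \<open>B\<close> would be covered by countably many null sets. This is the
  device that turns a random bound into a constant by passing to a smaller set.\<close>

lemma nonnegligible_split:
  fixes T :: "nat \<Rightarrow> 'a \<Rightarrow> bool"
  assumes B: "nonnegligible M B" and T: "\<And>n. {w \<in> space M. T n w} \<in> sets M"
    and cover: "AE w in M. w \<in> B \<longrightarrow> (\<exists>n. T n w)"
  obtains n C where "nonnegligible M C" "C \<subseteq> B" "\<forall>w\<in>C. T n w"
proof (rule ccontr)
  assume no: "\<not> thesis"
  have "AE w in M. \<not> (w \<in> B \<and> T n w)" for n
  proof -
    let ?C = "B \<inter> {w \<in> space M. T n w}"
    have "?C \<in> sets M" by (rule sets.Int[OF nonnegligible_sets[OF B] T])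
    moreover have "\<not> nonnegligible M ?C"
    proof
      assume "nonnegligible M ?C"
      then have thesis by (rule that[of _ n]) simp_all
      with no show False by (rule notE)
    qed
    ultimately have "AE w in M. w \<notin> ?C" by (simp add: nonnegligible_def)
    with AE_space show ?thesis by eventually_elim blast
  qed
  then have "AE w in M. \<forall>n. \<not> (w \<in> B \<and> T n w)" unfolding AE_all_countable by (rule allI)
  with cover have "AE w in M. w \<notin> B" by eventually_elim blast
  with B show False by (simp add: nonnegligible_def)
qed

locale lsc_convex_function = random_locally_convex_module M E P
  for M :: "'w measure" and E :: "(('w \<Rightarrow> real) set, 'e) module" and P +
  fixes f :: "'e \<Rightarrow> ('w \<Rightarrow> ereal) set"
  assumes conc: "countable_concatenation M E"
    and f_carrier: "f \<in> carrier E \<rightarrow> carrier (L0bar M)"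
    and proper: "proper_fun M E f"
    and lsc: "Tc_lsc M E P f"
    and convex: "L0_convex M E f"
begin

abbreviation F :: "'e \<Rightarrow> 'w \<Rightarrow> ereal" where "F x \<equiv> rep (f x)"

lemma f_closed [simp]: "x \<in> carrier E \<Longrightarrow> f x \<in> carrier (L0bar M)"
  using f_carrier by (rule funcset_mem)

lemma F_measurable [measurable (raw), simp]: "x \<in> carrier E \<Longrightarrow> F x \<in> borel_measurable M"
  by (intro L0bar_rep_measurable f_closed)

lemma F_gt: "x \<in> carrier E \<Longrightarrow> AE w in M. - \<infinity> < F x w"
  using proper by (simp add: proper_fun_def)

lemma dom_carrier: "x \<in> dom_fun M E f \<Longrightarrow> x \<in> carrier E"
  by (simp add: dom_fun_def)

lemma dom_finite: "x \<in> dom_fun M E f \<Longrightarrow> AE w in M. F x w = ereal (real_of_ereal (F x w))"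
proof -
  assume x: "x \<in> dom_fun M E f"
  then have "AE w in M. F x w < \<infinity>" by (simp add: dom_fun_def)
  with F_gt[OF dom_carrier[OF x]] show ?thesis
  proof eventually_elim
    case (elim w) then show ?case by (cases "F x w") simp_all
  qed
qed

lemma ae_class_one_minus:
  assumes "\<xi> \<in> borel_measurable M"
  shows "\<one>\<^bsub>L0 M\<^esub> \<ominus>\<^bsub>L0 M\<^esub> ae_class M \<xi> = ae_class M (\<lambda>w. 1 - \<xi> w)"
proof -
  have m: "(\<lambda>w. - \<xi> w) \<in> borel_measurable M" using assms by simp
  have "ae_class M (\<lambda>w. - \<xi> w) \<oplus>\<^bsub>L0 M\<^esub> ae_class M \<xi> = ae_class M (\<lambda>w. - \<xi> w + \<xi> w)"
    by (rule ae_class_add[OF m assms, symmetric])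
  then have "ae_class M (\<lambda>w. - \<xi> w) \<oplus>\<^bsub>L0 M\<^esub> ae_class M \<xi> = \<zero>\<^bsub>L0 M\<^esub>"
    by (simp add: ae_class_zero)
  then have "\<ominus>\<^bsub>L0 M\<^esub> ae_class M \<xi> = ae_class M (\<lambda>w. - \<xi> w)"
    by (rule R.minus_equality) (use assms m in simp_all)
  then have "\<one>\<^bsub>L0 M\<^esub> \<ominus>\<^bsub>L0 M\<^esub> ae_class M \<xi> = \<one>\<^bsub>L0 M\<^esub> \<oplus>\<^bsub>L0 M\<^esub> ae_class M (\<lambda>w. - \<xi> w)"
    by (simp only: R.minus_eq)
  also have "\<dots> = ae_class M (\<lambda>w. 1 + - \<xi> w)"
    unfolding ae_class_one[symmetric] by (rule ae_class_add[symmetric]) (use m in simp_all)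
  finally show ?thesis by simp
qed

section \<open>Convexity and locality of the function\<close>

lemma F_convex:
  assumes \<xi>: "\<xi> \<in> borel_measurable M" "\<And>w. 0 \<le> \<xi> w" "\<And>w. \<xi> w \<le> 1" and x: "x \<in> carrier E" and y: "y \<in> carrier E"
  shows "AE w in M. F (rsm \<xi> x \<oplus>\<^bsub>E\<^esub> rsm (\<lambda>w. 1 - \<xi> w) y) w \<le> ereal (\<xi> w) * F x w + ereal (1 - \<xi> w) * F y w"
proof -
  define a where "a = ae_class M \<xi>"
  define b where "b = ae_class M (\<lambda>w. 1 - \<xi> w)"
  have m: "(\<lambda>w. 1 - \<xi> w) \<in> borel_measurable M" using \<xi> by simp
  have ac: "a \<in> carrier (L0 M)" and bc: "b \<in> carrier (L0 M)" using \<xi> m by (simp_all add: a_def b_def)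
  note ra = AE_rep_ae_class[OF \<xi>(1), folded a_def] and rb = AE_rep_ae_class[OF m, folded b_def]
  have "AE w in M. rep \<zero>\<^bsub>L0 M\<^esub> w \<le> rep a w"
    using ra AE_rep_zero by eventually_elim (simp add: \<xi>)
  moreover have "AE w in M. rep a w \<le> rep \<one>\<^bsub>L0 M\<^esub> w"
    using ra AE_rep_one by eventually_elim (simp add: \<xi>)
  ultimately have a: "a \<in> L0_nonneg M" "as_le M a \<one>\<^bsub>L0 M\<^esub>"
    using ac by (simp_all add: L0_nonneg_def as_le_def)
  have "f (a \<odot>\<^bsub>E\<^esub> x \<oplus>\<^bsub>E\<^esub> (\<one>\<^bsub>L0 M\<^esub> \<ominus>\<^bsub>L0 M\<^esub> a) \<odot>\<^bsub>E\<^esub> y) \<sqsubseteq>\<^bsub>L0bar M\<^esub>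
        L0bar_add M (L0bar_mult M (to_L0bar M a) (f x))
                    (L0bar_mult M (to_L0bar M (\<one>\<^bsub>L0 M\<^esub> \<ominus>\<^bsub>L0 M\<^esub> a)) (f y))"
    using convex x y a unfolding L0_convex_def by simp
  then have "AE w in M. F (rsm \<xi> x \<oplus>\<^bsub>E\<^esub> rsm (\<lambda>w. 1 - \<xi> w) y) w \<le>
      rep (L0bar_add M (L0bar_mult M (to_L0bar M a) (f x)) (L0bar_mult M (to_L0bar M b) (f y))) w"
    unfolding a_def ae_class_one_minus[OF \<xi>(1)] b_def rsm_def le_L0bar as_le_def .
  moreover have "AE w in M. rep (L0bar_add M (L0bar_mult M (to_L0bar M a) (f x)) (L0bar_mult M (to_L0bar M b) (f y))) w
      = rep (L0bar_mult M (to_L0bar M a) (f x)) w + rep (L0bar_mult M (to_L0bar M b) (f y)) w"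
    by (rule AE_rep_L0bar_add) (use x y ac bc in simp_all)
  moreover have "AE w in M. rep (L0bar_mult M (to_L0bar M a) (f x)) w = rep (to_L0bar M a) w * F x w"
    by (rule AE_rep_L0bar_mult) (use x y ac bc in simp_all)
  moreover have "AE w in M. rep (L0bar_mult M (to_L0bar M b) (f y)) w = rep (to_L0bar M b) w * F y w"
    by (rule AE_rep_L0bar_mult) (use x y ac bc in simp_all)
  moreover note AE_rep_to_L0bar[OF ac] AE_rep_to_L0bar[OF bc] ra rb
  ultimately show ?thesis by eventually_elim simp
qed

text \<open>Convexity with the random scalar \<open>indicator A\<close> is locality: if
  \<open>x\<close> and \<open>y\<close> agree on \<open>A\<close>, gluing \<open>x\<close> on
  \<open>A\<close> to \<open>y\<close> elsewhere returns \<open>y\<close>. On \<open>A\<close> the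
  convention for 0 times infinity removes the term of \<open>y\<close>.\<close>

lemma F_eqon_le:
  assumes A: "A \<in> sets M" and x: "x \<in> carrier E" and y: "y \<in> carrier E" and e: "eqon A x y"
  shows "AE w in M. w \<in> A \<longrightarrow> F y w \<le> F x w"
proof -
  have "rsm (indicator A) x \<oplus>\<^bsub>E\<^esub> rsm (\<lambda>w. 1 - indicator A w) y = y"
    using glue_same[OF A y] glue_cong[OF e, of y] unfolding glue_def by simp
  moreover have "AE w in M. F (rsm (indicator A) x \<oplus>\<^bsub>E\<^esub> rsm (\<lambda>w. 1 - indicator A w) y) w
      \<le> ereal (indicator A w) * F x w + ereal (1 - indicator A w) * F y w"
    by (rule F_convex) (use A x y in \<open>simp_all add: indicator_def\<close>)
  ultimately have "AE w in M. F y w \<le> ereal (indicator A w) * F x w + ereal (1 - indicator A w) * F y w"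
    by simp
  then show ?thesis
  proof eventually_elim
    case (elim w)
    show ?case
    proof
      assume "w \<in> A"
      with elim show "F y w \<le> F x w" by (simp add: zero_ereal_def[symmetric] one_ereal_def[symmetric])
    qed
  qed
qed

lemma F_eqon:
  assumes A: "A \<in> sets M" and x: "x \<in> carrier E" and y: "y \<in> carrier E" and e: "eqon A x y"
  shows "AE w in M. w \<in> A \<longrightarrow> F x w = F y w"
  using F_eqon_le[OF assms] F_eqon_le[OF A y x e[unfolded eqon_def, symmetric, folded eqon_def]]
  by eventually_elim auto

lemma F_glue:
  assumes A: "A \<in> sets M" and x: "x \<in> carrier E" and y: "y \<in> carrier E"
  shows "AE w in M. F (glue A x y) w = (if w \<in> A then F x w else F y w)"
proof -
  have c: "space M - A \<in> sets M" using A by simp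
  note g = glue_closed[OF A x y]
  from F_eqon[OF A g x glue_eqon[OF A x y]] F_eqon[OF c g y glue_eqon_compl[OF A x y]] AE_space
  show ?thesis by eventually_elim simp
qed

lemma concat_sequence:
  fixes A :: "nat \<Rightarrow> 'w set"
  assumes "\<And>n. X n \<in> carrier E" "\<And>n. A n \<in> sets M" "disjoint_family A" "(\<Union>n. A n) = space M"
  obtains x where "x \<in> carrier E" "\<forall>n. eqon (A n) x (X n)"
proof -
  have "range X \<subseteq> carrier E \<and> range A \<subseteq> sets M \<and> disjoint_family A \<and> (\<Union>n. A n) = space M"
    using assms by auto
  then have "\<exists>x\<in>carrier E. \<forall>n. L0_ind M (A n) \<odot>\<^bsub>E\<^esub> x = L0_ind M (A n) \<odot>\<^bsub>E\<^esub> X n"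
    using conc unfolding countable_concatenation_def by simp
  then obtain x where "x \<in> carrier E" "\<forall>n. L0_ind M (A n) \<odot>\<^bsub>E\<^esub> x = L0_ind M (A n) \<odot>\<^bsub>E\<^esub> X n"
    by (elim bexE)
  then show ?thesis using that[of x] by (simp add: eqon_def rsm_def L0_ind_def)
qed

section \<open>From the closed epigraph to a uniform local bound\<close>

text \<open>Only the point is moved inside the product neighbourhood; the level \<open>r\<close>
  stays fixed. Since \<open>qn Q\<close> dominates each of its seminorms, smallness of the sum
  suffices. The set on which \<open>F z\<close> exceeds \<open>r\<close> may still depend on
  \<open>z\<close>.\<close>

lemma epi_separation:
  assumes x: "x \<in> carrier E" and r: "r \<in> carrier (L0 M)" and not: "\<not> (AE w in M. F x w \<le> ereal (rep r w))"
  obtains Q \<epsilon> where "finite Q" "Q \<noteq> {}" "Q \<subseteq> P" "\<epsilon> \<in> L0_pos M"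
    "\<forall>z\<in>carrier E. (AE w in M. qn Q (z \<ominus>\<^bsub>E\<^esub> x) w \<le> rep \<epsilon> w) \<longrightarrow> \<not> (AE w in M. F z w \<le> ereal (rep r w))"
proof -
  let ?T = "prod_topology (Tc M E P) (Tc_L0 M)"
  have epi: "(z, r) \<in> epi_fun M E f \<longleftrightarrow> (AE w in M. F z w \<le> ereal (rep r w))" if "z \<in> carrier E" for z
  proof -
    have "(AE w in M. F z w \<le> rep (to_L0bar M r) w) \<longleftrightarrow> (AE w in M. F z w \<le> ereal (rep r w))"
      using AE_rep_to_L0bar[OF r] by (intro eventually_subst) (auto elim!: eventually_mono)
    then show ?thesis using that r by (simp add: epi_fun_def as_le_def)
  qed
  have "openin ?T (topspace ?T - epi_fun M E f)"
    using lsc by (simp add: Tc_lsc_def closedin_def)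
  then have op: "(a, b) \<in> topspace ?T - epi_fun M E f \<Longrightarrow> \<exists>U V. openin (Tc M E P) U \<and> openin (Tc_L0 M) V \<and>
      a \<in> U \<and> b \<in> V \<and> U \<times> V \<subseteq> topspace ?T - epi_fun M E f" for a b
    unfolding openin_prod_topology_alt by (elim allE) (rule mp)
  have "(x, r) \<in> topspace ?T - epi_fun M E f"
    using x r not epi[OF x] by (simp add: topspace_Tc_E topspace_Tc_L0)
  from op[OF this] obtain U V where U: "openin (Tc M E P) U" and V: "openin (Tc_L0 M) V"
    and xU: "x \<in> U" "r \<in> V" and UV: "U \<times> V \<subseteq> topspace ?T - epi_fun M E f"
    by (elim exE conjE)
  have "\<exists>Q \<epsilon>. finite Q \<and> Q \<noteq> {} \<and> Q \<subseteq> P \<and> \<epsilon> \<in> L0_pos M \<and> (\<forall>y\<in>Tc_nbhd M E Q \<epsilon>. x \<oplus>\<^bsub>E\<^esub> y \<in> U)"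
    using U[unfolded openin_Tc_E] xU(1) by (elim conjE) (rule bspec)
  then obtain Q \<epsilon> where Q: "finite Q" "Q \<noteq> {}" "Q \<subseteq> P" "\<epsilon> \<in> L0_pos M"
    and n: "\<forall>y\<in>Tc_nbhd M E Q \<epsilon>. x \<oplus>\<^bsub>E\<^esub> y \<in> U" by (elim exE conjE)
  have ec: "\<epsilon> \<in> carrier (L0 M)" using Q by (simp add: L0_pos_def)
  show ?thesis
  proof (rule that[OF Q], intro ballI impI)
    fix z assume z: "z \<in> carrier E" and zx: "AE w in M. qn Q (z \<ominus>\<^bsub>E\<^esub> x) w \<le> rep \<epsilon> w"
    have zxc: "z \<ominus>\<^bsub>E\<^esub> x \<in> carrier E" using z x by simp
    have "z \<ominus>\<^bsub>E\<^esub> x \<in> Tc_nbhd M E Q \<epsilon>"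
    proof (subst Tc_nbhd_iff)
      show "p \<in> carrier E \<rightarrow> carrier (L0 M)" if "p \<in> Q" for p
        by (rule seminorm_carrier[OF subsetD[OF Q(3) that]])
      show "z \<ominus>\<^bsub>E\<^esub> x \<in> carrier E \<and> (\<forall>p\<in>Q. AE w in M. rep (p (z \<ominus>\<^bsub>E\<^esub> x)) w \<le> rep \<epsilon> w)"
      proof (intro conjI ballI zxc)
        fix p assume "p \<in> Q"
        from seminorm_le_qn[OF Q(1,3) zxc this] zx
        show "AE w in M. rep (p (z \<ominus>\<^bsub>E\<^esub> x)) w \<le> rep \<epsilon> w" by eventually_elim simp
      qed
    qed (use Q ec in simp_all)
    then have "x \<oplus>\<^bsub>E\<^esub> (z \<ominus>\<^bsub>E\<^esub> x) \<in> U" using n by simp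
    moreover have "x \<oplus>\<^bsub>E\<^esub> (z \<ominus>\<^bsub>E\<^esub> x) = z"
      using x z M.a_lcomm[of x z "\<ominus>\<^bsub>E\<^esub> x"] by (simp add: M.minus_eq M.r_neg)
    ultimately have "(z, r) \<in> U \<times> V" using xU by simp
    from subsetD[OF UV this] have "(z, r) \<notin> epi_fun M E f" by (simp only: Diff_iff not_False_eq_True)
    then show "\<not> (AE w in M. F z w \<le> ereal (rep r w))" using epi[OF z] by simp
  qed
qed

lemma dom_ne: obtains x0 where "x0 \<in> dom_fun M E f"
  using proper unfolding proper_fun_def by (metis ex_in_conv)

lemma qn_minus_self: "finite Q \<Longrightarrow> Q \<subseteq> P \<Longrightarrow> x \<in> carrier E \<Longrightarrow> AE w in M. qn Q (x \<ominus>\<^bsub>E\<^esub> x) w = 0"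
  using qn_rsm[of Q "\<zero>\<^bsub>E\<^esub>" "\<lambda>_. 0"] by (simp add: M.minus_eq M.r_neg)

lemma eqon_minus_right:
  assumes "A \<in> sets M" "x \<in> carrier E" "y \<in> carrier E" "z \<in> carrier E" "eqon A x y"
  shows "eqon A (z \<ominus>\<^bsub>E\<^esub> x) (z \<ominus>\<^bsub>E\<^esub> y)"
  using assms by (simp add: eqon_def M.minus_eq rsm_distr rsm_r_minus)

text \<open>Call \<open>B\<close> bad if a single point is close to \<open>x\<close> and has value
  at most \<open>\<beta>\<close> throughout \<open>B\<close>. The countable concatenation property
  enters here: it pastes the witnesses of countably many bad sets into one witness for their union,
  so a greatest bad set exists.\<close>

lemma exists_greatest_bad_set:
  assumes x: "x \<in> carrier E" and Q: "finite Q" "Q \<subseteq> P"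
  obtains D z where "D \<in> sets M" "D \<subseteq> A" "z \<in> carrier E"
    "AE w in M. w \<in> D \<longrightarrow> qn Q (z \<ominus>\<^bsub>E\<^esub> x) w \<le> e w \<and> F z w \<le> \<beta>"
    "\<forall>B y. B \<in> sets M \<and> B \<subseteq> A \<and> y \<in> carrier E \<and> (AE w in M. w \<in> B \<longrightarrow> qn Q (y \<ominus>\<^bsub>E\<^esub> x) w \<le> e w \<and> F y w \<le> \<beta>)
       \<longrightarrow> (AE w in M. w \<in> B \<longrightarrow> w \<in> D)"
proof -
  define K where "K B y \<longleftrightarrow> y \<in> carrier E \<and> (AE w in M. w \<in> B \<longrightarrow> qn Q (y \<ominus>\<^bsub>E\<^esub> x) w \<le> e w \<and> F y w \<le> \<beta>)" for B y
  define DD where "DD = {B. B \<in> sets M \<and> B \<subseteq> A \<and> (\<exists>y. K B y)}"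
  have sub: "DD \<subseteq> sets M" by (auto simp: DD_def)
  have "K {} x" using x by (simp add: K_def)
  then have ne: "DD \<noteq> {}" unfolding DD_def by blast
  have un: "(\<Union>n. X n) \<in> DD" if X: "range X \<subseteq> DD" for X :: "nat \<Rightarrow> 'w set"
  proof -
    have XD: "X n \<in> DD" for n using X by (simp add: image_subset_iff)
    have Xs: "X n \<in> sets M" "X n \<subseteq> A" "\<exists>y. K (X n) y" for n using XD[of n] by (simp_all add: DD_def)
    have "\<forall>n. \<exists>y. K (X n) y" using Xs(3) by (rule allI)
    then obtain y where y: "\<forall>n. K (X n) (y n)" by (elim choice[elim_format] exE)
    \<comment> \<open>Concatenation requires a partition of the whole space. Index 0 holds the
      complement of the union, filled with \<open>x\<close>; the disjointed pieces and their
      witnesses are shifted by one.\<close>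
    define A' where "A' n = (case n of 0 \<Rightarrow> space M - (\<Union>n. X n) | Suc k \<Rightarrow> disjointed X k)" for n
    define Y where "Y n = (case n of 0 \<Rightarrow> x | Suc k \<Rightarrow> y k)" for n
    have dX: "disjointed X k \<in> sets M" for k 
      using sets.range_disjointed_sets[of X M] Xs(1) by (simp add: image_subset_iff)
    have UX: "(\<Union>n. X n) \<in> sets M" by (rule sets.countable_UN) (use Xs(1) in \<open>simp add: image_subset_iff\<close>)
    have As: "A' n \<in> sets M" for n unfolding A'_def using UX by (cases n) (simp_all add: dX)
    have Yc: "Y n \<in> carrier E" for n unfolding Y_def using x y by (cases n) (simp_all add: K_def)
    have dj: "disjoint_family A'"
      unfolding disjoint_family_on_def
    proof (intro ballI impI)
      fix m n :: nat assume mn: "m \<noteq> n"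
      have d: "disjointed X i \<inter> disjointed X j = {}" if "i \<noteq> j" for i j
        using disjoint_family_disjointed[of X] that by (simp add: disjoint_family_on_def)
      have d0: "(space M - (\<Union>n. X n)) \<inter> disjointed X j = {}" for j using disjointed_subset[of X j] by blast
      show "A' m \<inter> A' n = {}"
        unfolding A'_def using mn d d0 by (cases m; cases n) (simp_all add: Int_commute)
    qed
    have UA: "(\<Union>n. A' n) = space M"
    proof -
      have A0: "A' 0 = space M - (\<Union>n. X n)" and AS: "A' (Suc k) = disjointed X k" for k
        by (simp_all add: A'_def)
      show ?thesis
      proof (intro subset_antisym subsetI)
        show "w \<in> space M" if "w \<in> (\<Union>n. A' n)" for w
          using that As sets.sets_into_space by fast
        fix w assume w: "w \<in> space M"
        show "w \<in> (\<Union>n. A' n)"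
        proof (cases "w \<in> (\<Union>n. X n)")
          case True
          then obtain k where "w \<in> disjointed X k" unfolding UN_disjointed_eq[of X, symmetric] by (elim UN_E)
          then show ?thesis using AS by (intro UN_I[of "Suc k"]) simp_all
        next
          case False
          with w A0 show ?thesis by (intro UN_I[of 0]) simp_all
        qed
      qed
    qed
    obtain z where z: "z \<in> carrier E" "\<forall>n. eqon (A' n) z (Y n)"
      by (rule concat_sequence[OF Yc As dj UA])
    have "AE w in M. w \<in> disjointed X k \<longrightarrow> qn Q (z \<ominus>\<^bsub>E\<^esub> x) w \<le> e w \<and> F z w \<le> \<beta>" for k
    proof -
      have yk: "y k \<in> carrier E" and Kk: "AE w in M. w \<in> X k \<longrightarrow> qn Q (y k \<ominus>\<^bsub>E\<^esub> x) w \<le> e w \<and> F (y k) w \<le> \<beta>"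
        using y by (simp_all add: K_def)
      have eq: "eqon (disjointed X k) z (y k)" using z(2)[rule_format, of "Suc k"] by (simp add: A'_def Y_def)
      have "AE w in M. w \<in> disjointed X k \<longrightarrow> qn Q (z \<ominus>\<^bsub>E\<^esub> x) w = qn Q (y k \<ominus>\<^bsub>E\<^esub> x) w"
        using z(1) x yk by (intro qn_eqon[OF Q _ _ dX eqon_minus[OF dX _ _ _ eq]]) simp_all
      with F_eqon[OF dX z(1) yk eq] Kk show ?thesis
      proof eventually_elim
        case (elim w)
        show ?case
        proof
          assume w: "w \<in> disjointed X k"
          then have "w \<in> X k" using disjointed_subset[of X k] by blast
          with elim w show "qn Q (z \<ominus>\<^bsub>E\<^esub> x) w \<le> e w \<and> F z w \<le> \<beta>" by simp
        qed
      qed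
    qed
    then have "AE w in M. \<forall>k. w \<in> disjointed X k \<longrightarrow> qn Q (z \<ominus>\<^bsub>E\<^esub> x) w \<le> e w \<and> F z w \<le> \<beta>"
      unfolding AE_all_countable by (rule allI)
    then have "AE w in M. w \<in> (\<Union>n. X n) \<longrightarrow> qn Q (z \<ominus>\<^bsub>E\<^esub> x) w \<le> e w \<and> F z w \<le> \<beta>"
      unfolding UN_disjointed_eq[of X, symmetric] by eventually_elim blast
    then have "K (\<Union>n. X n) z" using z(1) by (simp add: K_def)
    moreover note UX
    moreover have "(\<Union>n. X n) \<subseteq> A" using Xs(2) by blast
    ultimately show ?thesis unfolding DD_def by blast
  qed
  obtain D where D: "D \<in> DD" "\<forall>B\<in>DD. AE w in M. w \<in> B \<longrightarrow> w \<in> D"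
    by (rule exists_ae_greatest_set[OF sub ne un])
  have D1: "D \<in> sets M" "D \<subseteq> A" using D(1) by (simp_all add: DD_def)
  obtain z where z: "K D z" using D(1) unfolding DD_def by blast
  have max: "AE w in M. w \<in> B \<longrightarrow> w \<in> D" if "B \<in> sets M" "B \<subseteq> A" "K B y" for B y
  proof (rule bspec[OF D(2)])
    show "B \<in> DD" unfolding DD_def using that by blast
  qed
  show ?thesis
  proof (rule that[OF D1, of z], goal_cases)
    case 3
    show ?case
    proof (intro allI impI, elim conjE, rule max)
      fix B y assume "y \<in> carrier E" "AE w in M. w \<in> B \<longrightarrow> qn Q (y \<ominus>\<^bsub>E\<^esub> x) w \<le> e w \<and> F y w \<le> \<beta>"
      then show "K B y" by (simp add: K_def)
    qed
  qed (use z in \<open>simp_all add: K_def\<close>)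
qed

text \<open>The set \<open>B\<close> is found in \<open>A - D\<close>, where \<open>D\<close> is the
  greatest bad subset of \<open>A\<close> for the radius that separates from the epigraph. Off
  \<open>D\<close> no point can be near \<open>x\<close> and low on a nonnegligible part. The random
  radius is finally bounded below by \<open>1 / Suc n\<close> on a smaller set.\<close>

lemma lsc_nbhd:
  fixes \<beta> :: real
  assumes x: "x \<in> carrier E" and A: "nonnegligible M A" and less: "AE w in M. w \<in> A \<longrightarrow> ereal \<beta> < F x w"
  obtains B Q \<epsilon> where "nonnegligible M B" "B \<subseteq> A" "finite Q" "Q \<noteq> {}" "Q \<subseteq> P" "\<epsilon> > (0::real)"
    "\<forall>y\<in>carrier E. AE w in M. w \<in> B \<longrightarrow> qn Q (y \<ominus>\<^bsub>E\<^esub> x) w \<le> \<epsilon> \<longrightarrow> ereal \<beta> < F y w"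
proof -
  note As = nonnegligible_sets[OF A]
  obtain x0 where x0d: "x0 \<in> dom_fun M E f" by (rule dom_ne)
  note x0 = dom_carrier[OF x0d]
  \<comment> \<open>Off \<open>A\<close> the point is exchanged for one of the domain and the level
    \<open>s\<close> is set to its value, so that \<open>F x' \<le> s\<close> holds there. Being
    above the level is thereby a matter of \<open>A\<close> alone.\<close>
  define x' where "x' = glue A x x0"
  have x': "x' \<in> carrier E" unfolding x'_def using As x x0 by simp
  define s where "s w = (if w \<in> A then \<beta> else real_of_ereal (F x0 w))" for w
  have sm: "s \<in> borel_measurable M" unfolding s_def[abs_def]
    by (rule measurable_If_set) (use As x0 in simp_all)
  define r where "r = ae_class M s"
  have rc: "r \<in> carrier (L0 M)" unfolding r_def using sm by simp
  note rs = AE_rep_ae_class[OF sm, folded r_def]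
  note Fx' = F_glue[OF As x x0, folded x'_def]
  have "\<not> (AE w in M. F x' w \<le> ereal (rep r w))"
  proof
    assume "AE w in M. F x' w \<le> ereal (rep r w)"
    with rs Fx' less have "AE w in M. w \<notin> A"
    proof eventually_elim
      case (elim w) then show ?case by (auto simp: s_def)
    qed
    then show False using A by (simp add: nonnegligible_def)
  qed
  then obtain Q \<epsilon> where Q: "finite Q" "Q \<noteq> {}" "Q \<subseteq> P" "\<epsilon> \<in> L0_pos M"
    and sep: "\<forall>z\<in>carrier E. (AE w in M. qn Q (z \<ominus>\<^bsub>E\<^esub> x') w \<le> rep \<epsilon> w) \<longrightarrow> \<not> (AE w in M. F z w \<le> ereal (rep r w))"
    by (rule epi_separation[OF x' rc])
  have em: "rep \<epsilon> \<in> borel_measurable M" and epos: "AE w in M. 0 < rep \<epsilon> w" using Q(4) by (simp_all add: L0_pos_def)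
  obtain D z where D: "D \<in> sets M" "D \<subseteq> A" and z: "z \<in> carrier E"
    and Dz: "AE w in M. w \<in> D \<longrightarrow> qn Q (z \<ominus>\<^bsub>E\<^esub> x) w \<le> rep \<epsilon> w \<and> F z w \<le> ereal \<beta>"
    and max: "\<forall>B y. B \<in> sets M \<and> B \<subseteq> A \<and> y \<in> carrier E \<and>
       (AE w in M. w \<in> B \<longrightarrow> qn Q (y \<ominus>\<^bsub>E\<^esub> x) w \<le> rep \<epsilon> w \<and> F y w \<le> ereal \<beta>) \<longrightarrow> (AE w in M. w \<in> B \<longrightarrow> w \<in> D)"
    by (rule exists_greatest_bad_set[OF x Q(1,3)])
  \<comment> \<open>If \<open>D\<close> filled \<open>A\<close> up to a null set, the witness
    \<open>z\<close> on \<open>D\<close> glued to \<open>x'\<close> elsewhere would be within the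
    radius of \<open>x'\<close> and below the level almost everywhere, contrary to
    \<open>sep\<close>.\<close>
  have B0: "nonnegligible M (A - D)"
  proof (rule ccontr)
    assume "\<not> nonnegligible M (A - D)"
    then have AD: "AE w in M. w \<notin> A - D" using As D(1) by (simp add: nonnegligible_def)
    define z' where "z' = glue D z x'"
    have z': "z' \<in> carrier E" unfolding z'_def using D(1) z x' by simp
    have e1: "AE w in M. w \<in> D \<longrightarrow> qn Q (z' \<ominus>\<^bsub>E\<^esub> x') w = qn Q (z \<ominus>\<^bsub>E\<^esub> x') w"
      using z z' x' D(1) glue_eqon[OF D(1) z x', folded z'_def]
      by (intro qn_eqon[OF Q(1,3) _ _ D(1)] eqon_minus) simp_all
    have e2: "AE w in M. w \<in> A \<longrightarrow> qn Q (z \<ominus>\<^bsub>E\<^esub> x') w = qn Q (z \<ominus>\<^bsub>E\<^esub> x) w"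
      using z x' x As glue_eqon[OF As x x0, folded x'_def]
      by (intro qn_eqon[OF Q(1,3) _ _ As] eqon_minus_right) simp_all
    have e3: "AE w in M. w \<in> space M - D \<longrightarrow> qn Q (z' \<ominus>\<^bsub>E\<^esub> x') w = qn Q (x' \<ominus>\<^bsub>E\<^esub> x') w"
      using z z' x' D(1) glue_eqon_compl[OF D(1) z x', folded z'_def]
      by (intro qn_eqon[OF Q(1,3) _ _ _] eqon_minus) simp_all
    have "AE w in M. qn Q (z' \<ominus>\<^bsub>E\<^esub> x') w \<le> rep \<epsilon> w"
      using e1 e2 e3 Dz epos qn_minus_self[OF Q(1,3) x'] AE_space
    proof eventually_elim
      case (elim w)
      then show ?case using D(2) by (cases "w \<in> D") (simp_all add: subset_iff)
    qed
    moreover have "AE w in M. F z' w \<le> ereal (rep r w)"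
      using F_glue[OF D(1) z x', folded z'_def] Fx' rs Dz dom_finite[OF x0d] AD
    proof eventually_elim
      case (elim w)
      then show ?case using D(2) by (cases "w \<in> D"; cases "w \<in> A") (simp_all add: s_def subset_iff)
    qed
    ultimately show False using sep z' by simp
  qed
  have near: "AE w in M. w \<in> A - D \<longrightarrow> qn Q (y \<ominus>\<^bsub>E\<^esub> x) w \<le> rep \<epsilon> w \<longrightarrow> ereal \<beta> < F y w" if y: "y \<in> carrier E" for y
  proof -
    \<comment> \<open>The part of \<open>A - D\<close> on which \<open>y\<close> is near and low is
      itself a bad set with witness \<open>y\<close>; maximality puts it into \<open>D\<close> up to
      a null set, so it is null.\<close>
    define B where "B = {w \<in> space M. qn Q (y \<ominus>\<^bsub>E\<^esub> x) w \<le> rep \<epsilon> w \<and> F y w \<le> ereal \<beta>}"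
    have qm: "qn Q (y \<ominus>\<^bsub>E\<^esub> x) \<in> borel_measurable M" and Fm: "F y \<in> borel_measurable M"
      using Q(3) x y by simp_all
    have "B \<in> sets M" unfolding B_def using qm Fm em by measurable
    then have "(A - D) \<inter> B \<in> sets M" using As D(1) by simp
    moreover have "AE w in M. w \<in> (A - D) \<inter> B \<longrightarrow> qn Q (y \<ominus>\<^bsub>E\<^esub> x) w \<le> rep \<epsilon> w \<and> F y w \<le> ereal \<beta>"
      by (rule AE_I2) (simp add: B_def)
    moreover have "(A - D) \<inter> B \<subseteq> A" by blast
    ultimately have "AE w in M. w \<in> (A - D) \<inter> B \<longrightarrow> w \<in> D"
      by (intro max[rule_format, of "(A - D) \<inter> B" y] conjI y)
    with AE_space show ?thesis
      by eventually_elim (auto simp: B_def not_less)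
  qed
  have cover: "AE w in M. w \<in> A - D \<longrightarrow> (\<exists>n. 1 / real (Suc n) \<le> rep \<epsilon> w)"
    using epos by eventually_elim (metis nat_approx_posE less_imp_le)
  have Tm: "{w \<in> space M. 1 / real (Suc n) \<le> rep \<epsilon> w} \<in> sets M" for n using em by measurable
  obtain n C where C: "nonnegligible M C" "C \<subseteq> A - D" "\<forall>w\<in>C. 1 / real (Suc n) \<le> rep \<epsilon> w"
    by (rule nonnegligible_split[OF B0 Tm cover])
  show ?thesis
  proof (rule that[OF C(1) _ Q(1-3), of "1 / real (Suc n)"])
    show "C \<subseteq> A" using C(2) by blast
    show "\<forall>y\<in>carrier E. AE w in M. w \<in> C \<longrightarrow> qn Q (y \<ominus>\<^bsub>E\<^esub> x) w \<le> 1 / real (Suc n) \<longrightarrow> ereal \<beta> < F y w"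
    proof
      fix y assume "y \<in> carrier E"
      from near[OF this] show "AE w in M. w \<in> C \<longrightarrow> qn Q (y \<ominus>\<^bsub>E\<^esub> x) w \<le> 1 / real (Suc n) \<longrightarrow> ereal \<beta> < F y w"
      proof eventually_elim
        case (elim w)
        show ?case
        proof (intro impI)
          assume w: "w \<in> C" "qn Q (y \<ominus>\<^bsub>E\<^esub> x) w \<le> 1 / real (Suc n)"
          have "qn Q (y \<ominus>\<^bsub>E\<^esub> x) w \<le> rep \<epsilon> w" using w bspec[OF C(3) w(1)] by linarith
          moreover have "w \<in> A - D" using w C(2) by blast
          ultimately show "ereal \<beta> < F y w" using elim by simp
        qed
      qed
    qed
  qed simp
qed

end

context lsc_convex_function
begin

section \<open>Lower bounds by cones\<close>

text \<open>Near a domain point \<open>x0\<close> with \<open>\<bar>f x0\<bar> < m\<close> the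
  function exceeds \<open>-m\<close> on a ball of radius \<open>\<epsilon>\<close>. An arbitrary
  \<open>y\<close> is contracted towards \<open>x0\<close> into that ball, and convexity carries the
  bound back to \<open>y\<close>.\<close>

lemma dom_lower_bound:
  assumes A: "nonnegligible M A"
  obtains x0 B Q a b where "x0 \<in> carrier E" "nonnegligible M B" "B \<subseteq> A" "finite Q" "Q \<noteq> {}" "Q \<subseteq> P" "a \<ge> (0::real)" "b \<ge> (0::real)"
    "\<forall>y\<in>carrier E. AE w in M. w \<in> B \<longrightarrow> ereal (- a - b * qn Q (y \<ominus>\<^bsub>E\<^esub> x0) w) \<le> F y w"
proof -
  obtain x0 where x0d: "x0 \<in> dom_fun M E f" by (rule dom_ne)
  note x0 = dom_carrier[OF x0d]
  have Tm: "{w \<in> space M. \<bar>F x0 w\<bar> < ereal (real n)} \<in> sets M" for n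
    using F_measurable[OF x0] by measurable
  have cover: "AE w in M. w \<in> A \<longrightarrow> (\<exists>n. \<bar>F x0 w\<bar> < ereal (real n))"
    using dom_finite[OF x0d]
  proof eventually_elim
    case (elim w)
    obtain n where "\<bar>real_of_ereal (F x0 w)\<bar> < real n" using reals_Archimedean2 by blast
    then have "\<bar>F x0 w\<bar> < ereal (real n)" by (subst elim) simp
    then show ?case by blast
  qed
  obtain n A1 where A1: "nonnegligible M A1" "A1 \<subseteq> A" "\<forall>w\<in>A1. \<bar>F x0 w\<bar> < ereal (real n)"
    by (rule nonnegligible_split[OF A Tm cover])
  define m where "m = real n"
  have Fx0: "\<exists>r. F x0 w = ereal r \<and> - m < r \<and> r < m" if "w \<in> A1" for w
    using bspec[OF A1(3) that] by (cases "F x0 w") (simp_all add: m_def abs_less_iff)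
  have "AE w in M. w \<in> A1 \<longrightarrow> ereal (- m) < F x0 w"
    using Fx0 by (intro AE_I2) fastforce
  then obtain B Q \<epsilon> where B: "nonnegligible M B" "B \<subseteq> A1" and Q: "finite Q" "Q \<noteq> {}" "Q \<subseteq> P" and e: "\<epsilon> > (0::real)"
    and nb: "\<forall>y\<in>carrier E. AE w in M. w \<in> B \<longrightarrow> qn Q (y \<ominus>\<^bsub>E\<^esub> x0) w \<le> \<epsilon> \<longrightarrow> ereal (- m) < F y w"
    by (rule lsc_nbhd[OF x0 A1(1)])
  have "\<forall>y\<in>carrier E. AE w in M. w \<in> B \<longrightarrow> ereal (- (2 * m) - 2 * m / \<epsilon> * qn Q (y \<ominus>\<^bsub>E\<^esub> x0) w) \<le> F y w"
  proof
    fix y assume y: "y \<in> carrier E"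
    define q where "q = qn Q (y \<ominus>\<^bsub>E\<^esub> x0)"
    have qm: "q \<in> borel_measurable M" unfolding q_def using y x0 Q by simp
    \<comment> \<open>With this factor \<open>t * q \<le> \<epsilon>\<close>, and
      \<open>2 * m / t\<close> is affine in \<open>q\<close>. The maximum with 0 keeps
      \<open>t\<close> between 0 and 1 at every point, as \<open>q\<close> is nonnegative only
      almost surely.\<close>
    define t where "t w = \<epsilon> / (\<epsilon> + max 0 (q w))" for w
    have tm: "t \<in> borel_measurable M" unfolding t_def[abs_def] using qm by measurable
    have t01: "0 \<le> t w" "t w \<le> 1" "0 < t w" for w
      unfolding t_def using e by (auto simp: field_simps add_pos_nonneg)
    define z where "z = rsm t y \<oplus>\<^bsub>E\<^esub> rsm (\<lambda>w. 1 - t w) x0"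
    have z: "z \<in> carrier E" unfolding z_def using y x0 tm by simp
    have "rsm (\<lambda>w. 1 + - 1 * t w) x0 = rsm (\<lambda>_. 1) x0 \<oplus>\<^bsub>E\<^esub> rsm (\<lambda>w. - 1 * t w) x0"
      by (rule rsm_add) (use tm x0 in simp_all)
    also have "rsm (\<lambda>w. - 1 * t w) x0 = rsm (\<lambda>_. - 1) (rsm t x0)"
      by (rule rsm_rsm[symmetric]) (use tm x0 in simp_all)
    also have "\<dots> = \<ominus>\<^bsub>E\<^esub> rsm t x0" by (rule rsm_minus_one) (use tm x0 in simp)
    finally have "rsm (\<lambda>w. 1 - t w) x0 = x0 \<oplus>\<^bsub>E\<^esub> \<ominus>\<^bsub>E\<^esub> rsm t x0" using x0 by simp
    then have zx: "z \<ominus>\<^bsub>E\<^esub> x0 = rsm t (y \<ominus>\<^bsub>E\<^esub> x0)"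
      unfolding z_def using x0 y tm by (simp add: M.minus_eq rsm_distr rsm_r_minus M.a_ac M.r_neg1 M.r_neg2)
    have q_z: "AE w in M. qn Q (z \<ominus>\<^bsub>E\<^esub> x0) w = \<bar>t w\<bar> * q w"
      unfolding zx q_def by (rule qn_rsm) (use Q x0 y tm in simp_all)
    have Fz: "AE w in M. F z w \<le> ereal (t w) * F y w + ereal (1 - t w) * F x0 w"
      unfolding z_def by (rule F_convex[OF tm t01(1,2) y x0])
    have qnn: "AE w in M. 0 \<le> q w" unfolding q_def by (rule qn_nonneg) (use Q x0 y in simp_all)
    show "AE w in M. w \<in> B \<longrightarrow> ereal (- (2 * m) - 2 * m / \<epsilon> * qn Q (y \<ominus>\<^bsub>E\<^esub> x0) w) \<le> F y w"
      using bspec[OF nb z] q_z Fz qnn F_gt[OF y]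
    proof eventually_elim
      case (elim w)
      show ?case
      proof (intro impI)
        assume w: "w \<in> B"
        obtain r where r: "F x0 w = ereal r" "- m < r" "r < m" using Fx0 w B(2) by blast
        have tq: "t w = \<epsilon> / (\<epsilon> + q w)" using elim(4) by (simp add: t_def)
        have "t w * q w \<le> \<epsilon>"
          unfolding tq using e elim(4) by (simp add: field_simps add_pos_nonneg)
        then have lt: "ereal (- m) < F z w" using elim(1,2) w t01[of w] by simp
        show "ereal (- (2 * m) - 2 * m / \<epsilon> * qn Q (y \<ominus>\<^bsub>E\<^esub> x0) w) \<le> F y w"
        proof (cases "F y w")
          case (real s)
          have "ereal (- m) < ereal (t w) * F y w + ereal (1 - t w) * F x0 w" using lt elim(3) by (rule less_le_trans)
          then have "- m < t w * s + (1 - t w) * r" by (simp add: real r(1))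
          also have "(1 - t w) * r \<le> (1 - t w) * m" using r t01[of w] by (intro mult_left_mono) simp_all
          also have "(1 - t w) * m \<le> 1 * m" using t01[of w] by (intro mult_right_mono) (simp_all add: m_def)
          finally have "- (2 * m) < t w * s" by simp
          then have "- (2 * m) / t w < s" using pos_divide_less_eq[OF t01(3), of "- (2 * m)" w s] by (simp only: mult.commute[of s])
          moreover have "- (2 * m) / t w = - (2 * m) - 2 * m / \<epsilon> * q w"
            unfolding tq using e by (simp add: field_simps)
          ultimately show ?thesis by (simp add: real q_def)
        next
          case MInf then show ?thesis using elim(5) by simp
        qed simp
      qed
    qed
  qed
  moreover have "0 \<le> 2 * m" "0 \<le> 2 * m / \<epsilon>" using e by (simp_all add: m_def)
  moreover have "B \<subseteq> A" using B A1 by blast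
  ultimately show ?thesis using that[OF x0 B(1) _ Q, of "2 * m" "2 * m / \<epsilon>"] by simp
qed

text \<open>Near \<open>x\<close> the value exceeds \<open>c\<close> by \<open>lsc_nbhd\<close>.
  Farther away the affine bound around \<open>x0\<close> takes over, and a steep enough cone with
  apex value \<open>c\<close> at \<open>x\<close> lies below it.\<close>

lemma cone_bound:
  fixes c :: real
  assumes x: "x \<in> carrier E" and A: "nonnegligible M A" and less: "AE w in M. w \<in> A \<longrightarrow> ereal c < F x w"
  obtains B Q N where "nonnegligible M B" "B \<subseteq> A" "finite Q" "Q \<noteq> {}" "Q \<subseteq> P" "N > (0::real)"
    "\<forall>y\<in>carrier E. AE w in M. w \<in> B \<longrightarrow> ereal (c - N * qn Q (y \<ominus>\<^bsub>E\<^esub> x) w) \<le> F y w"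
proof -
  obtain x0 A1 Q1 a b where x0: "x0 \<in> carrier E" and A1: "nonnegligible M A1" "A1 \<subseteq> A"
    and Q1: "finite Q1" "Q1 \<noteq> {}" "Q1 \<subseteq> P" and ab: "a \<ge> (0::real)" "b \<ge> (0::real)"
    and low: "\<forall>y\<in>carrier E. AE w in M. w \<in> A1 \<longrightarrow> ereal (- a - b * qn Q1 (y \<ominus>\<^bsub>E\<^esub> x0) w) \<le> F y w"
    by (rule dom_lower_bound[OF A])
  have "AE w in M. w \<in> A1 \<longrightarrow> ereal c < F x w" using less by eventually_elim (use A1(2) in blast)
  then obtain A2 Q2 \<epsilon> where A2: "nonnegligible M A2" "A2 \<subseteq> A1" and Q2: "finite Q2" "Q2 \<noteq> {}" "Q2 \<subseteq> P" and e: "\<epsilon> > (0::real)"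
    and nb: "\<forall>y\<in>carrier E. AE w in M. w \<in> A2 \<longrightarrow> qn Q2 (y \<ominus>\<^bsub>E\<^esub> x) w \<le> \<epsilon> \<longrightarrow> ereal c < F y w"
    by (rule lsc_nbhd[OF x A1(1)])
  define Q where "Q = Q1 \<union> Q2"
  have Q: "finite Q" "Q \<noteq> {}" "Q \<subseteq> P" and QQ: "Q1 \<subseteq> Q" "Q2 \<subseteq> Q" using Q1 Q2 by (simp_all add: Q_def)
  have dm: "qn Q (x \<ominus>\<^bsub>E\<^esub> x0) \<in> borel_measurable M" using Q x x0 by simp
  have Tm: "{w \<in> space M. qn Q (x \<ominus>\<^bsub>E\<^esub> x0) w \<le> real n} \<in> sets M" for n using dm by measurable
  have cover: "AE w in M. w \<in> A2 \<longrightarrow> (\<exists>n. qn Q (x \<ominus>\<^bsub>E\<^esub> x0) w \<le> real n)"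
    by (intro AE_I2 impI real_arch_simple)
  obtain k B where B: "nonnegligible M B" "B \<subseteq> A2" "\<forall>w\<in>B. qn Q (x \<ominus>\<^bsub>E\<^esub> x0) w \<le> real k"
    by (rule nonnegligible_split[OF A2(1) Tm cover])
  define R where "R = \<bar>c\<bar> + a + b * real k"
  have R: "R \<ge> 0" using ab by (simp add: R_def)
  define N where "N = b + R / \<epsilon> + 1"
  have N: "N > 0" using ab R e by (simp add: N_def add_nonneg_pos)
  have "\<forall>y\<in>carrier E. AE w in M. w \<in> B \<longrightarrow> ereal (c - N * qn Q (y \<ominus>\<^bsub>E\<^esub> x) w) \<le> F y w"
  proof
    fix y assume y: "y \<in> carrier E"
    have c1: "y \<ominus>\<^bsub>E\<^esub> x \<in> carrier E" and c2: "x \<ominus>\<^bsub>E\<^esub> x0 \<in> carrier E" and c3: "y \<ominus>\<^bsub>E\<^esub> x0 \<in> carrier E" using x x0 y by simp_all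
    have eq: "(y \<ominus>\<^bsub>E\<^esub> x) \<oplus>\<^bsub>E\<^esub> (x \<ominus>\<^bsub>E\<^esub> x0) = y \<ominus>\<^bsub>E\<^esub> x0"
      using x x0 y by (simp add: M.minus_eq M.a_assoc M.r_neg1)
    show "AE w in M. w \<in> B \<longrightarrow> ereal (c - N * qn Q (y \<ominus>\<^bsub>E\<^esub> x) w) \<le> F y w"
      using bspec[OF low y] bspec[OF nb y] qn_mono[OF Q(1) QQ(2) Q(3) c1] qn_mono[OF Q(1) QQ(1) Q(3) c3]
        qn_triangle[OF Q(1,3) c1 c2, unfolded eq] qn_nonneg[OF Q(1,3) c1]
    proof eventually_elim
      case (elim w)
      define q where "q = qn Q (y \<ominus>\<^bsub>E\<^esub> x) w"
      show ?case
      proof (intro impI)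
        assume w: "w \<in> B"
        show "ereal (c - N * qn Q (y \<ominus>\<^bsub>E\<^esub> x) w) \<le> F y w"
        proof (cases "q \<le> \<epsilon>")
          case True
          then have "ereal c < F y w" using elim(2,3) w B(2) by (auto simp: q_def)
          moreover have "ereal (c - N * q) \<le> ereal c" using N elim(6) by (simp add: q_def)
          ultimately show ?thesis unfolding q_def by (meson less_imp_le order_trans)
        next
          case False
          have "qn Q1 (y \<ominus>\<^bsub>E\<^esub> x0) w \<le> q + real k" using elim(4,5) bspec[OF B(3) w] unfolding q_def by linarith
          then have "b * qn Q1 (y \<ominus>\<^bsub>E\<^esub> x0) w \<le> b * (q + real k)" using ab by (intro mult_left_mono)
          then have 1: "- a - b * q - b * real k \<le> - a - b * qn Q1 (y \<ominus>\<^bsub>E\<^esub> x0) w" by (simp add: algebra_simps)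
          have "R * 1 \<le> R * (q / \<epsilon>)" using False e R by (intro mult_left_mono) (simp_all add: field_simps)
          moreover have "N * q = b * q + R * (q / \<epsilon>) + q" by (simp add: N_def algebra_simps)
          moreover have "0 \<le> q" using False e by simp
          ultimately have "b * q + R \<le> N * q" by simp
          then have "c - N * q \<le> - a - b * q - b * real k" by (simp add: R_def)
          with 1 have "ereal (c - N * q) \<le> ereal (- a - b * qn Q1 (y \<ominus>\<^bsub>E\<^esub> x0) w)" by simp
          also have "\<dots> \<le> F y w" using elim(1) w B(2) A2(2) by blast
          finally show ?thesis by (simp add: q_def)
        qed
      qed
    qed
  qed
  moreover have "B \<subseteq> A" using B A2 A1 by blast
  ultimately show ?thesis using that[OF B(1) _ Q N] by simp
qed

end

section \<open>Additive maps dominated by seminorms\<close>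

context random_locally_convex_module
begin

text \<open>Domination by the local \<open>qn Q\<close> makes \<open>g\<close> local, additivity
  gives integer factors, and together they give integer-valued random factors. Replacing
  \<open>Suc k * \<xi>\<close> by its floor costs at most \<open>2 * N * qn Q u\<close>, whatever
  \<open>k\<close>, so dividing by \<open>Suc k\<close> leaves no error in the limit.\<close>

lemma additive_bounded_imp_linear:
  assumes gm: "\<forall>u\<in>carrier E. g u \<in> borel_measurable M"
    and gb: "\<forall>u\<in>carrier E. AE w in M. \<bar>g u w\<bar> \<le> N * qn Q u w"
    and ga: "\<forall>u\<in>carrier E. \<forall>v\<in>carrier E. AE w in M. g (u \<oplus>\<^bsub>E\<^esub> v) w = g u w + g v w"
    and Q: "finite Q" "Q \<subseteq> P" and u: "u \<in> carrier E" and \<xi>: "\<xi> \<in> borel_measurable M"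
  shows "AE w in M. g (rsm \<xi> u) w = \<xi> w * g u w"
proof -
  have local: "AE w in M. w \<in> A \<longrightarrow> g v w = g (rsm (indicator A) v) w"
    if A: "A \<in> sets M" and v: "v \<in> carrier E" for A v
  proof -
    have m: "(indicator A :: 'w \<Rightarrow> real) \<in> borel_measurable M" "(\<lambda>w. 1 - indicator A w :: real) \<in> borel_measurable M" using A by simp_all
    \<comment> \<open>The part of \<open>v\<close> off \<open>A\<close> has seminorm 0 on
      \<open>A\<close>, hence so does its image under \<open>g\<close>.\<close>
    let ?c = "rsm (\<lambda>w. 1 - indicator A w) v"
    have c: "?c \<in> carrier E" "rsm (indicator A) v \<in> carrier E" using m v by simp_all
    have "rsm (indicator A) v \<oplus>\<^bsub>E\<^esub> ?c = v" using glue_same[OF A v] by (simp add: glue_def)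
    then have "AE w in M. g v w = g (rsm (indicator A) v) w + g ?c w"
      using bspec[OF bspec[OF ga c(2)] c(1)] by simp
    moreover have "AE w in M. qn Q ?c w = \<bar>1 - indicator A w\<bar> * qn Q v w" by (rule qn_rsm[OF Q v m(2)])
    moreover note bspec[OF gb c(1)]
    ultimately show ?thesis by eventually_elim (auto simp: indicator_def)
  qed
  have nat_hom: "AE w in M. g (rsm (\<lambda>_. real n) v) w = real n * g v w" if v: "v \<in> carrier E" for n v
  proof (induction n)
    case 0
    have "AE w in M. g \<zero>\<^bsub>E\<^esub> w = g \<zero>\<^bsub>E\<^esub> w + g \<zero>\<^bsub>E\<^esub> w"
      using bspec[OF bspec[OF ga M.zero_closed] M.zero_closed] by simp
    then show ?case using v by simp
  next
    case (Suc n)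
    have "rsm (\<lambda>_. real n + 1) v = rsm (\<lambda>_. real n) v \<oplus>\<^bsub>E\<^esub> rsm (\<lambda>_. 1) v" by (rule rsm_add) (use v in simp_all)
    then have "rsm (\<lambda>_. real (Suc n)) v = rsm (\<lambda>_. real n) v \<oplus>\<^bsub>E\<^esub> v" using v by (simp add: add.commute)
    moreover have "AE w in M. g (rsm (\<lambda>_. real n) v \<oplus>\<^bsub>E\<^esub> v) w = g (rsm (\<lambda>_. real n) v) w + g v w"
      using ga v by simp
    ultimately have "AE w in M. g (rsm (\<lambda>_. real (Suc n)) v) w = g (rsm (\<lambda>_. real n) v) w + g v w" by simp
    with Suc show ?case by eventually_elim (simp add: algebra_simps)
  qed
  have neg_hom: "AE w in M. g (\<ominus>\<^bsub>E\<^esub> v) w = - g v w" if v: "v \<in> carrier E" for v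
  proof -
    have "AE w in M. g (v \<oplus>\<^bsub>E\<^esub> \<ominus>\<^bsub>E\<^esub> v) w = g v w + g (\<ominus>\<^bsub>E\<^esub> v) w" using ga v by simp
    moreover have "AE w in M. g \<zero>\<^bsub>E\<^esub> w = 0" using nat_hom[of "\<zero>\<^bsub>E\<^esub>" 0] by simp
    ultimately show ?thesis unfolding M.r_neg[OF v] by eventually_elim simp
  qed
  have int_hom: "AE w in M. g (rsm (\<lambda>_. real_of_int j) v) w = real_of_int j * g v w" if v: "v \<in> carrier E" for j v
  proof (cases j rule: int_cases2)
    case (nonneg n) then show ?thesis using nat_hom[OF v, of n] by simp
  next
    case (nonpos n)
    have nv: "rsm (\<lambda>_. real n) v \<in> carrier E" using v by simp
    have "rsm (\<lambda>_. - 1) (rsm (\<lambda>_. real n) v) = rsm (\<lambda>_. - 1 * real n) v" by (rule rsm_rsm) (use v in simp_all)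
    then have eq: "rsm (\<lambda>_. real_of_int j) v = \<ominus>\<^bsub>E\<^esub> rsm (\<lambda>_. real n) v"
      using rsm_minus_one[OF nv] nonpos by simp
    from neg_hom[OF nv] nat_hom[OF v, of n] show ?thesis
      unfolding eq by eventually_elim (simp add: nonpos)
  qed
  have int_valued: "AE w in M. g (rsm (\<lambda>w. real_of_int (h w)) u) w = real_of_int (h w) * g u w"
    if h: "h \<in> M \<rightarrow>\<^sub>M count_space UNIV" for h
  proof -
    have hm: "(\<lambda>w. real_of_int (h w)) \<in> borel_measurable M" using h by measurable
    have "AE w in M. h w = j \<longrightarrow> g (rsm (\<lambda>w. real_of_int (h w)) u) w = real_of_int (h w) * g u w" for j
    proof -
      define A where "A = {w \<in> space M. h w = j}"
      have A: "A \<in> sets M" unfolding A_def using h by measurable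
      have im: "(indicator A :: 'w \<Rightarrow> real) \<in> borel_measurable M" using A by simp
      have "rsm (indicator A) (rsm (\<lambda>w. real_of_int (h w)) u) = rsm (\<lambda>w. indicator A w * real_of_int (h w)) u"
        by (rule rsm_rsm) (use im hm u in simp_all)
      also have "\<dots> = rsm (\<lambda>w. indicator A w * real_of_int j) u"
      proof (rule rsm_cong)
        show "AE w in M. indicator A w * real_of_int (h w) = indicator A w * real_of_int j"
          by (rule AE_I2) (simp add: A_def indicator_def)
      qed (use im hm in simp_all)
      also have "\<dots> = rsm (indicator A) (rsm (\<lambda>_. real_of_int j) u)"
        by (rule rsm_rsm[symmetric]) (use im u in simp_all)
      finally have eq: "rsm (indicator A) (rsm (\<lambda>w. real_of_int (h w)) u) = rsm (indicator A) (rsm (\<lambda>_. real_of_int j) u)" .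
      have "AE w in M. w \<in> A \<longrightarrow> g (rsm (\<lambda>w. real_of_int (h w)) u) w = g (rsm (indicator A) (rsm (\<lambda>w. real_of_int (h w)) u)) w"
        by (rule local[OF A]) (use hm u in simp)
      moreover have "AE w in M. w \<in> A \<longrightarrow> g (rsm (\<lambda>_. real_of_int j) u) w = g (rsm (indicator A) (rsm (\<lambda>w. real_of_int (h w)) u)) w"
        unfolding eq by (rule local[OF A]) (use u in simp)
      moreover note int_hom[OF u, of j] AE_space
      ultimately show ?thesis by eventually_elim (simp add: A_def)
    qed
    then have "AE w in M. \<forall>j. h w = j \<longrightarrow> g (rsm (\<lambda>w. real_of_int (h w)) u) w = real_of_int (h w) * g u w"
      unfolding AE_all_countable by (rule allI)
    then show ?thesis by eventually_elim simp
  qed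
  have approx: "AE w in M. real (Suc k) * \<bar>g (rsm \<xi> u) w - \<xi> w * g u w\<bar> \<le> 2 * N * qn Q u w" for k
  proof -
    define h where "h w = \<lfloor>real (Suc k) * \<xi> w\<rfloor>" for w
    have h: "h \<in> M \<rightarrow>\<^sub>M count_space UNIV" unfolding h_def[abs_def] using \<xi> by measurable
    have hm: "(\<lambda>w. real_of_int (h w)) \<in> borel_measurable M" using h by measurable
    \<comment> \<open>The fractional remainder has absolute value at most 1, so
      \<open>g (rsm d u)\<close> and \<open>d * g u\<close> are each bounded by
      \<open>N * qn Q u\<close>.\<close>
    define d where "d w = real (Suc k) * \<xi> w - real_of_int (h w)" for w
    have dm: "d \<in> borel_measurable M" unfolding d_def[abs_def] using \<xi> hm by simp
    have d01: "\<bar>d w\<bar> \<le> 1" for w unfolding d_def h_def by linarith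
    have ku: "rsm (\<lambda>_. real (Suc k)) (rsm \<xi> u) = rsm (\<lambda>w. real (Suc k) * \<xi> w) u" by (rule rsm_rsm) (use \<xi> u in simp_all)
    have "rsm (\<lambda>w. real_of_int (h w) + d w) u = rsm (\<lambda>w. real_of_int (h w)) u \<oplus>\<^bsub>E\<^esub> rsm d u"
      by (rule rsm_add) (use hm dm u in simp_all)
    then have split: "rsm (\<lambda>_. real (Suc k)) (rsm \<xi> u) = rsm (\<lambda>w. real_of_int (h w)) u \<oplus>\<^bsub>E\<^esub> rsm d u"
      unfolding ku d_def by simp
    have c: "rsm (\<lambda>w. real_of_int (h w)) u \<in> carrier E" "rsm d u \<in> carrier E" "rsm \<xi> u \<in> carrier E" using hm dm \<xi> u by simp_all
    have "AE w in M. g (rsm (\<lambda>_. real (Suc k)) (rsm \<xi> u)) w = g (rsm (\<lambda>w. real_of_int (h w)) u) w + g (rsm d u) w"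
      unfolding split using ga c by simp
    with nat_hom[OF c(3), of "Suc k"] int_valued[OF h] bspec[OF gb c(2)] bspec[OF gb u] qn_rsm[OF Q u dm] qn_nonneg[OF Q u]
    show ?thesis
    proof eventually_elim
      case (elim w)
      define G where "G = N * qn Q u w"
      have G0: "0 \<le> G" using elim(4) by (simp add: G_def)
      have "real (Suc k) * (g (rsm \<xi> u) w - \<xi> w * g u w) = g (rsm d u) w - d w * g u w"
        using elim(1,2,7) by (simp add: d_def algebra_simps)
      then have "real (Suc k) * \<bar>g (rsm \<xi> u) w - \<xi> w * g u w\<bar> = \<bar>g (rsm d u) w - d w * g u w\<bar>"
        by (metis abs_mult abs_of_nat)
      also have "\<dots> \<le> \<bar>g (rsm d u) w\<bar> + \<bar>d w\<bar> * \<bar>g u w\<bar>" by (simp add: abs_mult[symmetric])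
      also have "\<bar>g (rsm d u) w\<bar> \<le> \<bar>d w\<bar> * G" using elim(3,5) by (simp add: G_def mult.left_commute)
      also have "\<bar>d w\<bar> * G \<le> 1 * G" by (rule mult_right_mono[OF d01 G0])
      also have "\<bar>d w\<bar> * \<bar>g u w\<bar> \<le> 1 * G" using elim(4) d01 by (intro mult_mono) (simp_all add: G_def)
      finally show ?case by (simp add: G_def)
    qed
  qed
  then have "AE w in M. \<forall>k. real (Suc k) * \<bar>g (rsm \<xi> u) w - \<xi> w * g u w\<bar> \<le> 2 * N * qn Q u w"
    unfolding AE_all_countable by (rule allI)
  then show ?thesis
  proof eventually_elim
    case (elim w)
    show ?case
    proof (rule ccontr)
      assume "g (rsm \<xi> u) w \<noteq> \<xi> w * g u w"
      then have pos: "0 < \<bar>g (rsm \<xi> u) w - \<xi> w * g u w\<bar>" by simp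
      obtain k where "2 * N * qn Q u w < real k * \<bar>g (rsm \<xi> u) w - \<xi> w * g u w\<bar>"
        using ex_less_of_nat_mult[OF pos] by blast
      also have "\<dots> \<le> real (Suc k) * \<bar>g (rsm \<xi> u) w - \<xi> w * g u w\<bar>" by (intro mult_right_mono) simp_all
      also have "\<dots> \<le> 2 * N * qn Q u w" using elim by (rule spec)
      finally show False by simp
    qed
  qed
qed

lemma dual_cI:
  assumes gm: "\<forall>u\<in>carrier E. g u \<in> borel_measurable M"
    and gb: "\<forall>u\<in>carrier E. AE w in M. \<bar>g u w\<bar> \<le> N * qn Q u w"
    and ga: "\<forall>u\<in>carrier E. \<forall>v\<in>carrier E. AE w in M. g (u \<oplus>\<^bsub>E\<^esub> v) w = g u w + g v w"
    and Q: "finite Q" "Q \<noteq> {}" "Q \<subseteq> P" and N: "N > 0"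
  shows "(\<lambda>u. ae_class M (g u)) \<in> dual_c M E P"
proof -
  define G where "G u = ae_class M (g u)" for u
  have gmu: "g u \<in> borel_measurable M" if "u \<in> carrier E" for u using gm that by simp
  have Gc: "G u \<in> carrier (L0 M)" if "u \<in> carrier E" for u unfolding G_def by (rule L0_class_closed[OF gmu[OF that]])
  have Gr: "AE w in M. rep (G u) w = g u w" if "u \<in> carrier E" for u unfolding G_def by (rule AE_rep_ae_class[OF gmu[OF that]])
  have Ga: "G (x \<oplus>\<^bsub>E\<^esub> y) = G x \<oplus>\<^bsub>L0 M\<^esub> G y" if x: "x \<in> carrier E" and y: "y \<in> carrier E" for x y
  proof -
    have "G (x \<oplus>\<^bsub>E\<^esub> y) = ae_class M (\<lambda>w. g x w + g y w)"
      unfolding G_def by (rule ae_class_cong) (use x y gmu ga in simp_all)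
    then show ?thesis unfolding G_def using ae_class_add[OF gmu[OF x] gmu[OF y]] by simp
  qed
  have Gs: "G (a \<odot>\<^bsub>E\<^esub> x) = a \<otimes>\<^bsub>L0 M\<^esub> G x" if a: "a \<in> carrier (L0 M)" and x: "x \<in> carrier E" for a x
  proof -
    have am: "rep a \<in> borel_measurable M" using a by simp
    have ac: "ae_class M (rep a) = a" using a by (simp add: carrier_L0 ae_class_rep)
    have "AE w in M. g (rsm (rep a) x) w = rep a w * g x w"
      by (rule additive_bounded_imp_linear[OF gm gb ga Q(1,3) x am])
    then have "AE w in M. g (a \<odot>\<^bsub>E\<^esub> x) w = rep a w * g x w" by (simp add: rsm_def ac)
    then have "G (a \<odot>\<^bsub>E\<^esub> x) = ae_class M (\<lambda>w. rep a w * g x w)"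
      unfolding G_def using a x gmu by (intro ae_class_cong) simp_all
    also have "\<dots> = ae_class M (rep a) \<otimes>\<^bsub>L0 M\<^esub> ae_class M (g x)" by (rule ae_class_mult[OF am gmu[OF x]])
    finally show ?thesis by (simp add: ac G_def)
  qed
  have cont: "continuous_map (Tc M E P) (Tc_L0 M) G"
    unfolding continuous_map
  proof (intro conjI allI impI)
    show "G ` topspace (Tc M E P) \<subseteq> topspace (Tc_L0 M)"
      unfolding topspace_Tc_E topspace_Tc_L0 by (rule image_subsetI) (rule Gc)
    fix U assume U: "openin (Tc_L0 M) U"
    show "openin (Tc M E P) {x \<in> topspace (Tc M E P). G x \<in> U}"
      unfolding openin_Tc_E topspace_Tc_E
    proof (intro conjI ballI)
      show "{x \<in> carrier E. G x \<in> U} \<subseteq> carrier E" by simp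
      fix x assume "x \<in> {x \<in> carrier E. G x \<in> U}"
      then have x: "x \<in> carrier E" "G x \<in> U" by simp_all
      have "\<exists>\<epsilon>. \<epsilon> \<in> L0_pos M \<and> (\<forall>y\<in>carrier (L0 M). (AE w in M. \<bar>rep y w\<bar> \<le> rep \<epsilon> w) \<longrightarrow> G x \<oplus>\<^bsub>L0 M\<^esub> y \<in> U)"
        by (rule bspec[OF conjunct2[OF U[unfolded openin_Tc_L0]] x(2)])
      then obtain \<epsilon> where e: "\<epsilon> \<in> L0_pos M"
        and nb: "\<forall>y\<in>carrier (L0 M). (AE w in M. \<bar>rep y w\<bar> \<le> rep \<epsilon> w) \<longrightarrow> G x \<oplus>\<^bsub>L0 M\<^esub> y \<in> U" by (elim exE conjE)
      \<comment> \<open>The sum \<open>qn Q\<close> has \<open>card Q\<close> terms; bounding each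
        by \<open>\<epsilon> / K\<close> makes \<open>N * qn Q\<close> at most
        \<open>\<epsilon>\<close>.\<close>
      define K where "K = N * real (card Q)"
      have K: "K > 0" using N Q by (simp add: K_def card_gt_0_iff)
      have em: "rep \<epsilon> \<in> borel_measurable M" and ep: "AE w in M. 0 < rep \<epsilon> w" using e by (simp_all add: L0_pos_def)
      define \<delta> where "\<delta> = ae_class M (\<lambda>w. rep \<epsilon> w / K)"
      have m: "(\<lambda>w. rep \<epsilon> w / K) \<in> borel_measurable M" using em by simp
      note dr = AE_rep_ae_class[OF m, folded \<delta>_def]
      have dc: "\<delta> \<in> carrier (L0 M)" unfolding \<delta>_def by (rule L0_class_closed[OF m])
      have "AE w in M. 0 < rep \<delta> w" using dr ep by eventually_elim (use K in simp)
      then have dp: "\<delta> \<in> L0_pos M" using dc by (simp add: L0_pos_def)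
      have "x \<oplus>\<^bsub>E\<^esub> y \<in> {x \<in> carrier E. G x \<in> U}" if y: "y \<in> Tc_nbhd M E Q \<delta>" for y
      proof -
        have "y \<in> carrier E \<and> (\<forall>p\<in>Q. AE w in M. rep (p y) w \<le> rep \<delta> w)"
          using y by (subst (asm) Tc_nbhd_iff[OF seminorm_carrier[OF subsetD[OF Q(3)]] Q(1) dc])
        then have yc: "y \<in> carrier E" and yd: "\<forall>p\<in>Q. AE w in M. rep (p y) w \<le> rep \<delta> w" by simp_all
        have "AE w in M. \<forall>p\<in>Q. rep (p y) w \<le> rep \<delta> w"
          using yd Q(1) by (subst AE_ball_countable) (simp_all add: countable_finite)
        with dr bspec[OF gb yc] Gr[OF yc] have "AE w in M. \<bar>rep (G y) w\<bar> \<le> rep \<epsilon> w"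
        proof eventually_elim
          case (elim w)
          have "qn Q y w \<le> (\<Sum>p\<in>Q. rep \<epsilon> w / K)" unfolding qn_def using elim(1,4) by (intro sum_mono) simp
          then have "N * qn Q y w \<le> N * (real (card Q) * (rep \<epsilon> w / K))" using N by (intro mult_left_mono) simp_all
          also have "\<dots> = K * (rep \<epsilon> w / K)" by (simp only: K_def mult.assoc)
          also have "\<dots> = rep \<epsilon> w" using K by simp
          finally show ?case using elim(2,3) by simp
        qed
        then have "G x \<oplus>\<^bsub>L0 M\<^esub> G y \<in> U" using bspec[OF nb Gc[OF yc]] by simp
        then show ?thesis using x yc by (simp add: Ga)
      qed
      then have "finite Q \<and> Q \<noteq> {} \<and> Q \<subseteq> P \<and> \<delta> \<in> L0_pos M \<and> (\<forall>y\<in>Tc_nbhd M E Q \<delta>. x \<oplus>\<^bsub>E\<^esub> y \<in> {x \<in> carrier E. G x \<in> U})"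
        using Q dp by simp
      then show "\<exists>Q \<epsilon>. finite Q \<and> Q \<noteq> {} \<and> Q \<subseteq> P \<and> \<epsilon> \<in> L0_pos M \<and>
          (\<forall>y\<in>Tc_nbhd M E Q \<epsilon>. x \<oplus>\<^bsub>E\<^esub> y \<in> {x \<in> carrier E. G x \<in> U})" by (intro exI)
    qed
  qed
  have "G \<in> dual_c M E P"
    unfolding dual_c_def using Gc Ga Gs cont by simp
  then show ?thesis unfolding G_def[abs_def] .
qed

end

section \<open>The Fenchel-Moreau theorem\<close>

sublocale random_locally_convex_module \<subseteq> mag: measure_abelian_group M E
  by unfold_locales

context lsc_convex_function
begin

lemma dom_convex:
  assumes z: "z1 \<in> dom_fun M E f" "z2 \<in> dom_fun M E f" and l: "0 \<le> l" "l \<le> 1"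
  defines "z \<equiv> rsm (\<lambda>_. l) z1 \<oplus>\<^bsub>E\<^esub> rsm (\<lambda>_. 1 - l) z2"
  shows "z \<in> dom_fun M E f"
    and "AE w in M. real_of_ereal (F z w) \<le> l * real_of_ereal (F z1 w) + (1 - l) * real_of_ereal (F z2 w)"
proof -
  note zc = dom_carrier[OF z(1)] dom_carrier[OF z(2)]
  have z': "z \<in> carrier E" unfolding z_def using zc by simp
  have "AE w in M. F z w \<le> ereal l * F z1 w + ereal (1 - l) * F z2 w"
    unfolding z_def by (rule F_convex) (use l zc in simp_all)
  then have le: "AE w in M. F z w \<le> ereal (l * real_of_ereal (F z1 w) + (1 - l) * real_of_ereal (F z2 w))"
    using dom_finite[OF z(1)] dom_finite[OF z(2)]
  proof eventually_elim
    case (elim w)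
    obtain r1 r2 where "F z1 w = ereal r1" "F z2 w = ereal r2" using elim(2,3) by blast
    then show ?case using elim(1) by simp
  qed
  then have "AE w in M. F z w < \<infinity>" by eventually_elim (auto intro: le_less_trans)
  then show zd: "z \<in> dom_fun M E f" using z' by (simp add: dom_fun_def)
  from le dom_finite[OF zd]
  show "AE w in M. real_of_ereal (F z w) \<le> l * real_of_ereal (F z1 w) + (1 - l) * real_of_ereal (F z2 w)"
  proof eventually_elim
    case (elim w)
    then show ?case by (metis ereal_less_eq(3))
  qed
qed

text \<open>On \<open>A\<close>, the linear minorants of the sublinear functional
  \<open>u \<mapsto> inf {N \<parallel>u - t(z - x)\<parallel> + t(f z - c) | t \<ge> 0, z \<in> dom f}\<close>
  are the slopes bounded by \<open>N \<parallel>\<cdot>\<parallel>\<close> of affine minorants of \<open>f\<close> with value \<open>c\<close> at \<open>x\<close>.\<close>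

lemma exists_affine_minorant_on:
  fixes c N :: real
  assumes x: "x \<in> carrier E" and A: "A \<in> sets M" and Q: "finite Q" "Q \<noteq> {}" "Q \<subseteq> P" and N: "N > 0"
    and bound: "\<forall>y\<in>carrier E. AE w in M. w \<in> A \<longrightarrow> ereal (c - N * qn Q (y \<ominus>\<^bsub>E\<^esub> x) w) \<le> F y w"
  obtains G where "G \<in> dual_c M E P"
    "\<forall>z\<in>dom_fun M E f. AE w in M. w \<in> A \<longrightarrow> ereal (rep (G z) w - rep (G x) w + c) \<le> F z w"
proof -
  \<comment> \<open>Cutting off by the indicator makes the estimates known on \<open>A\<close> hold
    almost everywhere, both functions being 0 outside \<open>A\<close>.\<close>
  define qq where "qq u w = indicator A w * (N * qn Q u w)" for u w
  define \<phi> where "\<phi> z w = indicator A w * (real_of_ereal (F z w) - c)" for z w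
  have qqm: "qq u \<in> borel_measurable M" if "u \<in> carrier E" for u
    unfolding qq_def[abs_def] using Q A that by simp
  have \<phi>m: "\<phi> z \<in> borel_measurable M" if "z \<in> carrier E" for z
    unfolding \<phi>_def[abs_def] using A that by simp
  have qq_add: "AE w in M. qq (u \<oplus>\<^bsub>E\<^esub> v) w \<le> qq u w + qq v w" if "u \<in> carrier E" "v \<in> carrier E" for u v
    using qn_triangle[OF Q(1,3) that]
  proof eventually_elim
    case (elim w)
    then have "N * qn Q (u \<oplus>\<^bsub>E\<^esub> v) w \<le> N * qn Q u w + N * qn Q v w"
      using N by (simp add: distrib_left[symmetric])
    then show ?case by (simp add: qq_def indicator_def)
  qed
  have qq_rsm: "AE w in M. qq (rsm (\<lambda>_. t) u) w = t * qq u w" if "u \<in> carrier E" "0 \<le> t" for t u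
  proof -
    have "AE w in M. qn Q (rsm (\<lambda>_. t) u) w = \<bar>t\<bar> * qn Q u w" by (rule qn_rsm) (use Q that in simp_all)
    then show ?thesis by eventually_elim (use that in \<open>simp add: qq_def\<close>)
  qed
  have qq_minus: "AE w in M. qq (\<ominus>\<^bsub>E\<^esub> u) w = qq u w" if "u \<in> carrier E" for u
    using qn_minus[OF Q(1,3) that] by eventually_elim (simp add: qq_def)
  have qq_\<phi>: "AE w in M. 0 \<le> qq (z \<ominus>\<^bsub>E\<^esub> x) w + \<phi> z w" if z: "z \<in> dom_fun M E f" for z
    using bspec[OF bound dom_carrier[OF z]] dom_finite[OF z]
  proof eventually_elim
    case (elim w)
    obtain r where r: "F z w = ereal r" using elim(2) by blast
    show ?case using elim(1) by (cases "w \<in> A") (simp_all add: qq_def \<phi>_def r)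
  qed
  define V where "V u t z w = qq (u \<ominus>\<^bsub>E\<^esub> rsm (\<lambda>_. t) (z \<ominus>\<^bsub>E\<^esub> x)) w + t * \<phi> z w" for u t z w
  \<comment> \<open>The multipliers \<open>t\<close> are real constants; linearity over random
    scalars will come from \<open>additive_bounded_imp_linear\<close>.\<close>
  define S where "S u = {V u t z |t z. 0 \<le> t \<and> z \<in> dom_fun M E f}" for u
  obtain x0 where x0: "x0 \<in> dom_fun M E f" by (rule dom_ne)
  have "\<exists>m. is_ess_inf M (S u) m" if u: "u \<in> carrier E" for u
  proof (rule exists_is_ess_inf)
    show "S u \<subseteq> borel_measurable M"
    proof
      fix X assume "X \<in> S u"
      then obtain t z where X: "X = V u t z" and z: "z \<in> dom_fun M E f" unfolding S_def by blast
      show "X \<in> borel_measurable M"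
        unfolding X V_def[abs_def] using u x dom_carrier[OF z]
        by (intro borel_measurable_add borel_measurable_times borel_measurable_const qqm \<phi>m) simp_all
    qed
    have "V u 0 x0 \<in> S u" unfolding S_def using x0 by blast
    then show "S u \<noteq> {}" by blast
    fix X assume "X \<in> S u"
    then obtain t z where X: "X = V u t z" and t: "0 \<le> t" and z: "z \<in> dom_fun M E f" unfolding S_def by blast
    \<comment> \<open>The cone bound, scaled by \<open>t\<close>, says that
      \<open>qq d + t * \<phi> z\<close> is nonnegative; the triangle inequality between
      \<open>d\<close> and \<open>u\<close> then bounds every term below by
      \<open>- qq u\<close>.\<close>
    define d where "d = rsm (\<lambda>_. t) (z \<ominus>\<^bsub>E\<^esub> x)"
    have zx: "z \<ominus>\<^bsub>E\<^esub> x \<in> carrier E" using dom_carrier[OF z] x by simp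
    have d: "d \<in> carrier E" unfolding d_def using zx by simp
    have "(d \<ominus>\<^bsub>E\<^esub> u) \<oplus>\<^bsub>E\<^esub> u = d" using d u by (simp add: M.minus_eq M.a_assoc M.l_neg)
    then have "AE w in M. qq d w \<le> qq (d \<ominus>\<^bsub>E\<^esub> u) w + qq u w" using qq_add[of "d \<ominus>\<^bsub>E\<^esub> u" u] d u by simp
    moreover have "\<ominus>\<^bsub>E\<^esub> (u \<ominus>\<^bsub>E\<^esub> d) = d \<ominus>\<^bsub>E\<^esub> u" using d u by (simp add: M.minus_eq M.minus_add M.a_comm)
    then have "AE w in M. qq (d \<ominus>\<^bsub>E\<^esub> u) w = qq (u \<ominus>\<^bsub>E\<^esub> d) w" using qq_minus[of "u \<ominus>\<^bsub>E\<^esub> d"] d u by simp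
    moreover have "AE w in M. qq d w = t * qq (z \<ominus>\<^bsub>E\<^esub> x) w" unfolding d_def by (rule qq_rsm[OF zx t])
    moreover note qq_\<phi>[OF z]
    ultimately show "AE w in M. - qq u w \<le> X w"
      unfolding X
    proof eventually_elim
      case (elim w)
      have "0 \<le> t * (qq (z \<ominus>\<^bsub>E\<^esub> x) w + \<phi> z w)" using t elim(4) by simp
      then show ?case using elim by (simp add: V_def d_def[symmetric] distrib_left)
    qed
  qed
  then have "\<forall>u\<in>carrier E. \<exists>m. is_ess_inf M (S u) m" by (rule ballI)
  then obtain p where p': "\<forall>u\<in>carrier E. is_ess_inf M (S u) (p u)" by (elim bchoice[elim_format] exE)
  then have p: "is_ess_inf M (S u) (p u)" if "u \<in> carrier E" for u using that by (rule bspec)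
  have lower: "AE w in M. p u w \<le> V u t z w" if "u \<in> carrier E" "0 \<le> t" "z \<in> dom_fun M E f" for u t z
    by (rule is_ess_inf_lower[OF p[OF that(1)]]) (use that in \<open>auto simp: S_def\<close>)
  have sub: "mag.sublin p"
  proof (rule mag.sublin_ess_inf[OF p])
    fix u X assume u: "u \<in> carrier E" "X \<in> S (u \<oplus>\<^bsub>E\<^esub> u)"
    then obtain t z where X: "X = V (u \<oplus>\<^bsub>E\<^esub> u) t z" and t: "0 \<le> t" and z: "z \<in> dom_fun M E f" unfolding S_def by blast
    define e where "e = z \<ominus>\<^bsub>E\<^esub> x"
    have e: "e \<in> carrier E" unfolding e_def using dom_carrier[OF z] x by simp
    define v where "v = u \<ominus>\<^bsub>E\<^esub> rsm (\<lambda>_. t / 2) e"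
    have v: "v \<in> carrier E" unfolding v_def using u e by simp
    have "rsm (\<lambda>_. t / 2 + t / 2) e = rsm (\<lambda>_. t / 2) e \<oplus>\<^bsub>E\<^esub> rsm (\<lambda>_. t / 2) e" by (rule rsm_add) (use e in simp_all)
    then have te: "rsm (\<lambda>_. t) e = rsm (\<lambda>_. t / 2) e \<oplus>\<^bsub>E\<^esub> rsm (\<lambda>_. t / 2) e" by simp
    have "rsm (\<lambda>_. 1 + 1) v = rsm (\<lambda>_. 1) v \<oplus>\<^bsub>E\<^esub> rsm (\<lambda>_. 1) v" by (rule rsm_add) (use v in simp_all)
    then have "rsm (\<lambda>_. 2) v = v \<oplus>\<^bsub>E\<^esub> v" using v by simp
    also have "\<dots> = (u \<oplus>\<^bsub>E\<^esub> u) \<ominus>\<^bsub>E\<^esub> rsm (\<lambda>_. t) e"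
      unfolding v_def te using u e by (simp add: M.minus_eq M.minus_add M.a_ac)
    finally have "AE w in M. qq ((u \<oplus>\<^bsub>E\<^esub> u) \<ominus>\<^bsub>E\<^esub> rsm (\<lambda>_. t) e) w = 2 * qq v w" using qq_rsm[OF v, of 2] by simp
    moreover have "AE w in M. p u w \<le> V u (t / 2) z w" using lower u t z by simp
    ultimately show "AE w in M. 2 * p u w \<le> X w"
      unfolding X by eventually_elim (simp add: V_def e_def[symmetric] v_def[symmetric])
  next
    fix u v X Y assume u: "u \<in> carrier E" and v: "v \<in> carrier E" and XS: "X \<in> S u" and YS: "Y \<in> S v"
    obtain t1 z1 where X: "X = V u t1 z1" and t1: "0 \<le> t1" and z1: "z1 \<in> dom_fun M E f" using XS unfolding S_def by blast
    obtain t2 z2 where Y: "Y = V v t2 z2" and t2: "0 \<le> t2" and z2: "z2 \<in> dom_fun M E f" using YS unfolding S_def by blast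
    define t where "t = t1 + t2"
    \<comment> \<open>The two multiples combine into the multiple \<open>t\<close> of one domain
      point, the convex combination with weights \<open>t1 / t\<close> and \<open>t2 / t\<close>. If
      \<open>t = 0\<close>, both multipliers vanish and any weight in the unit interval would
      do.\<close>
    define l where "l = (if t = 0 then 0 else t1 / t)"
    have l01: "0 \<le> l" "l \<le> 1" using t1 t2 by (simp_all add: l_def t_def)
    have tl: "t * l = t1" using t1 t2 by (simp add: l_def) (simp add: t_def)
    then have "t * (1 - l) = t2" by (simp add: right_diff_distrib t_def)
    note l = l01 tl this
    define z where "z = rsm (\<lambda>_. l) z1 \<oplus>\<^bsub>E\<^esub> rsm (\<lambda>_. 1 - l) z2"
    have z: "z \<in> dom_fun M E f" and Fz: "AE w in M. real_of_ereal (F z w) \<le> l * real_of_ereal (F z1 w) + (1 - l) * real_of_ereal (F z2 w)"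
      unfolding z_def by (rule dom_convex[OF z1 z2 l(1,2)])+
    have tz: "rsm (\<lambda>_. t) (z \<ominus>\<^bsub>E\<^esub> x) = rsm (\<lambda>_. t1) (z1 \<ominus>\<^bsub>E\<^esub> x) \<oplus>\<^bsub>E\<^esub> rsm (\<lambda>_. t2) (z2 \<ominus>\<^bsub>E\<^esub> x)"
    proof -
      have zc: "z1 \<in> carrier E" "z2 \<in> carrier E" using z1 z2 by (simp_all add: dom_carrier)
      have "rsm (\<lambda>_. t1 + t2) x = rsm (\<lambda>_. t1) x \<oplus>\<^bsub>E\<^esub> rsm (\<lambda>_. t2) x" by (rule rsm_add) (use x in simp_all)
      moreover have "rsm (\<lambda>_. t) z = rsm (\<lambda>_. t1) z1 \<oplus>\<^bsub>E\<^esub> rsm (\<lambda>_. t2) z2"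
        unfolding z_def using zc l by (simp add: rsm_distr rsm_rsm)
      ultimately show ?thesis
        using zc x dom_carrier[OF z] by (simp add: M.minus_eq rsm_distr rsm_r_minus t_def[symmetric] M.minus_add M.a_ac)
    qed
    define d1 where "d1 = rsm (\<lambda>_. t1) (z1 \<ominus>\<^bsub>E\<^esub> x)"
    define d2 where "d2 = rsm (\<lambda>_. t2) (z2 \<ominus>\<^bsub>E\<^esub> x)"
    have d: "d1 \<in> carrier E" "d2 \<in> carrier E" unfolding d1_def d2_def using z1 z2 x by (simp_all add: dom_carrier)
    have "(u \<ominus>\<^bsub>E\<^esub> d1) \<oplus>\<^bsub>E\<^esub> (v \<ominus>\<^bsub>E\<^esub> d2) = (u \<oplus>\<^bsub>E\<^esub> v) \<ominus>\<^bsub>E\<^esub> (d1 \<oplus>\<^bsub>E\<^esub> d2)"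
      using u v d by (simp add: M.minus_eq M.minus_add M.a_ac)
    then have "AE w in M. qq ((u \<oplus>\<^bsub>E\<^esub> v) \<ominus>\<^bsub>E\<^esub> (d1 \<oplus>\<^bsub>E\<^esub> d2)) w \<le> qq (u \<ominus>\<^bsub>E\<^esub> d1) w + qq (v \<ominus>\<^bsub>E\<^esub> d2) w"
      using qq_add[of "u \<ominus>\<^bsub>E\<^esub> d1" "v \<ominus>\<^bsub>E\<^esub> d2"] u v d by simp
    moreover have "AE w in M. p (u \<oplus>\<^bsub>E\<^esub> v) w \<le> V (u \<oplus>\<^bsub>E\<^esub> v) t z w"
      using u v t1 t2 z by (intro lower) (simp_all add: t_def)
    moreover note Fz
    ultimately show "AE w in M. p (u \<oplus>\<^bsub>E\<^esub> v) w \<le> X w + Y w"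
      unfolding X Y
    proof eventually_elim
      case (elim w)
      have "\<phi> z w \<le> l * \<phi> z1 w + (1 - l) * \<phi> z2 w"
        using elim(3) by (simp add: \<phi>_def indicator_def algebra_simps)
      then have "t * \<phi> z w \<le> t * (l * \<phi> z1 w + (1 - l) * \<phi> z2 w)" using t1 t2 by (intro mult_left_mono) (simp_all add: t_def)
      also have "\<dots> = t1 * \<phi> z1 w + t2 * \<phi> z2 w" by (simp add: distrib_left mult.assoc[symmetric] l)
      finally show ?case using elim(1,2) by (simp add: V_def tz d1_def[symmetric] d2_def[symmetric])
    qed
  qed
  obtain g where gm: "\<forall>u\<in>carrier E. g u \<in> borel_measurable M"
    and gp: "\<forall>u\<in>carrier E. AE w in M. g u w \<le> p u w"
    and ga: "\<forall>u\<in>carrier E. \<forall>v\<in>carrier E. AE w in M. g (u \<oplus>\<^bsub>E\<^esub> v) w = g u w + g v w"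
    by (rule mag.hahn_banach_kantorovich[OF sub])
  have gq: "AE w in M. g u w \<le> qq u w" if u: "u \<in> carrier E" for u
  proof -
    \<comment> \<open>The term \<open>t = 0\<close> gives domination by \<open>qq\<close>; applied
      to \<open>u\<close> and its negative, this bounds the absolute value of
      \<open>g\<close>.\<close>
    have "u \<ominus>\<^bsub>E\<^esub> rsm (\<lambda>_. 0) (x0 \<ominus>\<^bsub>E\<^esub> x) = u" using u x dom_carrier[OF x0] by (simp add: M.minus_eq)
    then have "V u 0 x0 = qq u" by (simp add: V_def fun_eq_iff)
    then have "AE w in M. p u w \<le> qq u w" using lower[OF u _ x0, of 0] by simp
    with bspec[OF gp u] show ?thesis by eventually_elim simp
  qed
  have gb: "\<forall>u\<in>carrier E. AE w in M. \<bar>g u w\<bar> \<le> N * qn Q u w"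
  proof
    fix u assume u: "u \<in> carrier E"
    have z0: "AE w in M. g \<zero>\<^bsub>E\<^esub> w = 0"
    proof -
      have "AE w in M. g \<zero>\<^bsub>E\<^esub> w = g \<zero>\<^bsub>E\<^esub> w + g \<zero>\<^bsub>E\<^esub> w"
        using bspec[OF bspec[OF ga M.zero_closed] M.zero_closed] by simp
      then show ?thesis by simp
    qed
    have mu: "\<ominus>\<^bsub>E\<^esub> u \<in> carrier E" using u by simp
    from bspec[OF bspec[OF ga u] mu, unfolded M.r_neg[OF u]] z0 gq[OF u] gq[OF mu] qq_minus[OF u] qn_nonneg[OF Q(1,3) u]
    show "AE w in M. \<bar>g u w\<bar> \<le> N * qn Q u w"
    proof eventually_elim
      case (elim w)
      have "0 \<le> N * qn Q u w" using N elim(6) by simp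
      then have "qq u w \<le> N * qn Q u w" by (simp add: qq_def indicator_def)
      then show ?case using elim by linarith
    qed
  qed
  define G where "G u = ae_class M (g u)" for u
  have Gr: "AE w in M. rep (G u) w = g u w" if "u \<in> carrier E" for u
    unfolding G_def by (rule AE_rep_ae_class) (use gm that in simp)
  have "(\<lambda>u. ae_class M (g u)) \<in> dual_c M E P" by (rule dual_cI[OF gm gb ga Q N])
  then have GD: "G \<in> dual_c M E P" unfolding G_def[abs_def] .
  show ?thesis
  proof (rule that[OF GD], rule ballI)
    fix z assume z: "z \<in> dom_fun M E f"
    have zc: "z \<in> carrier E" by (rule dom_carrier[OF z])
    define e where "e = z \<ominus>\<^bsub>E\<^esub> x"
    have e: "e \<in> carrier E" unfolding e_def using zc x by simp
    have "e \<oplus>\<^bsub>E\<^esub> x = z" unfolding e_def using zc x by (simp add: M.minus_eq M.a_assoc M.l_neg)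
    then have add: "AE w in M. g z w = g e w + g x w" using bspec[OF bspec[OF ga e] x] by simp
    \<comment> \<open>At \<open>t = 1\<close> and \<open>u = e\<close> the seminorm part vanishes,
      leaving \<open>g e \<le> \<phi> z\<close>, the minorant inequality on
      \<open>A\<close>.\<close>
    have "V e 1 z w = qq (e \<ominus>\<^bsub>E\<^esub> e) w + \<phi> z w" for w unfolding V_def e_def[symmetric] using e by simp
    then have "AE w in M. p e w \<le> qq (e \<ominus>\<^bsub>E\<^esub> e) w + \<phi> z w" using lower[OF e _ z, of 1] by simp
    with bspec[OF gp e] add qn_minus_self[OF Q(1,3) e] Gr[OF zc] Gr[OF x] dom_finite[OF z]
    show "AE w in M. w \<in> A \<longrightarrow> ereal (rep (G z) w - rep (G x) w + c) \<le> F z w"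
    proof eventually_elim
      case (elim w)
      obtain r where r: "F z w = ereal r" using elim(6) by blast
      show ?case using elim(1-5,7) by (cases "w \<in> A") (simp_all add: qq_def \<phi>_def r)
    qed
  qed
qed

section \<open>Conjugates and the two inequalities\<close>

lemma dual_closed: "g \<in> dual_c M E P \<Longrightarrow> x \<in> carrier E \<Longrightarrow> g x \<in> carrier (L0 M)"
  unfolding dual_c_def by blast

text \<open>Linearity over random scalars, applied to the indicator, makes dual elements
  local.\<close>

lemma dual_eqon:
  assumes g: "g \<in> dual_c M E P" and A: "A \<in> sets M" and x: "x \<in> carrier E" and y: "y \<in> carrier E" and e: "eqon A x y"
  shows "AE w in M. w \<in> A \<longrightarrow> rep (g x) w = rep (g y) w"
proof -
  have m: "(indicator A :: 'w \<Rightarrow> real) \<in> borel_measurable M" using A by simp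
  have c: "ae_class M (indicator A) \<in> carrier (L0 M)" using m by (rule L0_class_closed)
  have gs: "g (a \<odot>\<^bsub>E\<^esub> v) = a \<otimes>\<^bsub>L0 M\<^esub> g v" if "a \<in> carrier (L0 M)" "v \<in> carrier E" for a v
    using g that unfolding dual_c_def by simp
  have r: "AE w in M. rep (g (rsm (indicator A) v)) w = indicator A w * rep (g v) w" if v: "v \<in> carrier E" for v
    using AE_rep_mult[OF c dual_closed[OF g v]] AE_rep_ae_class[OF m] unfolding rsm_def gs[OF c v]
    by eventually_elim simp
  from r[OF x] r[OF y] show ?thesis unfolding e[unfolded eqon_def]
    by eventually_elim (auto simp: indicator_def)
qed

lemma conjugate_terms: "g \<in> dual_c M E P \<Longrightarrow> (\<lambda>x. L0bar_diff M (to_L0bar M (g x)) (f x)) ` carrier E \<subseteq> carrier (L0bar M)"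
  by (rule image_subsetI) (simp add: dual_closed)

lemma conjugate_closed: "g \<in> dual_c M E P \<Longrightarrow> conjugate_c M E f g \<in> carrier (L0bar M)"
  unfolding conjugate_c_def by (rule sup_L0bar_closed[OF conjugate_terms])

lemma AE_conjugate_term:
  assumes "g \<in> dual_c M E P" "x \<in> carrier E"
  shows "AE w in M. rep (L0bar_diff M (to_L0bar M (g x)) (f x)) w = ereal (rep (g x) w) - F x w"
proof -
  have "AE w in M. rep (L0bar_diff M (to_L0bar M (g x)) (f x)) w = rep (to_L0bar M (g x)) w - F x w"
    by (rule AE_rep_L0bar_diff) (use assms dual_closed in simp_all)
  with AE_rep_to_L0bar[OF dual_closed[OF assms]] show ?thesis by eventually_elim simp
qed

lemma biconjugate_terms:
  "(\<lambda>g. L0bar_diff M (to_L0bar M (g x)) (conjugate_c M E f g)) ` dual_c M E P \<subseteq> carrier (L0bar M)" if "x \<in> carrier E"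
  by (rule image_subsetI) (simp add: dual_closed conjugate_closed that)

lemma AE_biconjugate_term:
  assumes "g \<in> dual_c M E P" "x \<in> carrier E"
  shows "AE w in M. rep (L0bar_diff M (to_L0bar M (g x)) (conjugate_c M E f g)) w = ereal (rep (g x) w) - rep (conjugate_c M E f g) w"
proof -
  have "AE w in M. rep (L0bar_diff M (to_L0bar M (g x)) (conjugate_c M E f g)) w = rep (to_L0bar M (g x)) w - rep (conjugate_c M E f g) w"
    by (rule AE_rep_L0bar_diff) (use assms dual_closed conjugate_closed in simp_all)
  with AE_rep_to_L0bar[OF dual_closed[OF assms]] show ?thesis by eventually_elim simp
qed

text \<open>The Fenchel-Young inequality for each \<open>g\<close>, rearranged. Properness excludes
  the value minus infinity of \<open>F x\<close>, for which the rearrangement would fail.\<close>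

lemma AE_biconjugate_le:
  assumes x: "x \<in> carrier E"
  shows "AE w in M. rep (biconjugate_c M E P f x) w \<le> F x w"
  unfolding biconjugate_c_def
proof (rule AE_sup_L0bar_le[OF biconjugate_terms[OF x] f_closed[OF x]])
  fix a assume "a \<in> (\<lambda>g. L0bar_diff M (to_L0bar M (g x)) (conjugate_c M E f g)) ` dual_c M E P"
  then obtain g where g: "g \<in> dual_c M E P" and a: "a = L0bar_diff M (to_L0bar M (g x)) (conjugate_c M E f g)" by (elim imageE)
  have "AE w in M. rep (L0bar_diff M (to_L0bar M (g x)) (f x)) w \<le> rep (conjugate_c M E f g) w"
    unfolding conjugate_c_def by (rule AE_le_sup_L0bar[OF conjugate_terms[OF g] imageI[OF x]])
  with AE_conjugate_term[OF g x] AE_biconjugate_term[OF g x] F_gt[OF x] show "AE w in M. rep a w \<le> F x w"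
    unfolding a
  proof eventually_elim
    case (elim w)
    then show ?case by (cases "F x w"; cases "rep (conjugate_c M E f g) w") auto
  qed
qed

text \<open>The minorant is known at domain points only, whereas the conjugate runs over all
  \<open>z\<close>, including those with \<open>F z\<close> infinite on just a part of the space.
  Locality of \<open>f\<close> and \<open>G\<close> bridges the gap.\<close>

lemma conjugate_le_of_minorant:
  assumes G: "G \<in> dual_c M E P" and x: "x \<in> carrier E" and A: "A \<in> sets M"
    and minor: "\<forall>z\<in>dom_fun M E f. AE w in M. w \<in> A \<longrightarrow> ereal (rep (G z) w - rep (G x) w + c) \<le> F z w"
  shows "AE w in M. w \<in> A \<longrightarrow> rep (conjugate_c M E f G) w \<le> ereal (rep (G x) w - c)"
proof -
  obtain x0 where x0: "x0 \<in> dom_fun M E f" by (rule dom_ne)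
  have Gxm: "rep (G x) \<in> borel_measurable M" by (rule L0_rep_measurable[OF dual_closed[OF G x]])
  \<comment> \<open>The value infinity off \<open>A\<close> turns a bound wanted on \<open>A\<close>
    only into an upper bound in the lattice.\<close>
  define b where "b = (\<lambda>w. if w \<in> A then ereal (rep (G x) w - c) else \<infinity>)"
  have bm: "b \<in> borel_measurable M" unfolding b_def by (rule measurable_If_set) (use A Gxm in simp_all)
  have "AE w in M. rep (conjugate_c M E f G) w \<le> rep (ae_class M b) w"
    unfolding conjugate_c_def
  proof (rule AE_sup_L0bar_le[OF conjugate_terms[OF G] L0bar_class_closed[OF bm]])
    fix a assume "a \<in> (\<lambda>x. L0bar_diff M (to_L0bar M (G x)) (f x)) ` carrier E"
    then obtain z where z: "z \<in> carrier E" and a: "a = L0bar_diff M (to_L0bar M (G z)) (f z)" by (elim imageE)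
    \<comment> \<open>On \<open>B\<close> the point \<open>z\<close> is kept; elsewhere, where its
      term is minus infinity, a domain point replaces it, so that the glued point lies in the
      domain.\<close>
    define B where "B = {w \<in> space M. F z w < \<infinity>}"
    have B: "B \<in> sets M" unfolding B_def using F_measurable[OF z] by measurable
    define z' where "z' = glue B z x0"
    have z'c: "z' \<in> carrier E" unfolding z'_def using B z dom_carrier[OF x0] by simp
    have Fz': "AE w in M. F z' w = (if w \<in> B then F z w else F x0 w)"
      unfolding z'_def by (rule F_glue[OF B z dom_carrier[OF x0]])
    have "AE w in M. F z' w < \<infinity>" using Fz' dom_finite[OF x0]
    proof eventually_elim
      case (elim w)
      then show ?case by (metis (no_types, lifting) B_def mem_Collect_eq ereal_less(5) less_ereal.simps(4))
    qed
    then have z'd: "z' \<in> dom_fun M E f" using z'c by (simp add: dom_fun_def)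
    have Gz': "AE w in M. w \<in> B \<longrightarrow> rep (G z') w = rep (G z) w"
      by (rule dual_eqon[OF G B z'c z]) (simp add: z'_def glue_eqon[OF B z dom_carrier[OF x0]])
    show "AE w in M. rep a w \<le> rep (ae_class M b) w"
      using AE_conjugate_term[OF G z] AE_rep_ae_class[OF bm] bspec[OF minor z'd] Gz' Fz' F_gt[OF z] AE_space
      unfolding a
    proof eventually_elim
      case (elim w)
      show ?case
      proof (cases "w \<in> A")
        case True
        show ?thesis
        proof (cases "F z w")
          case (real r)
          then have "w \<in> B" using elim(7) by (simp add: B_def)
          with elim True real show ?thesis by (simp add: b_def)
        next
          case PInf with elim(1) show ?thesis by simp
        next
          case MInf with elim(6) show ?thesis by simp
        qed
      next
        case False with elim(2) show ?thesis by (simp add: b_def)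
      qed
    qed
  qed
  with AE_rep_ae_class[OF bm] show ?thesis by eventually_elim (auto simp: b_def)
qed

lemma AE_le_biconjugate:
  assumes x: "x \<in> carrier E"
  shows "AE w in M. F x w \<le> rep (biconjugate_c M E P f x) w"
proof (rule ccontr)
  let ?B = "rep (biconjugate_c M E P f x)"
  assume neg: "\<not> ?thesis"
  have Bc: "biconjugate_c M E P f x \<in> carrier (L0bar M)"
    unfolding biconjugate_c_def by (rule sup_L0bar_closed[OF biconjugate_terms[OF x]])
  have Bm: "?B \<in> borel_measurable M" by (rule L0bar_rep_measurable[OF Bc])
  define A0 where "A0 = {w \<in> space M. ?B w < F x w}"
  have A0s: "A0 \<in> sets M" unfolding A0_def using Bm F_measurable[OF x] by measurable
  have A0: "nonnegligible M A0"
    unfolding nonnegligible_def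
  proof (intro conjI A0s notI)
    assume "AE w in M. w \<notin> A0"
    with AE_space have "AE w in M. F x w \<le> ?B w" by eventually_elim (simp add: A0_def not_less)
    with neg show False by (rule notE)
  qed
  \<comment> \<open>Rational levels between the two values are countable in number, so a single
    constant \<open>c\<close> separates them on a nonnegligible subset.\<close>
  define T where "T n w \<longleftrightarrow> ?B w < ereal (of_rat (from_nat n)) \<and> ereal (of_rat (from_nat n)) < F x w" for n w
  have Tm: "{w \<in> space M. T n w} \<in> sets M" for n
    unfolding T_def using Bm F_measurable[OF x] by measurable
  have cover: "AE w in M. w \<in> A0 \<longrightarrow> (\<exists>n. T n w)"
  proof (intro AE_I2 impI)
    fix w assume "w \<in> A0"
    then have "?B w < F x w" by (simp add: A0_def)
    then obtain r where r: "?B w < ereal r" "ereal r < F x w" using ereal_dense2 by blast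
    obtain r2 where r2: "ereal r < ereal r2" "ereal r2 < F x w" using ereal_dense2[OF r(2)] by blast
    then obtain q where q: "r < of_rat q" "of_rat q < r2" using of_rat_dense[of r r2] by auto
    have "?B w < ereal (of_rat q)" using r(1) q(1) less_trans[of "?B w" "ereal r" "ereal (of_rat q)"] by simp
    moreover have "ereal (of_rat q) < F x w" using r2(2) q(2) less_trans[of "ereal (of_rat q)" "ereal r2" "F x w"] by simp
    ultimately have "T (to_nat q) w" by (simp add: T_def)
    then show "\<exists>n. T n w" by (rule exI)
  qed
  obtain n A where A: "nonnegligible M A" "A \<subseteq> A0" "\<forall>w\<in>A. T n w"
    by (rule nonnegligible_split[OF A0 Tm cover])
  define c :: real where "c = of_rat (from_nat n)"
  have "AE w in M. w \<in> A \<longrightarrow> ereal c < F x w" using A(3) by (intro AE_I2) (simp add: T_def c_def)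
  then obtain A' Q N where A': "nonnegligible M A'" "A' \<subseteq> A" and Q: "finite Q" "Q \<noteq> {}" "Q \<subseteq> P" and N: "N > (0::real)"
    and bound: "\<forall>y\<in>carrier E. AE w in M. w \<in> A' \<longrightarrow> ereal (c - N * qn Q (y \<ominus>\<^bsub>E\<^esub> x) w) \<le> F y w"
    by (rule cone_bound[OF x A(1)])
  note A's = nonnegligible_sets[OF A'(1)]
  obtain G where G: "G \<in> dual_c M E P"
    and minor: "\<forall>z\<in>dom_fun M E f. AE w in M. w \<in> A' \<longrightarrow> ereal (rep (G z) w - rep (G x) w + c) \<le> F z w"
    by (rule exists_affine_minorant_on[OF x A's Q N bound])
  have "AE w in M. rep (L0bar_diff M (to_L0bar M (G x)) (conjugate_c M E f G)) w \<le> ?B w"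
    unfolding biconjugate_c_def by (rule AE_le_sup_L0bar[OF biconjugate_terms[OF x] imageI[OF G]])
  with conjugate_le_of_minorant[OF G x A's minor] AE_biconjugate_term[OF G x]
  have "AE w in M. w \<notin> A'"
  proof eventually_elim
    case (elim w)
    show ?case
    proof
      assume w: "w \<in> A'"
      then have "?B w < ereal c" using A'(2) A(3) by (auto simp: T_def c_def)
      \<comment> \<open>The single dual element \<open>G\<close> already contributes at least
        \<open>c\<close> to the biconjugate on \<open>A'\<close>.\<close>
      moreover have "ereal c \<le> ereal (rep (G x) w) - rep (conjugate_c M E f G) w"
        using elim(1) w by (cases "rep (conjugate_c M E f G) w") auto
      ultimately show False using elim(2,3) by (metis leD order_trans)
    qed
  qed
  with A'(1) show False by (simp add: nonnegligible_def)
qed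

theorem biconjugate_eq:
  assumes x: "x \<in> carrier E"
  shows "biconjugate_c M E P f x = f x"
proof (rule class_eqI)
  show "biconjugate_c M E P f x \<in> borel_measurable M // ae_rel M"
    unfolding carrier_L0bar[symmetric] biconjugate_c_def by (rule sup_L0bar_closed[OF biconjugate_terms[OF x]])
  show "f x \<in> borel_measurable M // ae_rel M"
    unfolding carrier_L0bar[symmetric] by (rule f_closed[OF x])
  show "AE w in M. rep (biconjugate_c M E P f x) w = F x w"
    using AE_biconjugate_le[OF x] AE_le_biconjugate[OF x] by eventually_elim (rule order.antisym)
qed

end

theorem theorem5p5:
  fixes M :: "'w measure"
    and E :: "(('w \<Rightarrow> real) set, 'e) module"
    and P :: "('e \<Rightarrow> ('w \<Rightarrow> real) set) set"
    and f :: "'e \<Rightarrow> ('w \<Rightarrow> ereal) set"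
  assumes "random_locally_convex_module M E P"
    and "countable_concatenation M E"
    and "f \<in> carrier E \<rightarrow> carrier (L0bar M)"
    and "proper_fun M E f"
    and "Tc_lsc M E P f"
    and "L0_convex M E f"
  shows "\<forall>x\<in>carrier E. biconjugate_c M E P f x = f x"
proof -
  interpret lsc_convex_function M E P f
    by (intro lsc_convex_function.intro lsc_convex_function_axioms.intro assms)
  show ?thesis by (intro ballI biconjugate_eq)
qed

end
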